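(* Let $g\ge 1$ and $n\ge 1$. The space $\operatorname{Conf}_n(R_g)^+$ admits a cellular decomposition consisting of a single $0$-cell (the point $\infty$), together with $n!\cdot\binom{n+g-1}{g-1}$ cells in dimension $n$ and $n!\cdot\binom{n+g-2}{n-1}$ cells in dimension $n-1$. For $k\in\{n-1,n\}$, the $k$-dimensional cells are labelled by total orderings of $k$-element subsets $S\subseteq\{1,\dots,n\}$, separated by $g-1$ bars, \[ (\sigma_1\sigma_2\ldots\sigma_{j_1}|\sigma_{j_1+1}\ldots\sigma_{j_2}|\ldots|\sigma_{j_{g-1}+1}\ldots\sigma_k). \] The natural $S_n$-action freely permutes the $(n-1)$-cells and the $n$-cells. Consequently, there is a chain complex of free $\mathbb{Z}[S_n]$-modules \[ \mathbb{Z}[S_n]^{\binom{n+g-1}{g-1}}\xrightarrow{\ \partial\ }\mathbb{Z}[S_n]^{\binom{n+g-2}{g-1}}, \] with the modules placed in degrees $n$ and $n-1$ respectively, whose homology is isomorphic, $S_n$-equivariantly, to the reduced homology $\widetilde{H}_*(\operatorname{Conf}_n(R_g)^+)$.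
   Context: $R_g=\bigvee_{i=1}^g S^1$ is the rose graph, with unique vertex $v$. $\operatorname{Conf}_n(R_g)$ is the space of $n$-tuples of pairwise distinct points of $R_g$, and $\operatorname{Conf}_n(R_g)^+$ is its one-point compactification, with added point $\infty$; $S_n$ acts by permuting the labels. Let $\Xi_g=\bigcup_{i=1}^g(i-1,i)\subset\mathbb{R}$, with a fixed homeomorphism to $R_g\setminus\{v\}$ identifying the $i$-th interval with the $i$-th open petal. For $S\subseteq\{1,\dots,n\}$ with $|S|=k$, a total ordering $\sigma\colon\{1,\dots,k\}\to S$ (bijection, $\sigma_a=\sigma(a)$) and a nondecreasing function $\chi\colon\{1,\dots,k\}\to\{1,\dots,g\}$, the symbol $(\sigma_1\ldots\sigma_{j_1}|\ldots|\ldots\sigma_k)$, where $\chi^{-1}(1)=\{1,\dots,j_1\}$, $\chi^{-1}(2)=\{j_1+1,\dots,j_2\}$, etc. (blocks may be empty), denotes the set of configurations $(x_s)_{s\in S}$ of distinct points in $\Xi_g$ with $x_{\sigma_a}<x_{\sigma_b}$ iff $a<b$, and $x_{\sigma_a}\in(i-1,i)$ iff $\chi(a)=i$. For $k=n$ this is an open subset of $\operatorname{Conf}_n(R_g)$ (configurations with $v$ unoccupied); for $k=n-1$ it is regarded as a subset of $\operatorname{Conf}_n(R_g)$ by placing the point with the missing label at $v$. *)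

theory Defs
  imports "HOL-Analysis.Analysis" "HOL-Homology.Homology"
    "HOL-Algebra.Sym_Groups" "HOL-Algebra.Group_Action" "HOL-Algebra.Module"
begin

section \<open>The rose graph\<close>

definition quotient_topology :: "'a topology \<Rightarrow> ('a \<Rightarrow> 'b) \<Rightarrow> 'b topology"
  where "quotient_topology X q =
    topology (\<lambda>U. U \<subseteq> q ` topspace X \<and> openin X {x \<in> topspace X. q x \<in> U})"

lemma openin_quotient_topology:
  "openin (quotient_topology X q) U \<longleftrightarrow>
     U \<subseteq> q ` topspace X \<and> openin X {x \<in> topspace X. q x \<in> U}"
proof -
  have "istopology (\<lambda>U. U \<subseteq> q ` topspace X \<and> openin X {x \<in> topspace X. q x \<in> U})"
    unfolding istopology_def
  proof (intro conjI allI impI)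
    fix S T
    assume S: "S \<subseteq> q ` topspace X \<and> openin X {x \<in> topspace X. q x \<in> S}"
      and T: "T \<subseteq> q ` topspace X \<and> openin X {x \<in> topspace X. q x \<in> T}"
    have "{x \<in> topspace X. q x \<in> S \<inter> T} = {x \<in> topspace X. q x \<in> S} \<inter> {x \<in> topspace X. q x \<in> T}"
      by auto
    then show "openin X {x \<in> topspace X. q x \<in> S \<inter> T}"
      using S T by (simp add: openin_Int)
    show "S \<inter> T \<subseteq> q ` topspace X"
      using S by blast
  next
    fix \<K>
    assume K: "\<forall>K\<in>\<K>. K \<subseteq> q ` topspace X \<and> openin X {x \<in> topspace X. q x \<in> K}"
    have "{x \<in> topspace X. q x \<in> \<Union>\<K>} = (\<Union>K\<in>\<K>. {x \<in> topspace X. q x \<in> K})"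
      by auto
    then show "openin X {x \<in> topspace X. q x \<in> \<Union>\<K>}"
      using K by auto
    show "\<Union>\<K> \<subseteq> q ` topspace X"
      using K by blast
  qed
  then show ?thesis
    by (simp add: quotient_topology_def topology_inverse')
qed

lemma topspace_quotient_topology [simp]:
  "topspace (quotient_topology X q) = q ` topspace X"
proof
  show "topspace (quotient_topology X q) \<subseteq> q ` topspace X"
    using openin_topspace[of "quotient_topology X q"] unfolding openin_quotient_topology by (rule conjunct1)
  have "{x \<in> topspace X. q x \<in> q ` topspace X} = topspace X"
    by auto
  then show "q ` topspace X \<subseteq> topspace (quotient_topology X q)"
    by (intro openin_subset) (simp add: openin_quotient_topology)
qed

lemma quotient_map_quotient_topology: "quotient_map X (quotient_topology X q) q"
  by (auto simp: quotient_map_def openin_quotient_topology)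

text \<open>The wedge of \<open>g\<close> circles: in the disjoint union of \<open>g\<close> copies of the unit circle in the
  complex plane, all base points \<open>(i, 1)\<close> are collapsed to the single point \<open>None\<close>.\<close>

definition wedge_proj :: "nat \<times> complex \<Rightarrow> (nat \<times> complex) option"
  where "wedge_proj = (\<lambda>(i, z). if z = 1 then None else Some (i, z))"

definition rose :: "nat \<Rightarrow> (nat \<times> complex) option topology"
  where "rose g =
    quotient_topology (sum_topology (\<lambda>i. top_of_set (sphere 0 1)) {1..g}) wedge_proj"

definition rose_vertex :: "(nat \<times> complex) option"
  where "rose_vertex = None"

definition open_petal :: "nat \<Rightarrow> (nat \<times> complex) option set"
  where "open_petal i = wedge_proj ` ({i} \<times> (sphere 0 1 - {1}))"

definition Xi :: "nat \<Rightarrow> real set"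
  where "Xi g = (\<Union>i\<in>{1..g}. {real i - 1 <..< real i})"

definition petal_homeo :: "nat \<Rightarrow> (real \<Rightarrow> (nat \<times> complex) option) \<Rightarrow> bool"
  where "petal_homeo g h \<longleftrightarrow>
    homeomorphic_map (top_of_set (Xi g))
      (subtopology (rose g) (topspace (rose g) - {rose_vertex})) h \<and>
    (\<forall>i\<in>{1..g}. h ` {real i - 1 <..< real i} = open_petal i)"


section \<open>Configuration spaces\<close>

definition Conf :: "nat \<Rightarrow> 'a topology \<Rightarrow> (nat \<Rightarrow> 'a) topology"
  where "Conf n X = subtopology (product_topology (\<lambda>i. X) {1..n}) {x. inj_on x {1..n}}"

text \<open>The added point \<open>\<infinity>\<close> is \<open>None\<close>. If the space is already compact (as for \<open>n = 1\<close>), the added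
  point is isolated.\<close>

abbreviation Conf_plus :: "nat \<Rightarrow> 'a topology \<Rightarrow> (nat \<Rightarrow> 'a) option topology"
  where "Conf_plus n X \<equiv> Alexandroff_compactification (Conf n X)"

text \<open>The point labelled \<open>i\<close> gets the label \<open>p i\<close>; this is a left action.\<close>

definition conf_act :: "nat \<Rightarrow> (nat \<Rightarrow> nat) \<Rightarrow> (nat \<Rightarrow> 'a) option \<Rightarrow> (nat \<Rightarrow> 'a) option"
  where "conf_act n p = map_option (\<lambda>x. \<lambda>i\<in>{1..n}. x (inv' p i))"


section \<open>Cell labels and cells\<close>

text \<open>A bar symbol is a pair \<open>(\<sigma>, \<beta>)\<close> of lists of the same length \<open>k\<close>, the total ordering \<open>\<sigma>\<close> of
  \<open>S = set \<sigma>\<close> and the nondecreasing function \<open>\<beta>\<close> assigning petals to the positions \<open>0, \<dots>, k - 1\<close>.\<close>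

definition bar_symbols :: "nat \<Rightarrow> nat \<Rightarrow> nat \<Rightarrow> (nat list \<times> nat list) set"
  where "bar_symbols n g k =
    {(\<sigma>, \<beta>). length \<sigma> = k \<and> distinct \<sigma> \<and> set \<sigma> \<subseteq> {1..n} \<and>
             length \<beta> = k \<and> sorted \<beta> \<and> set \<beta> \<subseteq> {1..g}}"

definition symbol_configs :: "nat \<Rightarrow> nat list \<times> nat list \<Rightarrow> (nat \<Rightarrow> real) set"
  where "symbol_configs g = (\<lambda>(\<sigma>, \<beta>).
    {x \<in> set \<sigma> \<rightarrow>\<^sub>E Xi g.
       inj_on x (set \<sigma>) \<and>
       (\<forall>a<length \<sigma>. \<forall>b<length \<sigma>. x (\<sigma> ! a) < x (\<sigma> ! b) \<longleftrightarrow> a < b) \<and>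
       (\<forall>a<length \<sigma>. \<forall>i\<in>{1..g}. x (\<sigma> ! a) \<in> {real i - 1 <..< real i} \<longleftrightarrow> \<beta> ! a = i)})"

text \<open>The subset of the compactified configuration space given by a symbol; labels that do not
  occur in \<open>\<sigma>\<close> (at most one, when \<open>\<sigma>\<close> has length at least \<open>n - 1\<close>) are placed at the vertex.\<close>

definition symbol_cell ::
    "nat \<Rightarrow> nat \<Rightarrow> (real \<Rightarrow> (nat \<times> complex) option) \<Rightarrow> nat list \<times> nat list
      \<Rightarrow> (nat \<Rightarrow> (nat \<times> complex) option) option set"
  where "symbol_cell n g h w =
    (\<lambda>x. Some (\<lambda>s\<in>{1..n}. if s \<in> set (fst w) then h (x s) else rose_vertex)) ` symbol_configs g w"

definition symbol_cells ::
    "nat \<Rightarrow> nat \<Rightarrow> (real \<Rightarrow> (nat \<times> complex) option) \<Rightarrow> nat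
      \<Rightarrow> (nat \<Rightarrow> (nat \<times> complex) option) option set set"
  where "symbol_cells n g h k = symbol_cell n g h ` bar_symbols n g k"

text \<open>For \<open>n = 1\<close> the cells of dimension \<open>n - 1\<close> are \<open>0\<close>-cells besides \<open>\<infinity>\<close>.\<close>

definition all_cells ::
    "nat \<Rightarrow> nat \<Rightarrow> (real \<Rightarrow> (nat \<times> complex) option) \<Rightarrow> nat
      \<Rightarrow> (nat \<Rightarrow> (nat \<times> complex) option) option set set"
  where "all_cells n g h k =
    (if k = 0 then {{None}} else {}) \<union> (if k = n - 1 \<or> k = n then symbol_cells n g h k else {})"


section \<open>Cellular decompositions (CW structures)\<close>

definition unit_disc :: "nat \<Rightarrow> (nat \<Rightarrow> real) set"
  where "unit_disc k = {x \<in> topspace (Euclidean_space k). (\<Sum>i<k. (x i)\<^sup>2) \<le> 1}"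

definition open_unit_disc :: "nat \<Rightarrow> (nat \<Rightarrow> real) set"
  where "open_unit_disc k = {x \<in> topspace (Euclidean_space k). (\<Sum>i<k. (x i)\<^sup>2) < 1}"

text \<open>\<open>E k\<close> is the set of open cells of dimension \<open>k\<close>; \<open>\<Phi>\<close> is a characteristic map.\<close>

definition CW_decomposition :: "'a topology \<Rightarrow> (nat \<Rightarrow> 'a set set) \<Rightarrow> bool"
  where "CW_decomposition X E \<longleftrightarrow>
    Hausdorff_space X \<and>
    (\<Union>k. \<Union>(E k)) = topspace X \<and>
    (\<forall>k l. \<forall>c\<in>E k. \<forall>d\<in>E l. c \<inter> d \<noteq> {} \<longrightarrow> k = l \<and> c = d) \<and>
    (\<forall>k. \<forall>c\<in>E k. \<exists>\<Phi>.
       continuous_map (subtopology (Euclidean_space k) (unit_disc k)) X \<Phi> \<and>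
       homeomorphic_map (subtopology (Euclidean_space k) (open_unit_disc k)) (subtopology X c) \<Phi> \<and>
       (\<exists>F. finite F \<and> F \<subseteq> (\<Union>j<k. E j) \<and> \<Phi> ` (unit_disc k - open_unit_disc k) \<subseteq> \<Union>F)) \<and>
    (\<forall>A. A \<subseteq> topspace X \<longrightarrow>
       (\<forall>k. \<forall>c\<in>E k. closedin X (A \<inter> Abstract_Topology.closure_of X c)) \<longrightarrow> closedin X A)"


section \<open>Integral group rings, left modules and their chain complexes\<close>

definition group_ring :: "('g, 'm) monoid_scheme \<Rightarrow> ('g \<Rightarrow> int) ring"
  where "group_ring G =
    \<lparr>carrier = {f. finite {x. f x \<noteq> 0} \<and> {x. f x \<noteq> 0} \<subseteq> carrier G},
     mult = (\<lambda>f f' x. if x \<in> carrier G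
                       then \<Sum>y | f y \<noteq> 0. f y * f' (inv\<^bsub>G\<^esub> y \<otimes>\<^bsub>G\<^esub> x) else 0),
     one = (\<lambda>x. if x = \<one>\<^bsub>G\<^esub> then 1 else 0),
     zero = (\<lambda>x. 0),
     add = (\<lambda>f f' x. f x + f' x)\<rparr>"

definition group_ring_of :: "'g \<Rightarrow> 'g \<Rightarrow> int"
  where "group_ring_of y = (\<lambda>x. if x = y then 1 else 0)"

text \<open>The axioms of the locale \<^locale>\<open>module\<close>, without commutativity of the ring.\<close>

locale left_module = R?: ring R + M?: abelian_group M
  for R :: "('a, 'm) ring_scheme" (structure) and M :: "('a, 'b, 'p) module_scheme" (structure) +
  assumes smult_closed: "a \<in> carrier R \<Longrightarrow> x \<in> carrier M \<Longrightarrow> a \<odot>\<^bsub>M\<^esub> x \<in> carrier M"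
    and smult_l_distr: "a \<in> carrier R \<Longrightarrow> b \<in> carrier R \<Longrightarrow> x \<in> carrier M \<Longrightarrow>
      (a \<oplus> b) \<odot>\<^bsub>M\<^esub> x = a \<odot>\<^bsub>M\<^esub> x \<oplus>\<^bsub>M\<^esub> b \<odot>\<^bsub>M\<^esub> x"
    and smult_r_distr: "a \<in> carrier R \<Longrightarrow> x \<in> carrier M \<Longrightarrow> y \<in> carrier M \<Longrightarrow>
      a \<odot>\<^bsub>M\<^esub> (x \<oplus>\<^bsub>M\<^esub> y) = a \<odot>\<^bsub>M\<^esub> x \<oplus>\<^bsub>M\<^esub> a \<odot>\<^bsub>M\<^esub> y"
    and smult_assoc: "a \<in> carrier R \<Longrightarrow> b \<in> carrier R \<Longrightarrow> x \<in> carrier M \<Longrightarrow>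
      (a \<otimes> b) \<odot>\<^bsub>M\<^esub> x = a \<odot>\<^bsub>M\<^esub> (b \<odot>\<^bsub>M\<^esub> x)"
    and smult_one: "x \<in> carrier M \<Longrightarrow> \<one> \<odot>\<^bsub>M\<^esub> x = x"

definition left_linear ::
    "('r, 'm) ring_scheme \<Rightarrow> ('r, 'a, 'p) module_scheme \<Rightarrow> ('r, 'b, 'q) module_scheme
      \<Rightarrow> ('a \<Rightarrow> 'b) set"
  where "left_linear R M N =
    {f \<in> carrier M \<rightarrow> carrier N.
       (\<forall>x\<in>carrier M. \<forall>y\<in>carrier M. f (x \<oplus>\<^bsub>M\<^esub> y) = f x \<oplus>\<^bsub>N\<^esub> f y) \<and>
       (\<forall>a\<in>carrier R. \<forall>x\<in>carrier M. f (a \<odot>\<^bsub>M\<^esub> x) = a \<odot>\<^bsub>N\<^esub> f x)}"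

text \<open>The free left module of rank \<open>m\<close>. The record type also has fields for a multiplication
  and a unit, which play no role for modules.\<close>

definition free_module :: "('r, 'm) ring_scheme \<Rightarrow> nat \<Rightarrow> ('r, nat \<Rightarrow> 'r) module"
  where "free_module R m =
    \<lparr>carrier = {..<m} \<rightarrow>\<^sub>E carrier R,
     mult = undefined, one = undefined,
     zero = (\<lambda>j\<in>{..<m}. \<zero>\<^bsub>R\<^esub>),
     add = (\<lambda>x y. \<lambda>j\<in>{..<m}. x j \<oplus>\<^bsub>R\<^esub> y j),
     smult = (\<lambda>a x. \<lambda>j\<in>{..<m}. a \<otimes>\<^bsub>R\<^esub> x j)\<rparr>"

definition module_complex ::
    "('r, 'm) ring_scheme \<Rightarrow> (int \<Rightarrow> ('r, 'a, 'p) module_scheme) \<Rightarrow> (int \<Rightarrow> 'a \<Rightarrow> 'a) \<Rightarrow> bool"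
  where "module_complex R C d \<longleftrightarrow>
    (\<forall>p. left_module R (C p)) \<and>
    (\<forall>p. d p \<in> left_linear R (C p) (C (p - 1))) \<and>
    (\<forall>p. \<forall>x\<in>carrier (C p). d (p - 1) (d p x) = \<zero>\<^bsub>C (p - 2)\<^esub>)"

definition complex_homology ::
    "(int \<Rightarrow> ('r, 'a) module) \<Rightarrow> (int \<Rightarrow> 'a \<Rightarrow> 'a) \<Rightarrow> int \<Rightarrow> 'a set monoid"
  where "complex_homology C d p =
    ((add_monoid (C p)) \<lparr>carrier := {x \<in> carrier (C p). d p x = \<zero>\<^bsub>C (p - 1)\<^esub>}\<rparr>)
      Mod (d (p + 1) ` carrier (C (p + 1)))"

text \<open>Scalar multiplication induced on homology; homology classes are cosets.\<close>

definition homology_smult ::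
    "(int \<Rightarrow> ('r, 'a) module) \<Rightarrow> int \<Rightarrow> 'r \<Rightarrow> 'a set \<Rightarrow> 'a set"
  where "homology_smult C p a c = (\<lambda>z. a \<odot>\<^bsub>C p\<^esub> z) ` c"

text \<open>The graded module with free modules of ranks \<open>a\<close> and \<open>b\<close> in degrees \<open>n\<close> and \<open>n - 1\<close>, and the
  zero module in all other degrees.\<close>

definition two_term :: "('r, 'm) ring_scheme \<Rightarrow> nat \<Rightarrow> nat \<Rightarrow> nat \<Rightarrow> int \<Rightarrow> ('r, nat \<Rightarrow> 'r) module"
  where "two_term R n a b p =
    free_module R (if p = int n then a else if p = int n - 1 then b else 0)"

end

theory Submission
  imports Defs
begin

text \<open>
  Besides \<open>\<infinity>\<close>, the compactified configuration space contains two kinds of points: configurations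
  that avoid the vertex and configurations with one point at the vertex. Reading the points off the
  vertex from left to right in \<open>Xi g\<close> gives an ordering of their labels and a nondecreasing list
  of petals, that is, a bar symbol. The configurations with a given symbol form an open product of
  simplices, and every configuration has exactly one symbol (\<open>symbol_cover\<close>, \<open>symbol_unique\<close>).

  Two extensions make these open cells into cells of a CW structure. The parametrisation of the
  petals, extended by the value \<open>v\<close> outside \<open>Xi g\<close>, is continuous on the whole real line, because
  the rose is compact (\<open>continuous_map_petal_ext\<close>); and the map that sends a tuple of points of the
  rose to itself if its entries are distinct and to \<open>\<infinity>\<close> otherwise is continuous
  (\<open>continuous_map_collapse\<close>). Together they map the closed polytope of a symbol to the compactified
  configuration space. On a facet two points collide or some point reaches the vertex, so the
  boundary lands in the lower cells. The polytope is the unit ball of a gauge around an interior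
  point, and a radial rescaling identifies it with the Euclidean disc (\<open>slot_point_bij\<close>).

  For the homology let \<open>A\<close> be the closed set that consists of \<open>\<infinity>\<close> and the \<open>(n - 1)\<close>-cells. The groups
  \<open>H\<^sub>p(X, A)\<close> vanish for \<open>p \<noteq> n\<close>, the groups \<open>H\<^sub>p(A, \<infinity>)\<close> vanish for \<open>p \<noteq> n - 1\<close>, and in the
  remaining degrees the characteristic maps give bases (\<open>other_degrees\<close>, \<open>cellular_basis\<close>). Hence
  the long exact sequence of the triple \<open>\<infinity> \<in> A \<subseteq> X\<close> says that the connecting map
  \<open>H\<^sub>n(X, A) \<rightarrow> H\<^sub>n\<^sub>-\<^sub>1(A, \<infinity>)\<close> has the reduced homology of \<open>X\<close> as kernel and cokernel. A
  permutation of the labels carries characteristic maps to characteristic maps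
  (\<open>char_map_permute\<close>), so it permutes the two bases freely, with one orbit for each nondecreasing
  list of petals. Both groups are therefore free over the group ring, of the stated ranks.
\<close>

section \<open>Discs, spheres and radial expansion\<close>

definition disc :: "nat \<Rightarrow> (nat \<Rightarrow> real) topology"
  where "disc k = subtopology (Euclidean_space k) (unit_disc k)"

definition unit_sphere :: "nat \<Rightarrow> (nat \<Rightarrow> real) set"
  where "unit_sphere k = unit_disc k - open_unit_disc k"

definition nrm :: "nat \<Rightarrow> (nat \<Rightarrow> real) \<Rightarrow> real"
  where "nrm k x = sqrt (\<Sum>i<k. (x i)\<^sup>2)"

lemma nrm_nonneg [simp]: "nrm k x \<ge> 0"
  by (simp add: nrm_def sum_nonneg)

lemma nrm_scale: "nrm k (\<lambda>i. x i * c) = nrm k x * \<bar>c\<bar>"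
  by (simp add: nrm_def power_mult_distrib sum_distrib_right[symmetric] real_sqrt_mult)

lemma abs_le_nrm:
  assumes "i < k" shows "\<bar>x i\<bar> \<le> nrm k x"
proof -
  have "(x i)\<^sup>2 \<le> (\<Sum>i<k. (x i)\<^sup>2)"
    using assms by (intro member_le_sum) auto
  then have "sqrt ((x i)\<^sup>2) \<le> nrm k x"
    unfolding nrm_def by (rule real_sqrt_le_mono)
  then show ?thesis by simp
qed

lemma continuous_on_nrm: "continuous_on S (nrm k)"
  unfolding nrm_def by (intro continuous_intros continuous_on_subset[OF continuous_on_product_coordinates]) auto

lemma Euclidean_space_eq: "Euclidean_space k = top_of_set {x. \<forall>i\<ge>k. x i = 0}"
  by (simp add: Euclidean_space_def euclidean_product_topology)

lemma mem_unit_disc: "x \<in> unit_disc k \<longleftrightarrow> (\<forall>i\<ge>k. x i = 0) \<and> nrm k x \<le> 1"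
  by (simp add: unit_disc_def topspace_Euclidean_space nrm_def)

lemma mem_open_unit_disc: "x \<in> open_unit_disc k \<longleftrightarrow> (\<forall>i\<ge>k. x i = 0) \<and> nrm k x < 1"
  by (simp add: open_unit_disc_def topspace_Euclidean_space nrm_def)

lemma mem_unit_sphere: "x \<in> unit_sphere k \<longleftrightarrow> (\<forall>i\<ge>k. x i = 0) \<and> nrm k x = 1"
  by (auto simp: unit_sphere_def mem_unit_disc mem_open_unit_disc)

lemma disc_eq: "disc k = top_of_set (unit_disc k)"
  unfolding disc_def Euclidean_space_eq subtopology_subtopology
  by (rule arg_cong[where f="subtopology euclidean"]) (auto simp: mem_unit_disc)

lemma topspace_disc [simp]: "topspace (disc k) = unit_disc k"
  by (simp add: disc_eq)

lemma open_subset_disc: "open_unit_disc k \<subseteq> unit_disc k"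
  and sphere_subset_disc: "unit_sphere k \<subseteq> unit_disc k"
  by (auto simp: mem_unit_disc mem_open_unit_disc mem_unit_sphere)

lemma disc_minus_sphere: "unit_disc k - unit_sphere k = open_unit_disc k"
  by (auto simp: mem_unit_disc mem_open_unit_disc mem_unit_sphere)

lemma subtopology_disc_open: "subtopology (disc k) (open_unit_disc k)
   = subtopology (Euclidean_space k) (open_unit_disc k)"
  unfolding disc_def subtopology_subtopology using open_subset_disc[of k] by (simp add: Int_absorb1)

lemma continuous_on_coord: "continuous_on S (\<lambda>x::nat\<Rightarrow>real. x i)"
  by (rule continuous_on_subset[OF continuous_on_product_coordinates]) auto

lemma compact_unit_disc: "compact (unit_disc k)"
proof -
  have c: "compact (PiE UNIV (\<lambda>_::nat. {-1..1::real}))"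
    using compactin_PiE[of "\<lambda>_. euclideanreal" UNIV "\<lambda>_::nat. {-1..1::real}"]
    by (simp add: euclidean_product_topology)
  have "closed {x::nat\<Rightarrow>real. \<forall>i\<ge>k. x i = 0}"
    by (intro closed_Collect_all closed_Collect_imp open_Collect_const closed_Collect_eq continuous_on_coord)
      (auto intro: continuous_on_coord)
  moreover have "closed {x. nrm k x \<le> 1}"
    by (intro closed_Collect_le continuous_on_nrm) auto
  ultimately have cl: "closed (unit_disc k)"
    using closed_Int[of "{x. \<forall>i\<ge>k. x i = 0}" "{x. nrm k x \<le> 1}"]
    by (simp add: Collect_conj_eq[symmetric] mem_unit_disc[symmetric])
  have "unit_disc k \<subseteq> PiE UNIV (\<lambda>_::nat. {-1..1::real})"
  proof
    fix x assume x: "x \<in> unit_disc k"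
    have "\<bar>x i\<bar> \<le> 1" for i
    proof (cases "i < k")
      case True
      then show ?thesis using abs_le_nrm[OF True, of x] x by (auto simp: mem_unit_disc)
    qed (use x in \<open>auto simp: mem_unit_disc\<close>)
    then show "x \<in> PiE UNIV (\<lambda>_::nat. {-1..1::real})" by (force simp: PiE_UNIV_domain abs_le_iff)
  qed
  then show ?thesis using c cl by (metis compact_Int_closed inf.absorb_iff2)
qed

lemma compact_space_disc: "compact_space (disc k)"
  by (simp add: disc_eq compact_space_subtopology compact_unit_disc)

lemma Hausdorff_space_disc: "Hausdorff_space (disc k)"
  by (simp add: disc_eq Hausdorff_space_subtopology)

text \<open>Radial stretching by the factor \<open>1 + t\<close>, stopped at the unit sphere. The factor is written as the
  inverse of a maximum so that it stays continuous at the origin and equals \<open>1\<close> on the sphere.\<close>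

definition expand :: "nat \<Rightarrow> real \<Rightarrow> (nat \<Rightarrow> real) \<Rightarrow> nat \<Rightarrow> real"
  where "expand k t x = (\<lambda>i. x i * inverse (max (1 / (1 + t)) (nrm k x)))"

definition outer_shell :: "nat \<Rightarrow> (nat \<Rightarrow> real) set"
  where "outer_shell k = {x \<in> unit_disc k. nrm k x > 1/2}"

lemma nrm_expand:
  assumes "0 \<le> t" shows "nrm k (expand k t x) = nrm k x / max (1 / (1 + t)) (nrm k x)"
proof -
  have "max (1 / (1 + t)) (nrm k x) > 0" using assms by (simp add: less_max_iff_disj)
  then show ?thesis by (simp add: expand_def nrm_scale divide_inverse)
qed

lemma expand_in_disc:
  assumes "0 \<le> t" "x \<in> unit_disc k"
  shows "expand k t x \<in> unit_disc k"
proof -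
  have p: "max (1 / (1 + t)) (nrm k x) > 0" using assms by (simp add: less_max_iff_disj)
  then have "nrm k (expand k t x) \<le> 1"
    unfolding nrm_expand[OF assms(1)] by (simp add: divide_le_eq)
  then show ?thesis using assms by (simp add: mem_unit_disc) (simp add: expand_def)
qed

lemma nrm_expand_ge:
  assumes "0 \<le> t" "x \<in> unit_disc k"
  shows "nrm k (expand k t x) \<ge> nrm k x"
proof -
  have p: "max (1 / (1 + t)) (nrm k x) > 0" using assms by (simp add: less_max_iff_disj)
  have q: "max (1 / (1 + t)) (nrm k x) \<le> 1" using assms by (simp add: mem_unit_disc)
  show ?thesis unfolding nrm_expand[OF assms(1)]
    using p q by (simp add: le_divide_eq mult_left_le)
qed

lemma expand_0: "x \<in> unit_disc k \<Longrightarrow> expand k 0 x = x"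
  by (auto simp: expand_def mem_unit_disc max_def)

lemma expand_sphere: "0 \<le> t \<Longrightarrow> x \<in> unit_sphere k \<Longrightarrow> expand k t x = x"
  by (auto simp: expand_def mem_unit_sphere max_def)

lemma expand_1_shell: 
  assumes "x \<in> outer_shell k"
  shows "expand k 1 x \<in> unit_sphere k"
proof -
  have x: "x \<in> unit_disc k" and n: "nrm k x > 1/2" using assms by (auto simp: outer_shell_def)
  then have "max (1 / (1 + 1)) (nrm k x) = nrm k x" by (simp add: max_def)
  then have "nrm k (expand k 1 x) = 1" using nrm_expand[of 1 k x] n by simp
  then show ?thesis using expand_in_disc[OF _ x, of 1] by (simp add: mem_unit_sphere mem_unit_disc)
qed

lemma continuous_map_expand:
  "continuous_map (prod_topology (top_of_set {0..1}) (disc k)) (disc k) (\<lambda>(t, x). expand k t x)"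
proof -
  have eq: "prod_topology (top_of_set {0..1::real}) (disc k) = top_of_set ({0..1} \<times> unit_disc k)"
    by (simp add: disc_eq)
  have *: "continuous_on ({0..1::real} \<times> unit_disc k) (\<lambda>z. expand k (fst z) (snd z))"
    unfolding expand_def
  proof (rule continuous_on_coordinatewise_then_product)
    fix i
    have pos: "max (1 / (1 + fst z)) (nrm k (snd z)) \<noteq> 0" if "z \<in> {0..1::real} \<times> unit_disc k" for z
    proof -
      have "0 < 1 / (1 + fst z)" using that by auto
      then show ?thesis by linarith
    qed
    have a: "continuous_on ({0..1::real} \<times> unit_disc k) (\<lambda>z. snd z i)"
      by (rule continuous_on_compose2[OF continuous_on_coord[of UNIV]]) (auto intro: continuous_intros)
    have b: "continuous_on ({0..1::real} \<times> unit_disc k) (\<lambda>z. nrm k (snd z))"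
      by (rule continuous_on_compose2[OF continuous_on_nrm[of UNIV]]) (auto intro: continuous_intros)
    have c: "continuous_on ({0..1::real} \<times> unit_disc k) (\<lambda>z. 1 / (1 + fst z))"
      by (intro continuous_intros) auto
    show "continuous_on ({0..1::real} \<times> unit_disc k)
       (\<lambda>z. snd z i * inverse (max (1 / (1 + fst z)) (nrm k (snd z))))"
      using pos by (intro continuous_on_mult a continuous_on_inverse continuous_on_max b c) auto
  qed
  show ?thesis
    unfolding eq unfolding disc_eq continuous_map_in_subtopology
    using * by (auto simp: case_prod_beta' image_subset_iff intro: expand_in_disc)
qed

section \<open>Attaching one cell\<close>

text \<open>A space obtained from the closed set \<open>B\<close> by attaching a single \<open>k\<close>-cell. The homeomorphism onto the
  open cell is a consequence of compactness of the disc, see \<open>homeo\<close>.\<close>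

locale attached_cell =
  fixes X :: "'a topology" and B :: "'a set" and k :: nat and \<Phi> :: "(nat \<Rightarrow> real) \<Rightarrow> 'a"
  assumes haus: "Hausdorff_space X"
    and closed_B: "closedin X B"
    and cont: "continuous_map (disc k) X \<Phi>"
    and bdry: "\<Phi> ` unit_sphere k \<subseteq> B"
    and inj: "inj_on \<Phi> (open_unit_disc k)"
    and onto: "\<Phi> ` open_unit_disc k = topspace X - B"
begin

lemma preimage_open: "{x \<in> topspace (disc k). \<Phi> x \<in> topspace X - B} = open_unit_disc k"
  using bdry onto disc_minus_sphere[of k] open_subset_disc[of k] by auto

lemma homeo: "homeomorphic_map (subtopology (disc k) (open_unit_disc k)) (subtopology X (topspace X - B)) \<Phi>"
proof (rule bijective_closed_imp_homeomorphic_map)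
  show "closed_map (subtopology (disc k) (open_unit_disc k)) (subtopology X (topspace X - B)) \<Phi>"
    by (rule closed_map_restriction[OF continuous_imp_closed_map[OF cont compact_space_disc haus] preimage_open])
  show "continuous_map (subtopology (disc k) (open_unit_disc k)) (subtopology X (topspace X - B)) \<Phi>"
    using cont onto by (auto simp: continuous_map_in_subtopology continuous_map_from_subtopology)
qed (use onto inj open_subset_disc[of k] in \<open>auto simp: Int_absorb1 inj_on_def\<close>)

text \<open>\<open>B\<close> together with the part of the cell outside the closed half-disc: an open neighbourhood of \<open>B\<close>
  that can be pushed back into \<open>B\<close>.\<close>

definition thick_B :: "'a set" where "thick_B = B \<union> \<Phi> ` (outer_shell k)"

definition push :: "real \<times> 'a \<Rightarrow> 'a"
  where "push = (\<lambda>(t, x). if x \<in> topspace X - B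
      then \<Phi> (expand k t (inv_into (open_unit_disc k) \<Phi> x)) else x)"

lemma push_cell:
  assumes "0 \<le> t" "x \<in> unit_disc k" shows "push (t, \<Phi> x) = \<Phi> (expand k t x)"
proof (cases "x \<in> open_unit_disc k")
  case True
  then show ?thesis using onto inj unfolding push_def by auto
next
  case False
  then have "x \<in> unit_sphere k" using assms by (simp add: unit_sphere_def)
  then show ?thesis using bdry assms by (auto simp: push_def expand_sphere)
qed

lemma B_subset: "B \<subseteq> topspace X" using closed_B closedin_subset by blast

lemma in_image_or_B: "x \<in> topspace X \<Longrightarrow> x \<in> B \<or> x \<in> \<Phi> ` unit_disc k"
  using onto open_subset_disc[of k] by auto

lemma closed_image: "closedin X (\<Phi> ` unit_disc k)"
  using continuous_imp_closed_map[OF cont compact_space_disc haus]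
  by (metis closed_map_def closedin_topspace topspace_disc)

text \<open>The homotopy is pasted from two closed pieces. It is constant on \<open>B\<close>, and on the closed cell it
  descends from the disc along a quotient map, the product of the interval with the characteristic
  map: its source is compact and its target Hausdorff.\<close>

lemma continuous_push: "continuous_map (prod_topology (top_of_set {0..1}) X) X push"
proof -
  let ?I = "top_of_set {0..1::real}"
  let ?T = "\<lambda>b. {0..1::real} \<times> (if b then B else \<Phi> ` unit_disc k)"
  show ?thesis
  proof (rule pasting_lemma_closed[where I=UNIV and T="?T" and f="\<lambda>_. push"])
    show "closedin (prod_topology ?I X) (?T b)" for b
      using closed_B closed_image by (auto simp: closedin_prod_Times_iff)
    show "\<exists>j. j \<in> UNIV \<and> z \<in> ?T j \<and> push z = push z" if "z \<in> topspace (prod_topology ?I X)" for z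
      using that in_image_or_B by (cases z) (auto split: if_splits)
    show "continuous_map (subtopology (prod_topology ?I X) (?T b)) X push" for b
    proof (cases b)
      case True
      have "continuous_map (subtopology (prod_topology ?I X) (?T b)) X snd"
        by (rule continuous_map_from_subtopology[OF continuous_map_snd])
      then show ?thesis
        by (rule continuous_map_eq) (use True in \<open>auto simp: push_def\<close>)
    next
      case False
      let ?Q = "\<lambda>(t::real, x). (t, \<Phi> x)"
      let ?Y = "subtopology (prod_topology ?I X) (?T b)"
      have "quotient_map (prod_topology ?I (disc k)) ?Y ?Q"
      proof (rule continuous_imp_quotient_map)
        have "continuous_map (prod_topology ?I (disc k)) (prod_topology ?I X) (\<lambda>(t, x). (id t, \<Phi> x))"
          unfolding continuous_map_prod_top using cont by simp
        then show "continuous_map (prod_topology ?I (disc k)) ?Y ?Q"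
          using False by (auto simp: continuous_map_in_subtopology)
        show "compact_space (prod_topology ?I (disc k))"
          by (simp add: compact_space_prod_topology compact_space_disc compact_space_subtopology)
        show "Hausdorff_space ?Y"
          using haus by (simp add: Hausdorff_space_subtopology Hausdorff_space_prod_topology)
        have "\<Phi> ` unit_disc k \<subseteq> topspace X" using cont by (auto simp: continuous_map_def)
        then show "?Q ` topspace (prod_topology ?I (disc k)) = topspace ?Y"
          using False by force
      qed
      moreover have "continuous_map (prod_topology ?I (disc k)) X (push \<circ> ?Q)"
      proof (rule continuous_map_eq)
        show "continuous_map (prod_topology ?I (disc k)) X (\<Phi> \<circ> (\<lambda>(t, x). expand k t x))"
          by (rule continuous_map_compose[OF continuous_map_expand cont])
      qed (auto simp: push_cell)
      ultimately show ?thesis by (rule continuous_compose_quotient_map)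
    qed
  qed auto
qed

lemma push_homotopic:
  "homotopic_with (\<lambda>h. h \<in> B \<rightarrow> B \<and> h \<in> thick_B \<rightarrow> thick_B) X X id (\<lambda>x. push (1, x))"
  unfolding homotopic_with_def
proof (intro exI[of _ push] conjI allI ballI)
  show "push (0, x) = id x" for x
  proof (cases "x \<in> topspace X - B")
    case True
    then obtain y where "y \<in> open_unit_disc k" "x = \<Phi> y" using onto by blast
    then show ?thesis using push_cell[of 0 y] expand_0[of y k] open_subset_disc[of k] by (simp add: subset_iff)
  qed (simp only: push_def prod.case if_False id_def)
next
  fix t :: real assume "t \<in> {0..1}"
  then have t: "0 \<le> t" by simp
  show BB: "(\<lambda>x. push (t, x)) \<in> B \<rightarrow> B" by (auto simp: push_def)
  show "(\<lambda>x. push (t, x)) \<in> thick_B \<rightarrow> thick_B"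
  proof
    fix x assume "x \<in> thick_B"
    then consider "x \<in> B" | y where "y \<in> outer_shell k" "x = \<Phi> y" by (auto simp: thick_B_def)
    then show "push (t, x) \<in> thick_B"
    proof cases
      case 2
      then have y: "y \<in> unit_disc k" "1/2 < nrm k y" by (auto simp: outer_shell_def)
      have "expand k t y \<in> outer_shell k"
        using nrm_expand_ge[OF t y(1)] y expand_in_disc[OF t y(1)] unfolding outer_shell_def by auto
      then show ?thesis using push_cell[OF t y(1)] 2 by (auto simp: thick_B_def)
    qed (use BB in \<open>auto simp: thick_B_def\<close>)
  qed
qed (auto intro: continuous_push)

lemma push_thick_B: "(\<lambda>x. push (1, x)) \<in> thick_B \<rightarrow> B"
proof
  fix x assume "x \<in> thick_B"
  then consider "x \<in> B" | y where "y \<in> outer_shell k" "x = \<Phi> y" by (auto simp: thick_B_def)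
  then show "push (1, x) \<in> B"
  proof cases
    case 2
    then have "push (1, x) = \<Phi> (expand k 1 y)" using push_cell[of 1 y] by (auto simp: outer_shell_def)
    then show ?thesis using expand_1_shell[OF 2(1)] bdry by auto
  qed (auto simp: push_def)
qed

text \<open>The final stage of the push is a homotopy inverse of the inclusion of pairs. The whole homotopy is
  defined on \<open>X\<close> and preserves both \<open>B\<close> and its neighbourhood.\<close>

lemma enlarge_iso:
  "hom_induced p X B X thick_B id \<in> iso (relative_homology_group p X B) (relative_homology_group p X thick_B)"
proof (rule homotopy_equivalence_relative_homology_group_isomorphism[where g="\<lambda>x. push (1, x)"])
  show "continuous_map X X (\<lambda>x. push (1, x))"
    using homotopic_with_imp_continuous_maps[OF push_homotopic] by blast
  show "homotopic_with (\<lambda>h. h \<in> B \<rightarrow> B) X X ((\<lambda>x. push (1, x)) \<circ> id) id"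
    using homotopic_with_mono[OF homotopic_with_symD[OF push_homotopic]] by (simp add: comp_def)
  show "homotopic_with (\<lambda>h. h \<in> thick_B \<rightarrow> thick_B) X X (id \<circ> (\<lambda>x. push (1, x))) id"
    using homotopic_with_mono[OF homotopic_with_symD[OF push_homotopic]] by (simp add: comp_def)
qed (use push_thick_B in \<open>auto simp: thick_B_def\<close>)

lemma thick_B_eq: "thick_B = topspace X - \<Phi> ` {x \<in> unit_disc k. nrm k x \<le> 1/2}" (is "_ = _ - \<Phi> ` ?C")
proof -
  have C: "?C \<subseteq> open_unit_disc k" by (auto simp: mem_unit_disc mem_open_unit_disc)
  have 1: "\<Phi> x \<notin> \<Phi> ` ?C" if "x \<in> outer_shell k" for x
  proof (cases "x \<in> open_unit_disc k")
    case True
    show ?thesis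
    proof
      assume "\<Phi> x \<in> \<Phi> ` ?C"
      then obtain y where y: "y \<in> ?C" "\<Phi> x = \<Phi> y" by blast
      then have "x = y" using inj_onD[OF inj _ True] C by blast
      then show False using y that by (simp add: outer_shell_def)
    qed
  next
    case False
    then have "\<Phi> x \<in> B" using that bdry by (auto simp: unit_sphere_def outer_shell_def)
    then show ?thesis using C onto by blast
  qed
  have 2: "\<Phi> x \<in> topspace X" if "x \<in> outer_shell k" for x
    using that cont by (auto simp: outer_shell_def continuous_map_def)
  have 3: "x \<in> thick_B" if "x \<in> topspace X" "x \<notin> \<Phi> ` ?C" for x
    using that in_image_or_B[of x] by (force simp: thick_B_def outer_shell_def)
  have 4: "x \<in> topspace X" "x \<notin> \<Phi> ` ?C" if "x \<in> B" for x
    using that B_subset onto C by blast+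
  show ?thesis
  proof (intro equalityI subsetI)
    fix x assume "x \<in> thick_B"
    then consider "x \<in> B" | y where "y \<in> outer_shell k" "x = \<Phi> y" by (auto simp: thick_B_def)
    then show "x \<in> topspace X - \<Phi> ` ?C"
      by cases (use 1 2 4 in \<open>simp_all only: Diff_iff simp_thms\<close>)
  next
    fix x assume "x \<in> topspace X - \<Phi> ` ?C"
    then show "x \<in> thick_B" using 3 by (simp only: Diff_iff simp_thms)
  qed
qed

lemma open_thick_B: "openin X thick_B"
proof -
  have "compactin (disc k) {x \<in> unit_disc k. nrm k x \<le> 1/2}"
  proof -
    have "closed {x. nrm k x \<le> 1/2}" by (intro closed_Collect_le continuous_on_nrm) auto
    then have "compact (unit_disc k \<inter> {x. nrm k x \<le> 1/2})" using compact_unit_disc compact_Int_closed by blast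
    then show ?thesis by (simp add: disc_eq compactin_subtopology Collect_conj_eq[symmetric] Int_def)
  qed
  then have "closedin X (\<Phi> ` {x \<in> unit_disc k. nrm k x \<le> 1/2})"
    using haus cont by (meson compactin_imp_closedin image_compactin)
  then show ?thesis by (simp add: thick_B_eq openin_diff)
qed

text \<open>\<open>B\<close> is closed and its neighbourhood is open, so \<open>B\<close> can be excised, leaving only the open cell.\<close>

lemma excise_iso:
  "hom_induced p (subtopology X (topspace X - B)) (thick_B - B) X thick_B id
    \<in> iso (relative_homology_group p (subtopology X (topspace X - B)) (thick_B - B)) (relative_homology_group p X thick_B)"
proof -
  have "X closure_of B \<subseteq> X interior_of thick_B"
    unfolding closure_of_closedin[OF closed_B] interior_of_openin[OF open_thick_B] by (auto simp: thick_B_def)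
  moreover have "thick_B \<subseteq> topspace X" unfolding thick_B_eq by (rule Diff_subset)
  ultimately show ?thesis
    using homology_excision_axiom[of X B thick_B "topspace X" p] by simp
qed

end

lemma iso_cancel_right:
  assumes "g \<in> iso A B" "f \<circ> g \<in> iso A C" "f \<in> hom B C"
  shows "f \<in> iso B C"
proof -
  have b: "bij_betw g (carrier A) (carrier B)" and fg: "bij_betw (f \<circ> g) (carrier A) (carrier C)"
    using assms by (auto simp: iso_def)
  show ?thesis using bij_betw_comp_iff[OF b, of f] fg assms(3) by (auto simp: iso_def)
qed

lemma iso_cancel_left:
  assumes "f \<in> iso B C" "f \<circ> g \<in> iso A C" "g \<in> hom A B"
  shows "g \<in> iso A B"
proof -
  have b: "bij_betw f (carrier B) (carrier C)" and fg: "bij_betw (f \<circ> g) (carrier A) (carrier C)"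
    using assms by (auto simp: iso_def)
  have "g ` carrier A \<subseteq> carrier B" using assms(3) by (auto simp: hom_def)
  then show ?thesis using bij_betw_comp_iff2[OF b, of g] fg assms(3) by (auto simp: iso_def)
qed

lemma attached_cell_disc: "attached_cell (disc k) (unit_sphere k) k id"
proof
  have "closed {x. nrm k x = 1}" by (intro closed_Collect_eq continuous_on_nrm) auto
  moreover have "unit_sphere k = unit_disc k \<inter> {x. nrm k x = 1}" by (auto simp: mem_unit_disc mem_unit_sphere)
  ultimately show "closedin (disc k) (unit_sphere k)"
    by (simp add: disc_eq closedin_closed_Int)
qed (auto simp: Hausdorff_space_disc disc_minus_sphere)

context attached_cell
begin

text \<open>Both pairs are compared with the open disc relative to its outer shell, by enlarging the subspace
  and then excising. On that pair the characteristic map is a homeomorphism. The disc itself arises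
  from its boundary sphere by attaching one cell, so the same two isomorphisms apply to it.\<close>

theorem cell_iso:
  "hom_induced p (disc k) (unit_sphere k) X B \<Phi>
    \<in> iso (relative_homology_group p (disc k) (unit_sphere k)) (relative_homology_group p X B)"
proof -
  interpret D: attached_cell "disc k" "unit_sphere k" k id by (rule attached_cell_disc)
  define D' where "D' = D.thick_B"
  have D': "D' = outer_shell k"
    using sphere_subset_disc[of k] by (auto simp: D'_def D.thick_B_def outer_shell_def mem_unit_sphere)
  have PD: "\<Phi> \<in> D' \<rightarrow> thick_B" by (auto simp: D' thick_B_def)
  have DS: "topspace (disc k) - unit_sphere k = open_unit_disc k" by (simp add: disc_minus_sphere)
  let ?Do = "subtopology (disc k) (open_unit_disc k)" and ?Xo = "subtopology X (topspace X - B)"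
  have 1: "hom_induced p ?Do (D' - unit_sphere k) ?Xo (thick_B - B) \<Phi>
     \<in> iso (relative_homology_group p ?Do (D' - unit_sphere k)) (relative_homology_group p ?Xo (thick_B - B))"
  proof (rule homeomorphic_map_relative_homology_iso[OF homeo])
    show "D' - unit_sphere k \<subseteq> topspace ?Do"
      using open_subset_disc[of k] disc_minus_sphere[of k] by (auto simp: D' outer_shell_def)
    have "\<Phi> x \<notin> B" if "x \<in> D' - unit_sphere k" for x
      using that onto disc_minus_sphere[of k] by (auto simp: D' outer_shell_def)
    moreover have "x \<in> \<Phi> ` (D' - unit_sphere k)" if "x \<in> thick_B - B" for x
      using that bdry by (auto simp: thick_B_def D')
    ultimately show "\<Phi> ` (D' - unit_sphere k) = thick_B - B" using PD by auto
  qed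
  have PDo: "\<Phi> \<in> (D' - unit_sphere k) \<rightarrow> thick_B - B"
    using PD onto disc_minus_sphere[of k] by (auto simp: D' outer_shell_def)
  have cPo: "continuous_map ?Do ?Xo \<Phi>" using homeo by (simp add: homeomorphic_imp_continuous_map)
  have 2: "hom_induced p ?Do (D' - unit_sphere k) X thick_B \<Phi>
     \<in> iso (relative_homology_group p ?Do (D' - unit_sphere k)) (relative_homology_group p X thick_B)"
    using iso_set_trans[OF 1 excise_iso[of p]] hom_induced_compose[OF cPo PDo, of X id thick_B p]
    by (simp add: comp_def)
  have exD: "hom_induced p ?Do (D' - unit_sphere k) (disc k) D' id
    \<in> iso (relative_homology_group p ?Do (D' - unit_sphere k)) (relative_homology_group p (disc k) D')"
    using D.excise_iso[of p] unfolding DS D'_def[symmetric] .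
  have 3: "hom_induced p (disc k) D' X thick_B \<Phi>
     \<in> iso (relative_homology_group p (disc k) D') (relative_homology_group p X thick_B)"
  proof (rule iso_cancel_right[OF exD])
    show "hom_induced p (disc k) D' X thick_B \<Phi> \<circ> hom_induced p ?Do (D' - unit_sphere k) (disc k) D' id
       \<in> iso (relative_homology_group p ?Do (D' - unit_sphere k)) (relative_homology_group p X thick_B)"
      using 2 cont PD by (subst hom_induced_compose[symmetric]) auto
  qed (rule hom_induced_hom)
  have enD: "hom_induced p (disc k) (unit_sphere k) (disc k) D' id
    \<in> iso (relative_homology_group p (disc k) (unit_sphere k)) (relative_homology_group p (disc k) D')"
    using D.enlarge_iso[of p] unfolding D'_def .
  have SB: "\<Phi> \<in> unit_sphere k \<rightarrow> B" using bdry by auto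
  have SD: "unit_sphere k \<subseteq> D'" using sphere_subset_disc[of k] by (auto simp: D' outer_shell_def mem_unit_sphere)
  have 4: "hom_induced p (disc k) (unit_sphere k) X thick_B \<Phi>
     \<in> iso (relative_homology_group p (disc k) (unit_sphere k)) (relative_homology_group p X thick_B)"
  proof -
    have "id \<in> unit_sphere k \<rightarrow> D'" using SD by auto
    from hom_induced_compose[OF continuous_map_id this cont PD, of p]
    show ?thesis using iso_set_trans[OF enD 3] by (simp add: comp_def)
  qed
  show ?thesis
  proof (rule iso_cancel_left[OF enlarge_iso])
    show "hom_induced p X B X thick_B id \<circ> hom_induced p (disc k) (unit_sphere k) X B \<Phi>
      \<in> iso (relative_homology_group p (disc k) (unit_sphere k)) (relative_homology_group p X thick_B)"
      using 4 hom_induced_compose[OF cont SB, of X id thick_B p] by (simp add: thick_B_def)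
  qed (rule hom_induced_hom)
qed

end

section \<open>Attaching several cells\<close>

lemma exact_seq_image_eq_kernel:
  "exact_seq ([G2, G1, G0], [g, f]) \<Longrightarrow> f ` carrier G0 = kernel G1 G2 g"
  by (simp add: exact_seq_end_iff)

lemma contractible_disc: "contractible_space (disc k)"
  unfolding contractible_space_def homotopic_with_def
proof (intro exI conjI allI ballI)
  let ?h = "\<lambda>(t::real, x). (\<lambda>i::nat. x i * (1 - t) :: real)"
  have eq: "prod_topology (top_of_set {0..1::real}) (disc k) = top_of_set ({0..1} \<times> unit_disc k)"
    by (simp add: disc_eq)
  have "continuous_on ({0..1::real} \<times> unit_disc k) (\<lambda>z. (\<lambda>i. snd z i * (1 - fst z)))"
  proof (rule continuous_on_coordinatewise_then_product)
    fix i
    have "continuous_on ({0..1::real} \<times> unit_disc k) (\<lambda>z. snd z i)"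
      by (rule continuous_on_compose2[OF continuous_on_coord[of UNIV]]) (auto intro: continuous_intros)
    then show "continuous_on ({0..1::real} \<times> unit_disc k) (\<lambda>z. snd z i * (1 - fst z))"
      by (intro continuous_intros)
  qed
  moreover have "?h (t, x) \<in> unit_disc k" if "t \<in> {0..1}" "x \<in> unit_disc k" for t x
  proof -
    have "nrm k x * \<bar>1 - t\<bar> \<le> 1" using that by (intro mult_le_one) (auto simp: mem_unit_disc)
    then show ?thesis using that by (simp add: mem_unit_disc nrm_scale)
  qed
  ultimately show "continuous_map (prod_topology (top_of_set {0..1}) (disc k)) (disc k) ?h"
    unfolding eq unfolding disc_eq continuous_map_in_subtopology
    by (auto simp: case_prod_beta' image_subset_iff)
  show "?h (1, x) = (\<lambda>_. 0)" for x by simp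
qed (auto simp: fun_eq_iff)

lemma subtopology_disc_sphere: "subtopology (disc (Suc k)) (unit_sphere (Suc k)) = nsphere k"
proof -
  have "unit_disc (Suc k) \<inter> unit_sphere (Suc k) = {x. \<forall>i\<ge>Suc k. x i = 0} \<inter> {x. (\<Sum>i\<le>k. x i ^ 2) = 1}"
    by (auto simp: mem_unit_disc mem_unit_sphere nrm_def lessThan_Suc_atMost)
  then show ?thesis
    by (simp add: nsphere_def disc_eq Euclidean_space_eq subtopology_subtopology)
qed

lemma unit_sphere_0: "unit_sphere 0 = {}" and unit_disc_0: "unit_disc 0 = {\<lambda>_. 0}"
  by (auto simp: mem_unit_sphere mem_unit_disc nrm_def)

lemma unit_sphere_Suc_nonempty: "unit_sphere (Suc k) \<noteq> {}"
proof -
  have "(\<lambda>i. if i = 0 then 1 else 0) \<in> unit_sphere (Suc k)"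
    by (simp add: mem_unit_sphere nrm_def sum.lessThan_Suc_shift del: sum.lessThan_Suc)
  then show ?thesis by blast
qed

text \<open>For \<open>k > 0\<close> the connecting map identifies the relative homology of the contractible disc with the
  reduced homology of its boundary sphere. For \<open>k = 0\<close> the disc is a point and the sphere is empty.\<close>

lemma
  shows disc_homology_top: "relative_homology_group (int k) (disc k) (unit_sphere k) \<cong> integer_group"
    and disc_homology_other: "p \<noteq> int k \<Longrightarrow> trivial_group (relative_homology_group p (disc k) (unit_sphere k))"
proof -
  have "relative_homology_group (int k) (disc k) (unit_sphere k) \<cong> integer_group \<and>
    (p \<noteq> int k \<longrightarrow> trivial_group (relative_homology_group p (disc k) (unit_sphere k)))"
  proof (cases k)
    case 0
    then show ?thesis
      using homology_coefficients[of "disc 0"] homology_dimension_axiom[of "disc 0"]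
      by (simp add: unit_sphere_0 unit_disc_0)
  next
    case (Suc l)
    have "topspace (disc (Suc l)) \<inter> unit_sphere (Suc l) \<noteq> {}"
      using unit_sphere_Suc_nonempty[of l] sphere_subset_disc[of "Suc l"] by auto
    from isomorphic_group_relative_homology_of_contractible[OF contractible_disc this]
    have iso: "relative_homology_group q (disc k) (unit_sphere k) \<cong> reduced_homology_group (q - 1) (nsphere l)" for q
      unfolding Suc subtopology_disc_sphere .
    have "trivial_group (relative_homology_group p (disc k) (unit_sphere k))" if "p \<noteq> int k"
    proof -
      have "trivial_group (reduced_homology_group (p - 1) (nsphere l))"
        using that Suc by (intro reduced_homology_group_nsphere(2)) auto
      then show ?thesis using isomorphic_group_triviality[OF iso] by simp
    qed
    moreover have "relative_homology_group (int k) (disc k) (unit_sphere k) \<cong> integer_group"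
      using iso_trans[OF iso[of "int k"]] reduced_homology_group_nsphere(1)[of l] Suc by simp
    ultimately show ?thesis by blast
  qed
  then show "relative_homology_group (int k) (disc k) (unit_sphere k) \<cong> integer_group"
    and "p \<noteq> int k \<Longrightarrow> trivial_group (relative_homology_group p (disc k) (unit_sphere k))" by auto
qed

text \<open>The family \<open>e\<close> is a basis of the free abelian group \<open>G\<close> with coordinate functions \<open>\<pi>\<close>. The joint
  injectivity of the coordinates takes the place of the condition that \<open>e\<close> spans, because it is what
  exactness arguments provide.\<close>

definition dual_bases :: "('a, 'm) monoid_scheme \<Rightarrow> 'w set \<Rightarrow> ('w \<Rightarrow> 'a) \<Rightarrow> ('w \<Rightarrow> 'a \<Rightarrow> int) \<Rightarrow> bool"
  where "dual_bases G W e \<pi> \<longleftrightarrow> comm_group G \<and> finite W \<and> (\<forall>w\<in>W. e w \<in> carrier G) \<and>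
    (\<forall>w\<in>W. \<pi> w \<in> hom G integer_group) \<and>
    (\<forall>w\<in>W. \<forall>v\<in>W. \<pi> w (e v) = (if v = w then 1 else 0)) \<and>
    (\<forall>c\<in>carrier G. (\<forall>w\<in>W. \<pi> w c = 0) \<longrightarrow> c = \<one>\<^bsub>G\<^esub>)"

text \<open>Finitely many cells of the same dimension attached at once. Removing the open cells in \<open>V\<close> from
  \<open>X\<close> leaves the closed set \<open>rest V\<close>, and enlarging \<open>V\<close> step by step attaches one cell at a time.\<close>

locale attached_cells =
  fixes X :: "'a topology" and A :: "'a set" and k :: nat and W :: "'w set"
    and \<Phi> :: "'w \<Rightarrow> (nat \<Rightarrow> real) \<Rightarrow> 'a"
  assumes haus: "Hausdorff_space X"
    and closed_A: "closedin X A"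
    and fin: "finite W"
    and cont: "w \<in> W \<Longrightarrow> continuous_map (disc k) X (\<Phi> w)"
    and bdry: "w \<in> W \<Longrightarrow> \<Phi> w ` unit_sphere k \<subseteq> A"
    and inj: "w \<in> W \<Longrightarrow> inj_on (\<Phi> w) (open_unit_disc k)"
    and disj: "\<lbrakk>w \<in> W; v \<in> W; w \<noteq> v\<rbrakk> \<Longrightarrow> \<Phi> w ` open_unit_disc k \<inter> \<Phi> v ` open_unit_disc k = {}"
    and onto: "(\<Union>w\<in>W. \<Phi> w ` open_unit_disc k) = topspace X - A"
begin

definition cell :: "'w \<Rightarrow> 'a set" where "cell w = \<Phi> w ` open_unit_disc k"

definition rest :: "'w set \<Rightarrow> 'a set" where "rest V = topspace X - (\<Union>v\<in>V. cell v)"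

lemma cells_onto: "(\<Union>w\<in>W. cell w) = topspace X - A"
  using onto by (simp add: cell_def)

lemma cell_subset: "w \<in> W \<Longrightarrow> cell w \<subseteq> topspace X - A"
  using cells_onto by auto

lemma disj_cells: "\<lbrakk>w \<in> W; v \<in> W; w \<noteq> v\<rbrakk> \<Longrightarrow> cell w \<inter> cell v = {}"
  using disj unfolding cell_def .

lemma A_subset: "A \<subseteq> topspace X" using closed_A closedin_subset by blast

lemma rest_W: "rest W = A"
  using A_subset by (auto simp: rest_def cells_onto)

lemma rest_empty: "rest {} = topspace X" by (simp add: rest_def)

lemma disc_image: 
  assumes "w \<in> W" shows "\<Phi> w ` unit_disc k \<subseteq> A \<union> cell w"
proof -
  have "unit_disc k = open_unit_disc k \<union> unit_sphere k"
    using open_subset_disc[of k] by (auto simp: unit_sphere_def)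
  then show ?thesis using bdry[OF assms] by (auto simp: cell_def)
qed

lemma A_subset_rest: "V \<subseteq> W \<Longrightarrow> A \<subseteq> rest V"
  using rest_W by (auto simp: rest_def)

lemma open_cell: 
  assumes w: "w \<in> W" shows "openin X (cell w)"
proof -
  have cl: "closedin X (\<Phi> v ` unit_disc k)" if "v \<in> W" for v
    using continuous_imp_closed_map[OF cont[OF that] compact_space_disc haus]
    by (metis closed_map_def closedin_topspace topspace_disc)
  have "cell w = topspace X - (A \<union> (\<Union>v\<in>W - {w}. \<Phi> v ` unit_disc k))"
  proof (intro equalityI subsetI)
    fix x assume x: "x \<in> cell w"
    have "x \<notin> \<Phi> v ` unit_disc k" if "v \<in> W - {w}" for v
    proof -
      have "x \<notin> A \<union> cell v" using disj_cells[OF w, of v] cell_subset[OF w] x that by auto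
      then show ?thesis using contra_subsetD[OF disc_image[of v], of x] that by simp
    qed
    then show "x \<in> topspace X - (A \<union> (\<Union>v\<in>W - {w}. \<Phi> v ` unit_disc k))"
      using subsetD[OF cell_subset[OF w] x] by simp
  next
    fix x assume x: "x \<in> topspace X - (A \<union> (\<Union>v\<in>W - {w}. \<Phi> v ` unit_disc k))"
    then have "x \<in> (\<Union>w\<in>W. cell w)" unfolding cells_onto by simp
    then obtain v where v: "v \<in> W" "x \<in> cell v" by (rule UN_E)
    then have "x \<in> \<Phi> v ` unit_disc k"
      using image_mono[OF open_subset_disc[of k], of "\<Phi> v"] by (auto simp: cell_def)
    then show "x \<in> cell w" using x v by (cases "v = w") simp_all
  qed
  moreover have "closedin X (A \<union> (\<Union>v\<in>W - {w}. \<Phi> v ` unit_disc k))"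
    using fin closed_A cl by (intro closedin_Un closedin_Union) auto
  ultimately show ?thesis by (simp add: openin_diff)
qed

lemma closed_rest: "V \<subseteq> W \<Longrightarrow> closedin X (rest V)"
  unfolding rest_def by (intro closedin_diff openin_Union) (auto intro: open_cell)

lemma attached_cell_in_rest:
  assumes w: "w \<in> V" and V: "V \<subseteq> W"
  shows "attached_cell (subtopology X (rest (V - {w}))) (rest V) k (\<Phi> w)"
proof
  have wW: "w \<in> W" using w V by auto
  have rr: "rest V \<subseteq> rest (V - {w})" by (auto simp: rest_def)
  have cw: "cell w \<subseteq> rest (V - {w})"
  proof
    fix x assume x: "x \<in> cell w"
    have "x \<notin> cell v" if "v \<in> V - {w}" for v
      using disj_cells[OF wW, of v] x that V by auto
    then show "x \<in> rest (V - {w})" using x cell_subset[OF wW] by (auto simp: rest_def)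
  qed
  show "Hausdorff_space (subtopology X (rest (V - {w})))" by (rule Hausdorff_space_subtopology[OF haus])
  show "closedin (subtopology X (rest (V - {w}))) (rest V)"
    using closed_rest[OF V] rr by (simp add: closedin_subset_topspace)
  show "continuous_map (disc k) (subtopology X (rest (V - {w}))) (\<Phi> w)"
    using cont[OF wW] disc_image[OF wW] A_subset_rest[of "V - {w}"] V cw
    by (auto simp: continuous_map_in_subtopology)
  show "\<Phi> w ` unit_sphere k \<subseteq> rest V" using bdry[OF wW] A_subset_rest[OF V] by blast
  show "inj_on (\<Phi> w) (open_unit_disc k)" by (rule inj[OF wW])
  have "rest (V - {w}) - rest V = cell w"
    using cw w by (auto simp: rest_def)
  moreover have "rest (V - {w}) \<subseteq> topspace X" by (auto simp: rest_def)
  ultimately show "\<Phi> w ` open_unit_disc k = topspace (subtopology X (rest (V - {w}))) - rest V"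
    by (simp add: cell_def Int_absorb1)
qed

lemma single_cell: 
  assumes "w \<in> W" shows "attached_cell X (rest {w}) k (\<Phi> w)"
  using attached_cell_in_rest[of w "{w}"] assms by (simp add: rest_empty)

lemma sphere_to_A: "w \<in> W \<Longrightarrow> \<Phi> w \<in> unit_sphere k \<rightarrow> A"
  using bdry by auto

lemma cell_homology_iso:
  assumes "w \<in> W"
  shows "hom_induced p (disc k) (unit_sphere k) X (rest {w}) (\<Phi> w)
    \<in> iso (relative_homology_group p (disc k) (unit_sphere k)) (relative_homology_group p X (rest {w}))"
  by (rule attached_cell.cell_iso[OF single_cell[OF assms]])

text \<open>Induction on the number of cells. If a class dies in \<open>H(X, rest V)\<close>, then by exactness of a triple
  it comes from \<open>H(rest V, rest (insert v V))\<close>. Only the cell \<open>v\<close> is attached in that pair, so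
  projecting to \<open>v\<close> is injective there.\<close>

lemma jointly_injective:
  assumes V: "V \<subseteq> W"
    and c: "c \<in> carrier (relative_homology_group p X (rest V))"
    and z: "\<And>w. w \<in> V \<Longrightarrow> hom_induced p X (rest V) X (rest {w}) id c = \<one>\<^bsub>relative_homology_group p X (rest {w})\<^esub>"
  shows "c = \<one>\<^bsub>relative_homology_group p X (rest V)\<^esub>"
proof -
  have "finite V" using V fin finite_subset by blast
  then show ?thesis using V c z
  proof (induction V arbitrary: c)
    case empty
    then show ?case
      using trivial_relative_homology_group_topspace[of p X] unfolding rest_empty trivial_group_def by blast
  next
    case (insert v V)
    let ?H = "\<lambda>S. relative_homology_group p X S"
    let ?K = "relative_homology_group p (subtopology X (rest V)) (rest (insert v V))"
    have vW: "v \<in> W" and VW: "V \<subseteq> W" using insert.prems by auto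
    have sub: "rest (insert v V) \<subseteq> rest V" by (auto simp: rest_def)
    have subw: "rest V \<subseteq> rest {w}" if "w \<in> V" for w using that by (auto simp: rest_def)
    have subv: "rest (insert v V) \<subseteq> rest {v}" by (auto simp: rest_def)
    let ?c' = "hom_induced p X (rest (insert v V)) X (rest V) id c"
    have "?c' = \<one>\<^bsub>?H (rest V)\<^esub>"
    proof (rule insert.IH[OF VW])
      show "?c' \<in> carrier (?H (rest V))" by (rule hom_induced_carrier)
      fix w assume w: "w \<in> V"
      have "hom_induced p X (rest V) X (rest {w}) id ?c' = hom_induced p X (rest (insert v V)) X (rest {w}) (id \<circ> id) c"
        using sub subw[OF w] by (intro hom_induced_compose') auto
      then show "hom_induced p X (rest V) X (rest {w}) id ?c' = \<one>\<^bsub>?H (rest {w})\<^esub>"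
        using insert.prems(3)[of w] w by simp
    qed
    then have "c \<in> kernel (?H (rest (insert v V))) (?H (rest V)) (hom_induced p X (rest (insert v V)) X (rest V) id)"
      using insert.prems(2) by (simp add: kernel_def)
    also have "\<dots> = hom_induced p (subtopology X (rest V)) (rest (insert v V)) X (rest (insert v V)) id ` carrier ?K"
      using exact_seq_image_eq_kernel[OF homology_exactness_triple_3[OF sub, of p X]] by simp
    finally obtain d where d: "d \<in> carrier ?K"
      "c = hom_induced p (subtopology X (rest V)) (rest (insert v V)) X (rest (insert v V)) id d" by blast
    interpret v: attached_cell "subtopology X (rest V)" "rest (insert v V)" k "\<Phi> v"
      using attached_cell_in_rest[of v "insert v V"] insert.prems(1) insert.hyps(2) by simp
    let ?j = "hom_induced p (subtopology X (rest V)) (rest (insert v V)) X (rest {v}) id"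
    have "?j \<circ> hom_induced p (disc k) (unit_sphere k) (subtopology X (rest V)) (rest (insert v V)) (\<Phi> v)
       = hom_induced p (disc k) (unit_sphere k) X (rest {v}) (\<Phi> v)"
      using subv v.bdry by (subst hom_induced_compose[symmetric])
        (auto intro: v.cont continuous_map_from_subtopology)
    then have "?j \<in> iso ?K (?H (rest {v}))"
      using iso_cancel_right[OF v.cell_iso[of p], of ?j] cell_homology_iso[OF vW, of p] hom_induced_hom by metis
    moreover have "?j d = \<one>\<^bsub>?H (rest {v})\<^esub>"
    proof -
      have "hom_induced p X (rest (insert v V)) X (rest {v}) id c = ?j d"
        unfolding d(2) using subv by (subst hom_induced_compose') (auto intro: continuous_map_from_subtopology)
      then show ?thesis using insert.prems(3)[of v] by simp
    qed
    ultimately have "d = \<one>\<^bsub>?K\<^esub>"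
      using d(1) by (metis (no_types, lifting) bij_betw_imp_inj_on group_relative_homology_group
          group.is_monoid hom_one inj_onD iso_imp_homomorphism Group.iso_iff monoid.one_closed)
    then show ?case
      using d(2) hom_one[OF hom_induced_hom] by simp
  qed
qed

lemma project_cell:
  assumes "w \<in> W" "v \<in> W"
  shows "hom_induced p X A X (rest {w}) id (hom_induced p (disc k) (unit_sphere k) X A (\<Phi> v) c)
    = hom_induced p (disc k) (unit_sphere k) X (rest {w}) (\<Phi> v) c"
  using assms A_subset_rest[of "{w}"] sphere_to_A[of v] cont[of v]
  by (subst hom_induced_compose') auto

text \<open>The characteristic map of \<open>v\<close> factors through the pair of the disc and itself, whose homology is
  trivial, since the closed cell of \<open>v\<close> misses the open cell of \<open>w\<close>.\<close>

lemma project_other_cell: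
  assumes "w \<in> W" "v \<in> W" "v \<noteq> w" 
  shows "hom_induced p (disc k) (unit_sphere k) X (rest {w}) (\<Phi> v) c = \<one>\<^bsub>relative_homology_group p X (rest {w})\<^esub>"
proof (cases "c \<in> carrier (relative_homology_group p (disc k) (unit_sphere k))")
  case False
  then show ?thesis using hom_induced_default by blast
next
  case True
  have im: "\<Phi> v ` unit_disc k \<subseteq> rest {w}"
  proof -
    have "cell v \<subseteq> rest {w}"
      using cell_subset[OF assms(2)] disj_cells[OF assms(2,1,3)] by (auto simp: rest_def)
    moreover have "A \<subseteq> rest {w}" using A_subset_rest[of "{w}"] assms(1) by simp
    ultimately show ?thesis using disc_image[OF assms(2)] by blast
  qed
  have "hom_induced p (disc k) (unit_sphere k) X (rest {w}) (\<Phi> v) c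
    = hom_induced p (disc k) (unit_disc k) X (rest {w}) (\<Phi> v) (hom_induced p (disc k) (unit_sphere k) (disc k) (unit_disc k) id c)"
    using im cont[OF assms(2)] sphere_subset_disc[of k] by (subst hom_induced_compose') auto
  also have "hom_induced p (disc k) (unit_sphere k) (disc k) (unit_disc k) id c = \<one>\<^bsub>relative_homology_group p (disc k) (unit_disc k)\<^esub>"
    using trivial_relative_homology_group_topspace[of p "disc k"] hom_induced_carrier[of p "disc k" "unit_sphere k" "disc k" "unit_disc k" id c]
    by (auto simp: trivial_group_def)
  finally show ?thesis using hom_one[OF hom_induced_hom] by simp
qed

theorem other_degrees:
  assumes "p \<noteq> int k" shows "trivial_group (relative_homology_group p X A)"
proof -
  have "c = \<one>\<^bsub>relative_homology_group p X A\<^esub>" if "c \<in> carrier (relative_homology_group p X A)" for c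
  proof -
    have "c = \<one>\<^bsub>relative_homology_group p X (rest W)\<^esub>"
    proof (rule jointly_injective)
      fix w assume "w \<in> W"
      have "relative_homology_group p (disc k) (unit_sphere k) \<cong> relative_homology_group p X (rest {w})"
        using cell_homology_iso[OF \<open>w \<in> W\<close>] by (rule is_isoI)
      then have "trivial_group (relative_homology_group p X (rest {w}))"
        using disc_homology_other[OF assms] isomorphic_group_triviality by fastforce
      then show "hom_induced p X (rest W) X (rest {w}) id c = \<one>\<^bsub>relative_homology_group p X (rest {w})\<^esub>"
        using hom_induced_carrier[of p X "rest W" X "rest {w}" id c] unfolding trivial_group_def by blast
    qed (use that in \<open>auto simp: rest_W\<close>)
    then show ?thesis by (simp add: rest_W)
  qed
  then show ?thesis
    using group.is_monoid[OF group_relative_homology_group[of p X A]] monoid.one_closed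
    unfolding trivial_group_def by fastforce
qed

text \<open>The coordinate of a class along \<open>w\<close> is its image in \<open>H\<^sub>k(X, rest {w})\<close>, which is infinite cyclic
  because \<open>X\<close> arises from \<open>rest {w}\<close> by attaching one cell.\<close>

theorem cellular_basis:
  assumes \<kappa>: "\<kappa> \<in> iso (relative_homology_group (int k) (disc k) (unit_sphere k)) integer_group"
    and \<iota>: "\<iota> \<in> carrier (relative_homology_group (int k) (disc k) (unit_sphere k))" "\<kappa> \<iota> = 1"
  shows "\<exists>\<pi>. dual_bases (relative_homology_group (int k) X A) W
    (\<lambda>w. hom_induced (int k) (disc k) (unit_sphere k) X A (\<Phi> w) \<iota>) \<pi>"
proof -
  let ?H = "relative_homology_group (int k)"
  define f where "f w = hom_induced (int k) (disc k) (unit_sphere k) X (rest {w}) (\<Phi> w)" for w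
  define \<pi> where "\<pi> w = \<kappa> \<circ> inv_into (carrier (?H (disc k) (unit_sphere k))) (f w) \<circ> hom_induced (int k) X A X (rest {w}) id" for w
  have f: "f w \<in> iso (?H (disc k) (unit_sphere k)) (?H X (rest {w}))" if "w \<in> W" for w
    using cell_homology_iso[OF that] by (simp add: f_def)
  have finv: "inv_into (carrier (?H (disc k) (unit_sphere k))) (f w) \<in> iso (?H X (rest {w})) (?H (disc k) (unit_sphere k))" if "w \<in> W" for w
    using group.iso_set_sym[OF _ f[OF that]] by simp
  have fk: "\<kappa> \<circ> inv_into (carrier (?H (disc k) (unit_sphere k))) (f w) \<in> iso (?H X (rest {w})) integer_group" if "w \<in> W" for w
    by (rule iso_set_trans[OF finv[OF that] \<kappa>])
  have hom: "\<pi> w \<in> hom (?H X A) integer_group" if "w \<in> W" for w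
    unfolding \<pi>_def using fk[OF that] hom_induced_hom by (metis (no_types) hom_compose iso_imp_homomorphism)
  have dual: "\<pi> w (hom_induced (int k) (disc k) (unit_sphere k) X A (\<Phi> v) \<iota>) = (if v = w then 1 else 0)" 
    if "w \<in> W" "v \<in> W" for v w
  proof (cases "v = w")
    case True
    then have "hom_induced (int k) X A X (rest {w}) id (hom_induced (int k) (disc k) (unit_sphere k) X A (\<Phi> v) \<iota>) = f w \<iota>"
      using project_cell that by (simp add: f_def)
    moreover have "inv_into (carrier (?H (disc k) (unit_sphere k))) (f w) (f w \<iota>) = \<iota>"
      using f[OF that(1)] \<iota>(1) by (intro inv_into_f_f) (auto simp: iso_def bij_betw_def)
    ultimately show ?thesis using True \<iota> by (simp add: \<pi>_def)
  next
    case False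
    then have "hom_induced (int k) X A X (rest {w}) id (hom_induced (int k) (disc k) (unit_sphere k) X A (\<Phi> v) \<iota>) = \<one>\<^bsub>?H X (rest {w})\<^esub>"
      using project_cell that project_other_cell by simp
    moreover have "(\<kappa> \<circ> inv_into (carrier (?H (disc k) (unit_sphere k))) (f w)) \<one>\<^bsub>?H X (rest {w})\<^esub> = \<one>\<^bsub>integer_group\<^esub>"
      by (rule hom_one[OF iso_imp_homomorphism[OF fk[OF that(1)]]]) simp_all
    ultimately show ?thesis using False by (simp add: \<pi>_def)
  qed
  have "c = \<one>\<^bsub>?H X A\<^esub>" if c: "c \<in> carrier (?H X A)" and z: "\<forall>w\<in>W. \<pi> w c = 0" for c
  proof -
    have "c = \<one>\<^bsub>?H X (rest W)\<^esub>"
    proof (rule jointly_injective)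
      fix w assume w: "w \<in> W"
      let ?d = "hom_induced (int k) X A X (rest {w}) id c"
      let ?i = "\<kappa> \<circ> inv_into (carrier (?H (disc k) (unit_sphere k))) (f w)"
      have "?i ?d = 0" using z w by (auto simp: \<pi>_def)
      also have "0 = ?i \<one>\<^bsub>?H X (rest {w})\<^esub>"
        using hom_one[OF iso_imp_homomorphism[OF fk[OF w]]] by simp
      finally have "?d = \<one>\<^bsub>?H X (rest {w})\<^esub>"
        using fk[OF w] hom_induced_carrier
        by (metis (no_types, lifting) Group.iso_iff group.is_monoid group_relative_homology_group inj_onD monoid.one_closed)
      then show "hom_induced (int k) X (rest W) X (rest {w}) id c = \<one>\<^bsub>?H X (rest {w})\<^esub>" by (simp add: rest_W)
    qed (use c in \<open>auto simp: rest_W\<close>)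
    then show ?thesis by (simp add: rest_W)
  qed
  then have "dual_bases (?H X A) W (\<lambda>w. hom_induced (int k) (disc k) (unit_sphere k) X A (\<Phi> w) \<iota>) \<pi>"
    unfolding dual_bases_def using fin hom dual hom_induced_carrier by auto
  then show ?thesis by blast
qed

end

section \<open>The group ring of a finite group\<close>

locale finite_group = group G for G (structure) +
  assumes finite_carrier: "finite (carrier G)"
begin

abbreviation "ZG \<equiv> group_ring G"

lemma carrier_group_ring: "carrier ZG = {f. \<forall>x. x \<notin> carrier G \<longrightarrow> f x = 0}"
proof -
  have "finite {x. f x \<noteq> 0}" if "\<forall>x. x \<notin> carrier G \<longrightarrow> f x = 0" for f :: "'a \<Rightarrow> int"
    using that by (intro finite_subset[OF _ finite_carrier]) auto
  then show ?thesis by (auto simp: group_ring_def)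
qed

lemma add_group_ring: "f \<oplus>\<^bsub>ZG\<^esub> f' = (\<lambda>x. f x + f' x)"
  and zero_group_ring: "\<zero>\<^bsub>ZG\<^esub> = (\<lambda>x. 0)"
  and one_group_ring: "\<one>\<^bsub>ZG\<^esub> = (\<lambda>x. if x = \<one> then 1 else 0)"
  by (simp_all add: group_ring_def)

lemma mult_group_ring:
  assumes "f \<in> carrier ZG"
  shows "f \<otimes>\<^bsub>ZG\<^esub> f' = (\<lambda>x. if x \<in> carrier G then \<Sum>y\<in>carrier G. f y * f' (inv y \<otimes> x) else 0)"
proof -
  have "(\<Sum>y | f y \<noteq> 0. f y * f' (inv y \<otimes> x)) = (\<Sum>y\<in>carrier G. f y * f' (inv y \<otimes> x))" for x
    using assms finite_carrier by (intro sum.mono_neutral_left) (auto simp: carrier_group_ring)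
  then show ?thesis by (simp add: group_ring_def fun_eq_iff)
qed

lemma mult_group_ring_closed: "f \<in> carrier ZG \<Longrightarrow> f \<otimes>\<^bsub>ZG\<^esub> f' \<in> carrier ZG"
  by (simp add: mult_group_ring) (simp add: carrier_group_ring)

text \<open>The substitution \<open>y = z \<otimes> u\<close> in the double sum for a product of three elements makes convolution
  associative.\<close>

lemma sum_translate:
  assumes "z \<in> carrier G"
  shows "(\<Sum>y\<in>carrier G. F y) = (\<Sum>u\<in>carrier G. F (z \<otimes> u))"
proof (rule sum.reindex_bij_witness[of _ "\<lambda>u. z \<otimes> u" "\<lambda>y. inv z \<otimes> y"])
qed (use assms in \<open>simp_all add: m_assoc[symmetric]\<close>)

lemma mult_group_ring_assoc:
  assumes f: "f \<in> carrier ZG" and f': "f' \<in> carrier ZG" and f'': "f'' \<in> carrier ZG"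
  shows "(f \<otimes>\<^bsub>ZG\<^esub> f') \<otimes>\<^bsub>ZG\<^esub> f'' = f \<otimes>\<^bsub>ZG\<^esub> (f' \<otimes>\<^bsub>ZG\<^esub> f'')"
proof
  fix x
  show "((f \<otimes>\<^bsub>ZG\<^esub> f') \<otimes>\<^bsub>ZG\<^esub> f'') x = (f \<otimes>\<^bsub>ZG\<^esub> (f' \<otimes>\<^bsub>ZG\<^esub> f'')) x"
  proof (cases "x \<in> carrier G")
    case True
    have "((f \<otimes>\<^bsub>ZG\<^esub> f') \<otimes>\<^bsub>ZG\<^esub> f'') x
       = (\<Sum>y\<in>carrier G. (\<Sum>z\<in>carrier G. f z * f' (inv z \<otimes> y)) * f'' (inv y \<otimes> x))"
      using True by (simp add: mult_group_ring[OF f] mult_group_ring[OF mult_group_ring_closed[OF f, of f'], unfolded mult_group_ring[OF f]])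
    also have "\<dots> = (\<Sum>z\<in>carrier G. \<Sum>y\<in>carrier G. f z * f' (inv z \<otimes> y) * f'' (inv y \<otimes> x))"
      by (simp add: sum_distrib_right) (rule sum.swap)
    also have "\<dots> = (\<Sum>z\<in>carrier G. f z * (\<Sum>u\<in>carrier G. f' u * f'' (inv u \<otimes> (inv z \<otimes> x))))"
    proof (rule sum.cong[OF refl])
      fix z assume z: "z \<in> carrier G"
      have "(\<Sum>y\<in>carrier G. f z * f' (inv z \<otimes> y) * f'' (inv y \<otimes> x))
        = (\<Sum>u\<in>carrier G. f z * f' (inv z \<otimes> (z \<otimes> u)) * f'' (inv (z \<otimes> u) \<otimes> x))"
        by (rule sum_translate[OF z])
      also have "\<dots> = (\<Sum>u\<in>carrier G. f z * (f' u * f'' (inv u \<otimes> (inv z \<otimes> x))))"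
        using z True by (intro sum.cong refl) (simp add: m_assoc[symmetric] inv_mult_group)
      finally show "(\<Sum>y\<in>carrier G. f z * f' (inv z \<otimes> y) * f'' (inv y \<otimes> x))
        = f z * (\<Sum>u\<in>carrier G. f' u * f'' (inv u \<otimes> (inv z \<otimes> x)))"
        by (simp add: sum_distrib_left)
    qed
    also have "\<dots> = (f \<otimes>\<^bsub>ZG\<^esub> (f' \<otimes>\<^bsub>ZG\<^esub> f'')) x"
      using True by (simp add: mult_group_ring[OF f] mult_group_ring[OF f'])
    finally show ?thesis .
  next
    case False
    then show ?thesis
      using mult_group_ring_closed[OF mult_group_ring_closed[OF f]] mult_group_ring_closed[OF f]
      by (simp add: carrier_group_ring)
  qed
qed

lemma delta_mult:
  assumes s: "s \<in> carrier G" and f: "f \<in> carrier ZG"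
  shows "group_ring_of s \<otimes>\<^bsub>ZG\<^esub> f = (\<lambda>x. if x \<in> carrier G then f (inv s \<otimes> x) else 0)"
proof -
  have "group_ring_of s \<in> carrier ZG" using s by (auto simp: carrier_group_ring group_ring_of_def)
  then show ?thesis
    using s finite_carrier by (simp add: mult_group_ring group_ring_of_def if_distrib[where f="\<lambda>a. a * _"] cong: if_cong)
qed

lemma one_eq_delta: "\<one>\<^bsub>ZG\<^esub> = group_ring_of \<one>"
  by (auto simp: one_group_ring group_ring_of_def)

lemma delta_closed: "s \<in> carrier G \<Longrightarrow> group_ring_of s \<in> carrier ZG"
  by (auto simp: carrier_group_ring group_ring_of_def)

lemma ring_group_ring: "ring ZG"
proof (rule ringI)
  show "abelian_group ZG"
  proof (rule abelian_groupI)
    fix f assume "f \<in> carrier ZG"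
    then show "\<exists>y\<in>carrier ZG. y \<oplus>\<^bsub>ZG\<^esub> f = \<zero>\<^bsub>ZG\<^esub>"
      by (intro bexI[of _ "\<lambda>x. - f x"]) (simp_all add: add_group_ring zero_group_ring carrier_group_ring)
  qed (simp_all add: add_group_ring zero_group_ring carrier_group_ring fun_eq_iff)
  show "monoid ZG"
  proof (rule monoidI)
    fix f assume f: "f \<in> carrier ZG"
    show "\<one>\<^bsub>ZG\<^esub> \<otimes>\<^bsub>ZG\<^esub> f = f"
      using f by (auto simp: one_eq_delta delta_mult carrier_group_ring)
    show "f \<otimes>\<^bsub>ZG\<^esub> \<one>\<^bsub>ZG\<^esub> = f"
    proof
      fix x
      have "(inv y \<otimes> x = \<one>) = (y = x)" if "x \<in> carrier G" "y \<in> carrier G" for y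
        using that by (metis inv_closed inv_equality inv_inv l_inv)
      then show "(f \<otimes>\<^bsub>ZG\<^esub> \<one>\<^bsub>ZG\<^esub>) x = f x"
        using f finite_carrier
        by (auto simp: mult_group_ring[OF f] one_group_ring carrier_group_ring if_distrib[where f="\<lambda>a. _ * a"] cong: sum.cong if_cong)
    qed
  qed (simp_all add: mult_group_ring_closed mult_group_ring_assoc one_eq_delta delta_closed)
  fix f f' f'' assume f: "f \<in> carrier ZG" "f' \<in> carrier ZG" "f'' \<in> carrier ZG"
  have "f \<oplus>\<^bsub>ZG\<^esub> f' \<in> carrier ZG" using f by (simp add: add_group_ring carrier_group_ring)
  then show "(f \<oplus>\<^bsub>ZG\<^esub> f') \<otimes>\<^bsub>ZG\<^esub> f'' = f \<otimes>\<^bsub>ZG\<^esub> f'' \<oplus>\<^bsub>ZG\<^esub> f' \<otimes>\<^bsub>ZG\<^esub> f''"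
    using f by (auto simp: mult_group_ring add_group_ring distrib_right sum.distrib)
  show "f'' \<otimes>\<^bsub>ZG\<^esub> (f \<oplus>\<^bsub>ZG\<^esub> f') = f'' \<otimes>\<^bsub>ZG\<^esub> f \<oplus>\<^bsub>ZG\<^esub> f'' \<otimes>\<^bsub>ZG\<^esub> f'"
    using f by (auto simp: mult_group_ring add_group_ring distrib_left sum.distrib)
qed

end

section \<open>Free modules\<close>

lemma (in ring) left_module_free_module: "left_module R (free_module R m)"
proof -
  have ab: "abelian_group (free_module R m)"
  proof (rule abelian_groupI)
    fix x assume x: "x \<in> carrier (free_module R m)"
    then show "\<exists>y\<in>carrier (free_module R m). y \<oplus>\<^bsub>free_module R m\<^esub> x = \<zero>\<^bsub>free_module R m\<^esub>"
      by (intro bexI[of _ "\<lambda>j\<in>{..<m}. \<ominus> x j"]) (auto simp: free_module_def PiE_iff l_neg intro!: restrict_ext)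
  qed (auto simp: free_module_def PiE_iff a_assoc extensional_def intro!: restrict_ext a_comm)
  interpret M: abelian_group "free_module R m" by (rule ab)
  show ?thesis
    by unfold_locales
      (auto simp: free_module_def PiE_iff l_distr r_distr m_assoc extensional_def intro!: restrict_ext)
qed

section \<open>Dual bases\<close>

locale dual_basis = comm_group M for M (structure) +
  fixes W :: "'w set" and e :: "'w \<Rightarrow> 'a" and \<pi> :: "'w \<Rightarrow> 'a \<Rightarrow> int"
  assumes dual: "dual_bases M W e \<pi>"
begin

lemma finW: "finite W" and eM: "w \<in> W \<Longrightarrow> e w \<in> carrier M"
  and \<pi>hom: "w \<in> W \<Longrightarrow> \<pi> w \<in> hom M integer_group"
  and \<pi>e: "w \<in> W \<Longrightarrow> v \<in> W \<Longrightarrow> \<pi> w (e v) = (if v = w then 1 else 0)"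
  and \<pi>inj: "c \<in> carrier M \<Longrightarrow> (\<And>w. w \<in> W \<Longrightarrow> \<pi> w c = 0) \<Longrightarrow> c = \<one>"
  using dual unfolding dual_bases_def by auto

definition comb :: "('w \<Rightarrow> int) \<Rightarrow> 'a" where "comb z = finprod M (\<lambda>w. e w [^] z w) W"

lemma comb_closed: "comb z \<in> carrier M"
  unfolding comb_def using eM by (intro finprod_closed) auto

lemma integer_hom_mult: "h \<in> hom M integer_group \<Longrightarrow> a \<in> carrier M \<Longrightarrow> b \<in> carrier M \<Longrightarrow> h (a \<otimes> b) = h a + h b"
  by (auto dest: hom_mult)

lemma integer_hom_one: "h \<in> hom M integer_group \<Longrightarrow> h \<one> = 0"
  using hom_one[of h M integer_group] by simp

lemma integer_hom_inv: "h \<in> hom M integer_group \<Longrightarrow> a \<in> carrier M \<Longrightarrow> h (inv a) = - h a"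
  using integer_hom_mult[of h "inv a" a] integer_hom_one[of h] by simp

lemma integer_hom_pow: "h \<in> hom M integer_group \<Longrightarrow> a \<in> carrier M \<Longrightarrow> h (a [^] (z::int)) = z * h a"
  using hom_int_pow[of h M integer_group a z] by simp

lemma integer_hom_finprod:
  assumes h: "h \<in> hom M integer_group" and "finite F" "f \<in> F \<rightarrow> carrier M"
  shows "h (finprod M f F) = (\<Sum>w\<in>F. h (f w))"
  using assms(2,3)
  by (induction F) (auto simp: integer_hom_one[OF h] integer_hom_mult[OF h])

lemma integer_hom_comb:
  assumes h: "h \<in> hom M integer_group"
  shows "h (comb z) = (\<Sum>w\<in>W. z w * h (e w))"
  unfolding comb_def using eM finW
  by (subst integer_hom_finprod[OF h]) (auto simp: integer_hom_pow[OF h])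

lemma \<pi>_comb: "w \<in> W \<Longrightarrow> \<pi> w (comb z) = z w"
  using finW by (simp add: integer_hom_comb[OF \<pi>hom] \<pi>e if_distrib cong: if_cong sum.cong)

lemma eqI:
  assumes "c \<in> carrier M" "d \<in> carrier M" "\<And>w. w \<in> W \<Longrightarrow> \<pi> w c = \<pi> w d"
  shows "c = d"
proof -
  have "c \<otimes> inv d = \<one>"
    using assms by (intro \<pi>inj) (simp_all add: integer_hom_mult[OF \<pi>hom] integer_hom_inv[OF \<pi>hom])
  then show ?thesis using assms by (metis inv_equality inv_inv inv_closed)
qed

lemma comb_\<pi>: "c \<in> carrier M \<Longrightarrow> comb (\<lambda>w. \<pi> w c) = c"
  by (rule eqI) (simp_all add: comb_closed \<pi>_comb)

text \<open>Used to compute the coordinates of a transformed class from the images of the basis elements.\<close>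

lemma integer_hom_expand:
  assumes "h \<in> hom M integer_group" "c \<in> carrier M"
  shows "h c = (\<Sum>w\<in>W. \<pi> w c * h (e w))"
  using integer_hom_comb[OF assms(1), of "\<lambda>w. \<pi> w c"] comb_\<pi>[OF assms(2)] by simp

lemma dual_basis_reindex:
  assumes "bij_betw b V W"
  shows "dual_bases M V (e \<circ> b) (\<pi> \<circ> b)"
proof -
  have b: "b v \<in> W" if "v \<in> V" for v using assms that by (auto simp: bij_betw_def)
  have "c = \<one>" if "c \<in> carrier M" "\<forall>v\<in>V. \<pi> (b v) c = 0" for c
    using that assms by (intro \<pi>inj) (auto simp: bij_betw_def)
  moreover have "finite V" using assms finW bij_betw_finite by blast
  moreover have "b v = b w \<longleftrightarrow> v = w" if "v \<in> V" "w \<in> V" for v w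
    using assms that by (auto simp: bij_betw_def inj_on_def)
  ultimately show ?thesis
    unfolding dual_bases_def using b eM \<pi>hom \<pi>e comm_group_axioms by auto
qed

end

section \<open>Free modules over the group ring from freely permuted bases\<close>

text \<open>A \<open>\<int>\<close>-basis indexed by \<open>{..<m} \<times> G\<close> on which \<open>G\<close> acts by translation of the second index. This is
  the same as a free module of rank \<open>m\<close> over the group ring, and the functions \<open>to_group\<close> and
  \<open>to_free\<close> translate between the two descriptions.\<close>

locale permuted_basis = finite_group G + B: dual_basis M "{..<m} \<times> carrier G" e \<pi>
  for G :: "('g, 'k) monoid_scheme" (structure) and M :: "('a, 'l) monoid_scheme" (structure)
    and m :: nat and e :: "nat \<times> 'g \<Rightarrow> 'a" and \<pi> :: "nat \<times> 'g \<Rightarrow> 'a \<Rightarrow> int" +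
  fixes act :: "'g \<Rightarrow> 'a \<Rightarrow> 'a"
  assumes act_hom: "s \<in> carrier G \<Longrightarrow> act s \<in> hom M M"
    and act_e: "s \<in> carrier G \<Longrightarrow> t \<in> carrier G \<Longrightarrow> j < m \<Longrightarrow> act s (e (j, t)) = e (j, s \<otimes>\<^bsub>G\<^esub> t)"
begin

abbreviation "F \<equiv> free_module ZG m"

definition to_group :: "(nat \<Rightarrow> 'g \<Rightarrow> int) \<Rightarrow> 'a" where "to_group x = B.comb (\<lambda>(j, s). x j s)"

definition to_free :: "'a \<Rightarrow> nat \<Rightarrow> 'g \<Rightarrow> int"
  where "to_free c = (\<lambda>j\<in>{..<m}. \<lambda>s. if s \<in> carrier G then \<pi> (j, s) c else 0)"

lemma carrier_F: "x \<in> carrier F \<longleftrightarrow> x \<in> {..<m} \<rightarrow>\<^sub>E carrier ZG"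
  by (simp add: free_module_def)

lemma to_group_closed: "to_group x \<in> carrier M"
  by (simp add: to_group_def B.comb_closed)

lemma to_free_closed: "to_free c \<in> carrier F"
  by (auto simp: carrier_F to_free_def carrier_group_ring)

lemma to_group_to_free: "c \<in> carrier M \<Longrightarrow> to_group (to_free c) = c"
  by (rule B.eqI) (auto simp: to_group_closed to_group_def B.comb_closed B.\<pi>_comb to_free_def)

lemma to_free_to_group:
  assumes "x \<in> carrier F" shows "to_free (to_group x) = x"
proof
  fix j show "to_free (to_group x) j = x j"
    using assms by (auto simp: to_free_def to_group_def B.\<pi>_comb carrier_F PiE_iff extensional_def carrier_group_ring Pi_iff fun_eq_iff)
qed

lemma to_group_onto: "to_group ` carrier F = carrier M"
proof (intro equalityI subsetI)
  fix c assume "c \<in> carrier M"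
  then show "c \<in> to_group ` carrier F"
    by (intro image_eqI[of _ _ "to_free c"]) (simp_all add: to_group_to_free to_free_closed)
qed (auto simp: to_group_closed)

lemma to_free_mult: "c \<in> carrier M \<Longrightarrow> d \<in> carrier M \<Longrightarrow> to_free (c \<otimes>\<^bsub>M\<^esub> d) = to_free c \<oplus>\<^bsub>F\<^esub> to_free d"
  by (auto simp: to_free_def free_module_def add_group_ring B.integer_hom_mult[OF B.\<pi>hom] fun_eq_iff)

lemma to_group_add:
  assumes "x \<in> carrier F" "y \<in> carrier F"
  shows "to_group (x \<oplus>\<^bsub>F\<^esub> y) = to_group x \<otimes>\<^bsub>M\<^esub> to_group y"
proof -
  have "x \<oplus>\<^bsub>F\<^esub> y = to_free (to_group x \<otimes>\<^bsub>M\<^esub> to_group y)"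
    using assms by (simp add: to_free_mult to_group_closed to_free_to_group)
  then show ?thesis by (simp add: to_group_to_free to_group_closed)
qed

lemma to_free_one: "to_free \<one>\<^bsub>M\<^esub> = \<zero>\<^bsub>F\<^esub>"
  by (auto simp: to_free_def free_module_def zero_group_ring B.integer_hom_one[OF B.\<pi>hom] fun_eq_iff)

lemma to_group_zero: "to_group \<zero>\<^bsub>F\<^esub> = \<one>\<^bsub>M\<^esub>"
  by (simp flip: to_free_one add: to_group_to_free)

lemma act_closed: "s \<in> carrier G \<Longrightarrow> c \<in> carrier M \<Longrightarrow> act s c \<in> carrier M"
  using act_hom hom_in_carrier by metis

text \<open>Acting by \<open>s\<close> translates basis elements by \<open>s\<close>, hence coordinates by the inverse of \<open>s\<close>. This
  inverse is the one in the convolution product of the group ring.\<close>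

lemma \<pi>_act:
  assumes s: "s \<in> carrier G" and t: "t \<in> carrier G" and j: "j < m" and c: "c \<in> carrier M"
  shows "\<pi> (j, t) (act s c) = \<pi> (j, inv\<^bsub>G\<^esub> s \<otimes>\<^bsub>G\<^esub> t) c"
proof -
  have h: "\<pi> (j, t) \<circ> act s \<in> hom M integer_group"
    using Group.hom_compose[OF act_hom[OF s] B.\<pi>hom[of "(j, t)"]] t j by simp
  have "(s \<otimes>\<^bsub>G\<^esub> u = t) = (u = inv\<^bsub>G\<^esub> s \<otimes>\<^bsub>G\<^esub> t)" if "u \<in> carrier G" for u
    using s t that by (metis inv_solve_left)
  then have *: "(\<pi> (j, t) \<circ> act s) (e w) = (if w = (j, inv\<^bsub>G\<^esub> s \<otimes>\<^bsub>G\<^esub> t) then 1 else 0)"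
    if "w \<in> {..<m} \<times> carrier G" for w
    using that s t j by (cases w) (auto simp: act_e B.\<pi>e)
  have "\<pi> (j, t) (act s c) = (\<Sum>w\<in>{..<m} \<times> carrier G. \<pi> w c * (\<pi> (j, t) \<circ> act s) (e w))"
    using B.integer_hom_expand[OF h c] by simp
  also have "\<dots> = (\<Sum>w\<in>{..<m} \<times> carrier G. if w = (j, inv\<^bsub>G\<^esub> s \<otimes>\<^bsub>G\<^esub> t) then \<pi> w c else 0)"
    using * by (intro sum.cong refl) (simp only: comp_apply, simp)
  also have "\<dots> = \<pi> (j, inv\<^bsub>G\<^esub> s \<otimes>\<^bsub>G\<^esub> t) c"
    using B.finW s t j by (subst sum.delta) auto
  finally show ?thesis .
qed

text \<open>The action of the group ring that extends the group action linearly.\<close>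

definition scale :: "('g \<Rightarrow> int) \<Rightarrow> 'a \<Rightarrow> 'a"
  where "scale a c = finprod M (\<lambda>y. act y c [^]\<^bsub>M\<^esub> a y) (carrier G)"

lemma scale_closed: "c \<in> carrier M \<Longrightarrow> scale a c \<in> carrier M"
  unfolding scale_def by (intro B.finprod_closed) (auto intro: act_closed)

lemma to_free_scale:
  assumes a: "a \<in> carrier ZG" and c: "c \<in> carrier M"
  shows "to_free (scale a c) = a \<odot>\<^bsub>F\<^esub> to_free c"
proof -
  have "\<pi> (j, t) (scale a c) = (\<Sum>y\<in>carrier G. a y * \<pi> (j, inv\<^bsub>G\<^esub> y \<otimes>\<^bsub>G\<^esub> t) c)" if "j < m" "t \<in> carrier G" for j t
  proof -
    have h: "\<pi> (j, t) \<in> hom M integer_group" using that by (intro B.\<pi>hom) auto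
    have "\<pi> (j, t) (scale a c) = (\<Sum>y\<in>carrier G. \<pi> (j, t) (act y c [^]\<^bsub>M\<^esub> a y))"
      unfolding scale_def using c finite_carrier by (intro B.integer_hom_finprod[OF h]) (auto intro: act_closed)
    also have "\<dots> = (\<Sum>y\<in>carrier G. a y * \<pi> (j, inv\<^bsub>G\<^esub> y \<otimes>\<^bsub>G\<^esub> t) c)"
      using c that by (intro sum.cong refl) (simp add: B.integer_hom_pow[OF h] act_closed \<pi>_act)
    finally show ?thesis .
  qed
  then show ?thesis
    by (auto simp: to_free_def free_module_def mult_group_ring[OF a] fun_eq_iff intro!: sum.cong)
qed

lemma to_group_smult: 
  assumes "a \<in> carrier ZG" "x \<in> carrier F" 
  shows "to_group (a \<odot>\<^bsub>F\<^esub> x) = scale a (to_group x)"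
  using to_free_scale[OF assms(1) to_group_closed, of x] assms(2)
  by (metis scale_closed to_free_to_group to_group_closed to_group_to_free)

lemma scale_delta:
  assumes s: "s \<in> carrier G" and c: "c \<in> carrier M"
  shows "scale (group_ring_of s) c = act s c"
proof -
  have "scale (group_ring_of s) c = finprod M (\<lambda>y. if s = y then act y c else \<one>\<^bsub>M\<^esub>) (carrier G)"
    unfolding scale_def using c by (intro B.finprod_cong') (auto simp: group_ring_of_def B.int_pow_1 act_closed)
  also have "\<dots> = act s c"
    using s c finite_carrier by (subst B.finprod_singleton) (auto intro: act_closed)
  finally show ?thesis .
qed

end

section \<open>Equivariant two-term complexes\<close>

text \<open>The isomorphism theorem for cycles modulo boundaries. The second part describes a homology class as
  a set of cycles on which \<open>\<theta>\<close> is constant; it is used to compare the action on classes with the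
  action on cycles.\<close>

lemma complex_homology_iso:
  fixes C :: "int \<Rightarrow> ('r, 'a) module" and H :: "('c, 'm) monoid_scheme"
  assumes cpx: "module_complex R C d"
    and H: "group H"
    and \<theta>: "\<And>x y. x \<in> Z \<Longrightarrow> y \<in> Z \<Longrightarrow> \<theta> (x \<oplus>\<^bsub>C p\<^esub> y) = \<theta> x \<otimes>\<^bsub>H\<^esub> \<theta> y"
    and Z: "Z = {x \<in> carrier (C p). d p x = \<zero>\<^bsub>C (p - 1)\<^esub>}"
    and surj: "\<theta> ` Z = carrier H"
    and ker: "{x \<in> Z. \<theta> x = \<one>\<^bsub>H\<^esub>} = d (p + 1) ` carrier (C (p + 1))"
  shows "(\<lambda>c. the_elem (\<theta> ` c)) \<in> iso (complex_homology C d p) H"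
    and "c \<in> carrier (complex_homology C d p) \<Longrightarrow> c \<subseteq> Z \<and> (\<exists>z\<in>Z. \<theta> ` c = {\<theta> z})"
proof -
  let ?A = "add_monoid (C p)"
  let ?Z = "?A \<lparr>carrier := Z\<rparr>"
  have lm: "left_module R (C q)" for q using cpx by (simp add: module_complex_def)
  have ab: "abelian_group (C q)" for q using left_module.axioms(2)[OF lm] .
  have dlin: "d p \<in> left_linear R (C p) (C (p - 1))" using cpx by (simp add: module_complex_def)
  interpret Cp: abelian_group "C p" by (rule ab)
  interpret Cp1: abelian_group "C (p - 1)" by (rule ab)
  have gA: "group ?A" by (rule Cp.a_group)
  have gA1: "group (add_monoid (C (p - 1)))" by (rule Cp1.a_group)
  have dh: "d p \<in> hom ?A (add_monoid (C (p - 1)))"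
    using dlin by (auto simp: hom_def left_linear_def)
  interpret dh: group_hom ?A "add_monoid (C (p - 1))" "d p"
    using gA gA1 dh by (simp add: group_hom_def group_hom_axioms_def)
  have Zker: "Z = kernel ?A (add_monoid (C (p - 1))) (d p)" by (simp add: Z kernel_def)
  have sZ: "subgroup Z ?A" unfolding Zker by (rule dh.subgroup_kernel)
  have gZ: "group ?Z" by (rule group.subgroup_imp_group[OF gA sZ])
  interpret th: group_hom ?Z H \<theta>
    using gZ H \<theta> surj by (auto simp: group_hom_def group_hom_axioms_def hom_def)
  have k: "kernel ?Z H \<theta> = d (p + 1) ` carrier (C (p + 1))" using ker by (simp add: kernel_def)
  have ch: "complex_homology C d p = ?Z Mod kernel ?Z H \<theta>"
    by (simp only: complex_homology_def k Z[symmetric])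
  show "(\<lambda>c. the_elem (\<theta> ` c)) \<in> iso (complex_homology C d p) H"
    unfolding ch by (rule th.FactGroup_iso_set) (simp add: surj)
  assume "c \<in> carrier (complex_homology C d p)"
  then obtain z where z: "z \<in> Z" and c: "c = r_coset ?Z (kernel ?Z H \<theta>) z"
    unfolding ch carrier_FactGroup by auto
  have el: "x \<in> c \<longleftrightarrow> (\<exists>b\<in>kernel ?Z H \<theta>. x = b \<oplus>\<^bsub>C p\<^esub> z)" for x by (auto simp: c r_coset_def)
  have kz: "b \<in> Z" "\<theta> b = \<one>\<^bsub>H\<^esub>" if "b \<in> kernel ?Z H \<theta>" for b using that by (auto simp: kernel_def)
  have "c \<subseteq> Z" using el kz(1) subgroup.m_closed[OF sZ] z by auto
  moreover have "\<theta> x = \<theta> z" if "x \<in> c" for x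
    using that el \<theta>[OF kz(1) z] kz(2) H z surj by (auto simp: group.is_monoid[THEN monoid.l_one])
  moreover have "c \<noteq> {}" using el monoid.one_closed[OF group.is_monoid[OF gZ]] th.hom_one by (force simp: kernel_def)
  ultimately have "c \<subseteq> Z" "\<theta> ` c = {\<theta> z}" by auto
  with z show "c \<subseteq> Z \<and> (\<exists>z\<in>Z. \<theta> ` c = {\<theta> z})" by (intro conjI bexI)
qed

lemma the_elem_equivariant:
  assumes "c \<subseteq> Z" "\<theta> ` c = {b}" "\<And>z. z \<in> Z \<Longrightarrow> \<theta> (f z) = \<alpha> (\<theta> z)"
  shows "the_elem (\<theta> ` (f ` c)) = \<alpha> (the_elem (\<theta> ` c))"
proof -
  have "\<theta> ` f ` c = \<alpha> ` \<theta> ` c" using assms(1,3) by (auto simp: image_iff subset_iff)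
  then show ?thesis using assms(2) by simp
qed

locale equivariant_map = M: permuted_basis G M m e \<pi> act + K: permuted_basis G K m' e' \<pi>' act'
  for G :: "('g, 'k) monoid_scheme" (structure)
    and M :: "('a, 'l) monoid_scheme" and m e \<pi> act
    and K :: "('b, 'l') monoid_scheme" and m' e' \<pi>' act' +
  fixes bd :: "'a \<Rightarrow> 'b"
  assumes bd_hom: "bd \<in> hom M K"
    and bd_act: "s \<in> carrier G \<Longrightarrow> c \<in> carrier M \<Longrightarrow> bd (act s c) = act' s (bd c)"
begin

abbreviation "ZG \<equiv> group_ring G"

definition differential :: "(nat \<Rightarrow> 'g \<Rightarrow> int) \<Rightarrow> nat \<Rightarrow> 'g \<Rightarrow> int"
  where "differential x = K.to_free (bd (M.to_group x))"

lemma bd_closed: "c \<in> carrier M \<Longrightarrow> bd c \<in> carrier K"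
  using bd_hom by (rule hom_in_carrier)

lemma bd_scale:
  assumes "c \<in> carrier M" shows "bd (M.scale a c) = K.scale a (bd c)"
proof -
  have gK: "group K" and gM: "group M" by (rule K.B.group_axioms, rule M.B.group_axioms)
  have "bd (finprod M f S) = finprod K (\<lambda>y. bd (f y)) S" if "finite S" "f \<in> S \<rightarrow> carrier M" for f S
    using that
  proof (induction S)
    case empty
    then show ?case using hom_one[OF bd_hom gM gK] by simp
  next
    case (insert y S)
    then have "bd (finprod M f (insert y S)) = bd (f y \<otimes>\<^bsub>M\<^esub> finprod M f S)" by simp
    also have "\<dots> = bd (f y) \<otimes>\<^bsub>K\<^esub> bd (finprod M f S)"
      using insert.prems by (intro hom_mult[OF bd_hom]) auto
    also have "\<dots> = finprod K (\<lambda>y. bd (f y)) (insert y S)"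
      using insert bd_closed by (subst K.B.finprod_insert) (auto simp: Pi_iff)
    finally show ?case .
  qed
  moreover have "(\<lambda>y. act y c [^]\<^bsub>M\<^esub> a y) \<in> carrier G \<rightarrow> carrier M"
    using assms by (auto simp: M.act_closed)
  ultimately have "bd (M.scale a c) = finprod K (\<lambda>y. bd (act y c [^]\<^bsub>M\<^esub> a y)) (carrier G)"
    unfolding M.scale_def using M.finite_carrier by blast
  also have "\<dots> = K.scale a (bd c)"
    unfolding K.scale_def
    using assms bd_closed M.act_closed K.act_closed
    by (intro K.B.finprod_cong') (auto simp: bd_act hom_int_pow[OF bd_hom _ gM gK])
  finally show ?thesis .
qed

lemma differential_closed: "differential x \<in> carrier K.F"
  by (simp add: differential_def K.to_free_closed)

lemma differential_add: "x \<in> carrier M.F \<Longrightarrow> y \<in> carrier M.F \<Longrightarrow> differential (x \<oplus>\<^bsub>M.F\<^esub> y) = differential x \<oplus>\<^bsub>K.F\<^esub> differential y"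
  by (simp add: differential_def M.to_group_add hom_mult[OF bd_hom] M.to_group_closed K.to_free_mult bd_closed)

lemma differential_smult: "a \<in> carrier ZG \<Longrightarrow> x \<in> carrier M.F \<Longrightarrow> differential (a \<odot>\<^bsub>M.F\<^esub> x) = a \<odot>\<^bsub>K.F\<^esub> differential x"
  by (simp add: differential_def M.to_group_smult bd_scale M.to_group_closed K.to_free_scale bd_closed)

lemma differential_zero: "differential \<zero>\<^bsub>M.F\<^esub> = \<zero>\<^bsub>K.F\<^esub>"
  using hom_one[OF bd_hom M.B.group_axioms K.B.group_axioms]
  by (simp add: differential_def M.to_group_zero K.to_free_one)

lemma differential_eq_zero_iff: "x \<in> carrier M.F \<Longrightarrow> differential x = \<zero>\<^bsub>K.F\<^esub> \<longleftrightarrow> bd (M.to_group x) = \<one>\<^bsub>K\<^esub>"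
  by (metis differential_def K.to_free_one K.to_group_to_free K.to_group_zero M.to_group_closed bd_closed)

lemma to_group_image_differential: "K.to_group ` differential ` carrier M.F = bd ` carrier M"
proof -
  have "K.to_group (differential x) = bd (M.to_group x)" for x
    by (simp add: differential_def K.to_group_to_free bd_closed M.to_group_closed)
  then have "K.to_group ` differential ` carrier M.F = bd ` M.to_group ` carrier M.F"
    by (simp add: image_image)
  also have "M.to_group ` carrier M.F = carrier M" by (rule M.to_group_onto)
  finally show ?thesis .
qed

end

lemma carrier_free_module_0: "carrier (free_module R 0) = {\<zero>\<^bsub>free_module R 0\<^esub>}"
  by (auto simp: free_module_def)

text \<open>A complex with at most one nonzero differential has the kernel and the cokernel of that differential as its
  homology. So it suffices that \<open>q\<close> embeds \<open>H n\<close> as the kernel of the given map and that \<open>r\<close> presents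
  \<open>H (n - 1)\<close> as its cokernel.\<close>

theorem (in equivariant_map) two_term_homology:
  fixes H :: "int \<Rightarrow> 'c monoid" and \<alpha> :: "int \<Rightarrow> 'g \<Rightarrow> 'c \<Rightarrow> 'c" and n :: nat
  defines "C \<equiv> two_term ZG n m m'"
  assumes H: "\<And>p. group (H p)"
    and \<alpha>: "\<And>p s. s \<in> carrier G \<Longrightarrow> \<alpha> p s \<in> hom (H p) (H p)"
    and triv: "\<And>p. p \<noteq> int n \<Longrightarrow> p \<noteq> int n - 1 \<Longrightarrow> trivial_group (H p)"
    and q: "q \<in> hom (H (int n)) M" "inj_on q (carrier (H (int n)))"
      "q ` carrier (H (int n)) = kernel M K bd"
      "\<And>s x. s \<in> carrier G \<Longrightarrow> x \<in> carrier (H (int n)) \<Longrightarrow> q (\<alpha> (int n) s x) = act s (q x)"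
    and r: "r \<in> hom K (H (int n - 1))" "r ` carrier K = carrier (H (int n - 1))"
      "kernel K (H (int n - 1)) r = bd ` carrier M"
      "\<And>s x. s \<in> carrier G \<Longrightarrow> x \<in> carrier K \<Longrightarrow> r (act' s x) = \<alpha> (int n - 1) s (r x)"
  shows "\<exists>d. module_complex ZG C d \<and>
    (\<forall>p. \<exists>\<phi>\<in>iso (complex_homology C d p) (H p).
       \<forall>s\<in>carrier G. \<forall>c\<in>carrier (complex_homology C d p).
         \<phi> (homology_smult C p (group_ring_of s) c) = \<alpha> p s (\<phi> c))"
proof -
  (* In every other degree the source or the target is the zero module. *)
  define d where "d p = (if p = int n then differential else (\<lambda>x. \<zero>\<^bsub>C (p - 1)\<^esub>))" for p
  have Cn: "C (int n) = M.F" and Cn1: "C (int n - 1) = K.F"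
    by (simp_all add: C_def two_term_def)
  have C0: "C p = free_module ZG 0" if "p \<noteq> int n" "p \<noteq> int n - 1" for p
    using that by (simp_all add: C_def two_term_def)
  have lm: "left_module ZG (C p)" for p
    unfolding C_def two_term_def by (rule ring.left_module_free_module[OF M.ring_group_ring])
  then have ab: "abelian_group (C p)" for p by (rule left_module.axioms(2))
  have z0: "\<zero>\<^bsub>C p\<^esub> \<in> carrier (C p)" for p using abelian_group.axioms(1)[OF ab] by (rule abelian_monoid.zero_closed)
  have zz: "\<zero>\<^bsub>C p\<^esub> \<oplus>\<^bsub>C p\<^esub> \<zero>\<^bsub>C p\<^esub> = \<zero>\<^bsub>C p\<^esub>" for p
    using abelian_monoid.l_zero[OF abelian_group.axioms(1)[OF ab] z0] .
  have sz: "a \<odot>\<^bsub>C p\<^esub> \<zero>\<^bsub>C p\<^esub> = \<zero>\<^bsub>C p\<^esub>" if "a \<in> carrier ZG" for a p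
  proof -
    interpret Cp: left_module ZG "C p" by (rule lm)
    have "a \<odot>\<^bsub>C p\<^esub> \<zero>\<^bsub>C p\<^esub> \<oplus>\<^bsub>C p\<^esub> a \<odot>\<^bsub>C p\<^esub> \<zero>\<^bsub>C p\<^esub> = a \<odot>\<^bsub>C p\<^esub> \<zero>\<^bsub>C p\<^esub>"
      using Cp.smult_r_distr[OF that z0 z0] by (simp add: zz)
    then show ?thesis using Cp.smult_closed[OF that z0] by (metis Cp.M.add.r_cancel_one')
  qed
  have dlin: "d p \<in> left_linear ZG (C p) (C (p - 1))" for p
  proof (cases "p = int n")
    case True
    then show ?thesis
      using differential_closed differential_add differential_smult by (simp add: d_def left_linear_def Cn Cn1)
  next
    case False
    then show ?thesis using z0 zz sz by (simp add: d_def left_linear_def)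
  qed
  have d0: "d p \<zero>\<^bsub>C p\<^esub> = \<zero>\<^bsub>C (p - 1)\<^esub>" for p
    using differential_zero by (simp add: d_def Cn Cn1)
  have cpx: "module_complex ZG C d"
    unfolding module_complex_def
  proof (intro conjI allI ballI lm dlin)
    fix p x assume "x \<in> carrier (C p)"
    have e: "p - 2 = p - 1 - 1" by simp
    show "d (p - 1) (d p x) = \<zero>\<^bsub>C (p - 2)\<^esub>"
    proof (cases "p = int n")
      case True
      then show ?thesis unfolding e by (simp add: d_def)
    next
      case False
      then have "d p x = \<zero>\<^bsub>C (p - 1)\<^esub>" by (simp add: d_def)
      then show ?thesis unfolding e by (simp only: d0)
    qed
  qed
  have main: "\<exists>\<phi>\<in>iso (complex_homology C d p) (H p).
       \<forall>s\<in>carrier G. \<forall>c\<in>carrier (complex_homology C d p).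
         \<phi> (homology_smult C p (group_ring_of s) c) = \<alpha> p s (\<phi> c)"
    if Z: "Z = {x \<in> carrier (C p). d p x = \<zero>\<^bsub>C (p - 1)\<^esub>}"
      and t1: "\<And>x y. x \<in> Z \<Longrightarrow> y \<in> Z \<Longrightarrow> \<theta> (x \<oplus>\<^bsub>C p\<^esub> y) = \<theta> x \<otimes>\<^bsub>H p\<^esub> \<theta> y"
      and t2: "\<theta> ` Z = carrier (H p)"
      and t3: "{x \<in> Z. \<theta> x = \<one>\<^bsub>H p\<^esub>} = d (p + 1) ` carrier (C (p + 1))"
      and t4: "\<And>s x. s \<in> carrier G \<Longrightarrow> x \<in> Z \<Longrightarrow> \<theta> (group_ring_of s \<odot>\<^bsub>C p\<^esub> x) = \<alpha> p s (\<theta> x)"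
    for p Z \<theta>
  proof (intro bexI[of _ "\<lambda>c. the_elem (\<theta> ` c)"] ballI)
    note * = complex_homology_iso[OF cpx H[of p] t1 Z t2 t3]
    show "(\<lambda>c. the_elem (\<theta> ` c)) \<in> iso (complex_homology C d p) (H p)" by (rule *(1))
    fix s c assume s: "s \<in> carrier G" and c: "c \<in> carrier (complex_homology C d p)"
    obtain z where "c \<subseteq> Z" "\<theta> ` c = {\<theta> z}" using *(2)[OF _ _ c] by blast
    then show "the_elem (\<theta> ` homology_smult C p (group_ring_of s) c) = \<alpha> p s (the_elem (\<theta> ` c))"
      unfolding homology_smult_def by (rule the_elem_equivariant) (rule t4[OF s])
  qed
  have "\<exists>\<phi>\<in>iso (complex_homology C d p) (H p).
       \<forall>s\<in>carrier G. \<forall>c\<in>carrier (complex_homology C d p).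
         \<phi> (homology_smult C p (group_ring_of s) c) = \<alpha> p s (\<phi> c)" for p
  proof -
    consider "p = int n" | "p = int n - 1" | "p \<noteq> int n" "p \<noteq> int n - 1" by blast
    then show ?thesis
    proof cases
      case 1
      define Z where "Z = {x \<in> carrier (C p). d p x = \<zero>\<^bsub>C (p - 1)\<^esub>}"
      have Zel: "x \<in> Z \<longleftrightarrow> x \<in> carrier M.F \<and> M.to_group x \<in> q ` carrier (H p)" for x
        using differential_eq_zero_iff M.to_group_closed by (auto simp: Z_def 1 Cn Cn1 d_def q(3) kernel_def)
      define \<theta> where "\<theta> x = inv_into (carrier (H p)) q (M.to_group x)" for x
      have \<theta>: "\<theta> x \<in> carrier (H p)" "q (\<theta> x) = M.to_group x" if "x \<in> Z" for x
        using that Zel inv_into_into f_inv_into_f unfolding \<theta>_def by metis+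
      have uniq: "\<theta> x = y" if "x \<in> Z" "y \<in> carrier (H p)" "q y = M.to_group x" for x y
        using \<theta>[OF that(1)] that q(2) 1 by (metis inj_onD)
      have Zadd: "x \<oplus>\<^bsub>C p\<^esub> y \<in> Z" and \<theta>add: "\<theta> (x \<oplus>\<^bsub>C p\<^esub> y) = \<theta> x \<otimes>\<^bsub>H p\<^esub> \<theta> y" if "x \<in> Z" "y \<in> Z" for x y
      proof -
        have cl: "\<theta> x \<otimes>\<^bsub>H p\<^esub> \<theta> y \<in> carrier (H p)" 
          using \<theta> that H by (simp add: group.is_monoid monoid.m_closed)
        have e: "q (\<theta> x \<otimes>\<^bsub>H p\<^esub> \<theta> y) = M.to_group (x \<oplus>\<^bsub>C p\<^esub> y)"
          using \<theta> that Zel 1 by (simp add: hom_mult[OF q(1)] M.to_group_add Cn)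
        have "x \<oplus>\<^bsub>C p\<^esub> y \<in> carrier (C p)"
          using that Zel ab[of p] 1 Cn by (metis abelian_group.axioms(1) abelian_monoid.a_closed)
        then show "x \<oplus>\<^bsub>C p\<^esub> y \<in> Z" using e cl by (simp add: Zel 1 Cn) (metis image_eqI)
        then show "\<theta> (x \<oplus>\<^bsub>C p\<^esub> y) = \<theta> x \<otimes>\<^bsub>H p\<^esub> \<theta> y" using cl e by (rule uniq)
      qed
      show ?thesis
      proof (rule main[OF Z_def])
        show "\<theta> (x \<oplus>\<^bsub>C p\<^esub> y) = \<theta> x \<otimes>\<^bsub>H p\<^esub> \<theta> y" if "x \<in> Z" "y \<in> Z" for x y by (rule \<theta>add[OF that])
        have "y \<in> \<theta> ` Z" if y: "y \<in> carrier (H p)" for y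
        proof -
          have qy: "q y \<in> carrier M" using q(1) y 1 hom_in_carrier by metis
          have "M.to_free (q y) \<in> Z" using y qy by (simp add: Zel M.to_free_closed M.to_group_to_free)
          moreover from this have "\<theta> (M.to_free (q y)) = y" using y qy by (intro uniq) (simp_all add: M.to_group_to_free)
          ultimately show ?thesis by (metis image_eqI)
        qed
        then show "\<theta> ` Z = carrier (H p)" using \<theta>(1) by blast
        have "\<theta> x = \<one>\<^bsub>H p\<^esub> \<longleftrightarrow> x = \<zero>\<^bsub>M.F\<^esub>" if "x \<in> Z" for x
        proof -
          have "q \<one>\<^bsub>H p\<^esub> = \<one>\<^bsub>M\<^esub>" using hom_one[OF q(1) H M.B.group_axioms] 1 by simp
          then have "\<theta> x = \<one>\<^bsub>H p\<^esub> \<longleftrightarrow> M.to_group x = \<one>\<^bsub>M\<^esub>"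
            using \<theta>[OF that] uniq[OF that] H[of p] by (metis group.is_monoid monoid.one_closed)
          also have "\<dots> \<longleftrightarrow> x = \<zero>\<^bsub>M.F\<^esub>"
            using that Zel by (metis M.to_free_one M.to_free_to_group M.to_group_zero)
          finally show ?thesis .
        qed
        moreover have "\<zero>\<^bsub>M.F\<^esub> \<in> Z" using z0[of p] d0[of p] 1 by (simp add: Z_def Cn)
        moreover have "d (p + 1) ` carrier (C (p + 1)) = {\<zero>\<^bsub>M.F\<^esub>}"
          using z0[of "p + 1"] 1 by (auto simp: d_def Cn)
        ultimately show "{x \<in> Z. \<theta> x = \<one>\<^bsub>H p\<^esub>} = d (p + 1) ` carrier (C (p + 1))" by auto
        fix s x assume s: "s \<in> carrier G" and x: "x \<in> Z"
        have xF: "x \<in> carrier M.F" using x Zel by blast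
        have cl: "\<alpha> p s (\<theta> x) \<in> carrier (H p)" using \<alpha>[OF s] \<theta>(1)[OF x] by (rule hom_in_carrier)
        have e: "q (\<alpha> p s (\<theta> x)) = M.to_group (group_ring_of s \<odot>\<^bsub>C p\<^esub> x)"
          using q(4)[OF s, of "\<theta> x"] \<theta>[OF x] 1 xF s
          by (simp add: Cn M.to_group_smult M.delta_closed M.scale_delta M.to_group_closed)
        have "group_ring_of s \<odot>\<^bsub>C p\<^esub> x \<in> carrier M.F"
          using left_module.smult_closed[OF lm[of p] M.delta_closed[OF s], of x] xF 1 Cn by simp
        then have "group_ring_of s \<odot>\<^bsub>C p\<^esub> x \<in> Z" using e cl by (simp add: Zel) (metis image_eqI)
        then show "\<theta> (group_ring_of s \<odot>\<^bsub>C p\<^esub> x) = \<alpha> p s (\<theta> x)" using cl e by (rule uniq)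
      qed
    next
      case 2
      show ?thesis
      proof (rule main[OF refl])
        let ?Z = "{x \<in> carrier (C p). d p x = \<zero>\<^bsub>C (p - 1)\<^esub>}"
        have Z: "?Z = carrier K.F" using 2 by (simp add: d_def Cn1)
        have Cp: "C p = K.F" using 2 Cn1 by simp
        show "(r \<circ> K.to_group) (x \<oplus>\<^bsub>C p\<^esub> y) = (r \<circ> K.to_group) x \<otimes>\<^bsub>H p\<^esub> (r \<circ> K.to_group) y" if "x \<in> ?Z" "y \<in> ?Z" for x y
          using that 2 unfolding Z Cp by (simp add: K.to_group_add hom_mult[OF r(1)] K.to_group_closed)
        have im: "K.to_group ` carrier K.F = carrier K"
          by (rule K.to_group_onto)
        then show "(r \<circ> K.to_group) ` ?Z = carrier (H p)"
          unfolding Z image_comp[symmetric] using r(2) 2 by simp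
        have "{x \<in> carrier K.F. r (K.to_group x) = \<one>\<^bsub>H p\<^esub>} = differential ` carrier M.F"
        proof -
          have "r (K.to_group x) = \<one>\<^bsub>H p\<^esub> \<longleftrightarrow> x \<in> differential ` carrier M.F" if "x \<in> carrier K.F" for x
          proof -
            have "r (K.to_group x) = \<one>\<^bsub>H p\<^esub> \<longleftrightarrow> K.to_group x \<in> bd ` carrier M"
              unfolding r(3)[symmetric] kernel_def using K.to_group_closed[of x] 2 by simp
            also have "\<dots> \<longleftrightarrow> x \<in> differential ` carrier M.F"
            proof
              assume "K.to_group x \<in> bd ` carrier M"
              then obtain y where "y \<in> carrier M.F" "K.to_group x = K.to_group (differential y)"
                unfolding to_group_image_differential[symmetric] image_image by (rule imageE)
              then have "x = differential y" using K.to_free_to_group[OF that] K.to_free_to_group[OF differential_closed] by metis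
              then show "x \<in> differential ` carrier M.F" using \<open>y \<in> carrier M.F\<close> by (rule image_eqI)
            qed (unfold to_group_image_differential[symmetric], rule imageI)
            finally show ?thesis .
          qed
          then show ?thesis using differential_closed by auto
        qed
        then show "{x \<in> ?Z. (r \<circ> K.to_group) x = \<one>\<^bsub>H p\<^esub>} = d (p + 1) ` carrier (C (p + 1))"
          unfolding Z using 2 by (simp add: d_def Cn)
        fix s x assume "s \<in> carrier G" "x \<in> ?Z"
        then show "(r \<circ> K.to_group) (group_ring_of s \<odot>\<^bsub>C p\<^esub> x) = \<alpha> p s ((r \<circ> K.to_group) x)"
          using r(4)[of s "K.to_group x"] 2 unfolding Z Cp
          by (simp add: K.to_group_smult M.delta_closed K.scale_delta K.to_group_closed)
      qed
    next
      case 3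
      have c0: "carrier (C p) = {\<zero>\<^bsub>C p\<^esub>}" using carrier_free_module_0 C0[OF 3] by metis
      have Hp: "carrier (H p) = {\<one>\<^bsub>H p\<^esub>}" using triv[OF 3] by (simp add: trivial_group_def)
      show ?thesis
      proof (rule main[OF refl])
        let ?Z = "{x \<in> carrier (C p). d p x = \<zero>\<^bsub>C (p - 1)\<^esub>}"
        have Z: "?Z = {\<zero>\<^bsub>C p\<^esub>}" using c0 d0 by auto
        show "(\<lambda>_. \<one>\<^bsub>H p\<^esub>) ` ?Z = carrier (H p)" unfolding Z Hp by simp
        have "d (p + 1) ` carrier (C (p + 1)) \<subseteq> carrier (C p)"
          using dlin[of "p + 1"] by (auto simp: left_linear_def)
        moreover have "d (p + 1) ` carrier (C (p + 1)) \<noteq> {}" using z0[of "p + 1"] by blast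
        ultimately have im: "d (p + 1) ` carrier (C (p + 1)) = {\<zero>\<^bsub>C p\<^esub>}" unfolding c0 by (metis subset_singletonD)
        show "{x \<in> ?Z. \<one>\<^bsub>H p\<^esub> = \<one>\<^bsub>H p\<^esub>} = d (p + 1) ` carrier (C (p + 1))"
          unfolding Z im by simp
        show "\<one>\<^bsub>H p\<^esub> = \<alpha> p s \<one>\<^bsub>H p\<^esub>" if "s \<in> carrier G" for s
          using hom_one[OF \<alpha>[OF that] H H] by simp
      qed (use H in \<open>simp add: group.is_monoid monoid.l_one monoid.one_closed\<close>)
    qed
  qed
  then show ?thesis using cpx by blast
qed

section \<open>Radial rescaling to the unit ball of a gauge\<close>

text \<open>A continuous, positively homogeneous function that dominates the coordinates. Its unit ball is
  identified with the Euclidean disc by moving points along rays so that the gauge of the image is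
  the Euclidean norm of the argument. At the origin the factor is \<open>0 / 0 = 0\<close>, which keeps the origin
  fixed.\<close>

locale radial_gauge =
  fixes k :: nat and N :: "(nat \<Rightarrow> real) \<Rightarrow> real"
  assumes cont: "continuous_on UNIV N"
    and scale: "0 \<le> c \<Longrightarrow> N (\<lambda>i. y i * c) = N y * c"
    and bound: "i < k \<Longrightarrow> \<bar>y i\<bar> \<le> N y"
    and nonneg: "0 \<le> N y"
begin

definition rescale :: "(nat \<Rightarrow> real) \<Rightarrow> nat \<Rightarrow> real"
  where "rescale y = (\<lambda>i. y i * (nrm k y / N y))"

abbreviation "V \<equiv> {y :: nat \<Rightarrow> real. \<forall>i\<ge>k. y i = 0}"

lemma N_zero_imp: "y \<in> V \<Longrightarrow> N y = 0 \<Longrightarrow> y = (\<lambda>_. 0)"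
proof
  fix i assume "y \<in> V" "N y = 0"
  then show "y i = 0" using bound[of i y] by (cases "i < k") auto
qed

lemma nrm_zero_imp: "y \<in> V \<Longrightarrow> nrm k y = 0 \<Longrightarrow> y = (\<lambda>_. 0)"
proof
  fix i assume "y \<in> V" "nrm k y = 0"
  then show "y i = 0" using abs_le_nrm[of i k y] by (cases "i < k") auto
qed

lemma N_0: "N (\<lambda>_. 0) = 0"
  using scale[of 0 "\<lambda>_. 0"] by simp

lemma nrm_0: "nrm k (\<lambda>_. 0) = 0" by (simp add: nrm_def)

lemma rescale_V: "y \<in> V \<Longrightarrow> rescale y \<in> V"
  by (simp add: rescale_def)

lemma N_rescale: "y \<in> V \<Longrightarrow> N (rescale y) = nrm k y"
  using scale[of "nrm k y / N y" y] nonneg[of y] N_zero_imp[of y] nrm_0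
  by (cases "N y = 0") (auto simp: rescale_def)

lemma rescale_inj: "inj_on rescale V"
proof (rule inj_onI)
  fix y z assume y: "y \<in> V" and z: "z \<in> V" and eq: "rescale y = rescale z"
  have n: "nrm k y = nrm k z" using N_rescale[OF y] N_rescale[OF z] eq by simp
  show "y = z"
  proof (cases "nrm k y = 0")
    case True
    then show ?thesis using nrm_zero_imp[OF y] nrm_zero_imp[OF z] n by simp
  next
    case False
    then have Ny: "N y \<noteq> 0" and Nz: "N z \<noteq> 0"
      using N_zero_imp[OF y] N_zero_imp[OF z] n nrm_0 by auto
    have "y i = z i * (N y / N z)" for i
    proof -
      have "y i * (nrm k y / N y) = z i * (nrm k y / N z)"
        using fun_cong[OF eq, of i] n by (simp add: rescale_def)
      then show ?thesis using False Ny Nz by (simp add: field_simps)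
    qed
    then have yz: "y = (\<lambda>i. z i * (N y / N z))" by auto
    then have "nrm k y = nrm k z * \<bar>N y / N z\<bar>" by (metis nrm_scale)
    then have "nrm k z * \<bar>N y / N z\<bar> = nrm k z * 1" using n by simp
    then have "\<bar>N y / N z\<bar> = 1" using False n by (metis mult_left_cancel)
    then have "N y / N z = 1" using nonneg[of y] nonneg[of z] by (simp add: abs_of_nonneg)
    then show ?thesis using yz by simp
  qed
qed

lemma rescale_onto:
  assumes z: "z \<in> V" shows "\<exists>y\<in>V. rescale y = z \<and> nrm k y = N z"
proof (cases "N z = 0")
  case True
  then have "z = (\<lambda>_. 0)" using N_zero_imp z by simp
  then show ?thesis using N_0 nrm_0 by (intro bexI[of _ "\<lambda>_. 0"]) (auto simp: rescale_def)
next
  case False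
  (* The inverse rescales by the reciprocal factor. *)
  define y where "y = (\<lambda>i. z i * (N z / nrm k z))"
  have nz: "nrm k z \<noteq> 0" using nrm_zero_imp[OF z] False N_0 by auto
  have Nz: "N z > 0" using False nonneg[of z] by simp
  have ny: "nrm k y = N z" unfolding y_def nrm_scale using Nz nz by (simp add: abs_of_nonneg)
  have Ny: "N y = N z * (N z / nrm k z)" unfolding y_def using Nz by (intro scale) simp
  have "rescale y = z"
    unfolding rescale_def Ny ny using Nz nz by (simp add: y_def)
  then show ?thesis using ny z by (intro bexI[of _ y]) (auto simp: y_def)
qed

text \<open>Away from the origin the factor is a quotient of continuous functions. At the origin the domination
  of the coordinates by the gauge bounds every coordinate of the image by the norm.\<close>

lemma continuous_on_rescale: "continuous_on V rescale"
proof (rule continuous_on_coordinatewise_then_product)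
  fix i
  have cN: "continuous_on V N" by (rule continuous_on_subset[OF cont]) simp
  have "((\<lambda>y. rescale y i) \<longlongrightarrow> rescale y i) (at y within V)" if y: "y \<in> V" for y
  proof (cases "N y = 0")
    case False
    have c: "continuous (at y within V) N" "continuous (at y within V) (nrm k)" "continuous (at y within V) (\<lambda>y. y i)"
      using cN continuous_on_nrm[of V k] continuous_on_coord[of V i] y
      by (auto simp: continuous_on_eq_continuous_within)
    show ?thesis
      unfolding rescale_def using c False
      by (intro tendsto_intros) (auto simp: continuous_within)
  next
    case True
    then have y0: "y = (\<lambda>_. 0)" using N_zero_imp y by simp
    have le: "\<bar>rescale z i\<bar> \<le> nrm k z" if z: "z \<in> V" for z
    proof (cases "i < k \<and> N z \<noteq> 0")
      case True
      then have "\<bar>z i\<bar> / N z \<le> 1" using bound[of i z] nonneg[of z] by (simp add: divide_le_eq_1)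
      then have "\<bar>z i\<bar> / N z * nrm k z \<le> 1 * nrm k z" by (intro mult_right_mono) auto
      moreover have "\<bar>rescale z i\<bar> = \<bar>z i\<bar> / N z * nrm k z"
        using nonneg[of z] by (simp add: rescale_def abs_mult)
      ultimately show ?thesis by simp
    next
      case False
      then have "rescale z i = 0" using z by (auto simp: rescale_def)
      then show ?thesis by simp
    qed
    have "(nrm k \<longlongrightarrow> 0) (at y within V)"
    proof -
      have "(nrm k \<longlongrightarrow> nrm k y) (at y within V)"
        using continuous_on_nrm[of V k] y unfolding continuous_on_def by (rule bspec)
      then show ?thesis by (simp add: y0 nrm_0)
    qed
    then have "((\<lambda>y. rescale y i) \<longlongrightarrow> 0) (at y within V)"
      by (rule Lim_null_comparison[rotated])
        (use le in \<open>auto simp: eventually_at_filter\<close>)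
    then show ?thesis by (simp add: y0 rescale_def)
  qed
  then show "continuous_on V (\<lambda>y. rescale y i)"
    unfolding continuous_on_def by blast
qed

end

section \<open>Products of simplices\<close>

text \<open>The point of the open polytope that serves as the origin of the gauge. Its \<open>a\<close>-th coordinate lies at
  the fraction \<open>(a + 1) / (k + 1)\<close> of the \<open>a\<close>-th petal. Since this fraction grows with \<open>a\<close>, the
  coordinates increase within each petal, whichever way the positions are distributed over petals.\<close>

definition slot_centre :: "nat \<Rightarrow> (nat \<Rightarrow> nat) \<Rightarrow> nat \<Rightarrow> real"
  where "slot_centre k b a = real (b a) - 1 + (real a + 1) / (real k + 1)"

text \<open>The open product of simplices that belongs to a bar symbol: the coordinate \<open>t a\<close> is the place in
  \<open>\<real>\<close> of the point at position \<open>a\<close>, and \<open>b a\<close> is its petal.\<close>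

definition open_slots :: "nat \<Rightarrow> (nat \<Rightarrow> nat) \<Rightarrow> (nat \<Rightarrow> real) set"
  where "open_slots k b = {t. (\<forall>i\<ge>k. t i = 0) \<and> (\<forall>a<k. real (b a) - 1 < t a \<and> t a < real (b a)) \<and>
     (\<forall>a. Suc a < k \<longrightarrow> t a < t (Suc a))}"

text \<open>The facets of the polytope as linear functionals around \<open>slot_centre\<close>, normalised so that the facet
  is the level set \<open>1\<close>: a point reaches the left or right end of its petal, or two consecutive points
  meet.\<close>

definition lower_face :: "nat \<Rightarrow> nat \<Rightarrow> (nat \<Rightarrow> real) \<Rightarrow> real"
  where "lower_face k a y = - y a * ((real k + 1) / (real a + 1))"

definition upper_face :: "nat \<Rightarrow> nat \<Rightarrow> (nat \<Rightarrow> real) \<Rightarrow> real"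
  where "upper_face k a y = y a * ((real k + 1) / (real k - real a))"

definition diagonal_face :: "nat \<Rightarrow> (nat \<Rightarrow> nat) \<Rightarrow> nat \<Rightarrow> (nat \<Rightarrow> real) \<Rightarrow> real"
  where "diagonal_face k b a y = (y a - y (Suc a)) * inverse (slot_centre k b (Suc a) - slot_centre k b a)"

definition faces :: "nat \<Rightarrow> (nat \<Rightarrow> nat) \<Rightarrow> ((nat \<Rightarrow> real) \<Rightarrow> real) set"
  where "faces k b = lower_face k ` {..<k} \<union> upper_face k ` {..<k} \<union> diagonal_face k b ` {a. Suc a < k}"

text \<open>The gauge whose unit ball is the polytope. The value \<open>0\<close> is included so that the maximum also makes
  sense for \<open>k = 0\<close>.\<close>

definition slot_gauge :: "nat \<Rightarrow> (nat \<Rightarrow> nat) \<Rightarrow> (nat \<Rightarrow> real) \<Rightarrow> real"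
  where "slot_gauge k b y = Max (insert 0 ((\<lambda>L. L y) ` faces k b))"

lemma finite_faces: "finite (faces k b)"
proof -
  have "{a. Suc a < k} \<subseteq> {..<k}" by auto
  then have "finite {a. Suc a < k}" by (rule finite_subset) simp
  then show ?thesis by (simp add: faces_def)
qed

lemma continuous_on_Max:
  fixes F :: "('a::topological_space \<Rightarrow> real) set"
  assumes "finite F" "\<And>f. f \<in> F \<Longrightarrow> continuous_on S f"
  shows "continuous_on S (\<lambda>y. Max (insert 0 ((\<lambda>f. f y) ` F)))"
  using assms
proof (induction F)
  case (insert f F)
  have "Max (insert 0 ((\<lambda>f. f y) ` insert f F)) = max (f y) (Max (insert 0 ((\<lambda>f. f y) ` F)))" for y
  proof -
    have "insert 0 ((\<lambda>f. f y) ` insert f F) = insert (f y) (insert 0 ((\<lambda>f. f y) ` F))" by auto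
    then show ?thesis using insert.hyps(1) by (simp add: Max_insert)
  qed
  then show ?case using insert by (simp add: continuous_on_max)
qed simp

lemma radial_gauge_slot_gauge: "radial_gauge k (slot_gauge k b)"
proof
  show "continuous_on UNIV (slot_gauge k b)"
    unfolding slot_gauge_def
    by (rule continuous_on_Max[OF finite_faces])
      (auto simp: faces_def lower_face_def upper_face_def diagonal_face_def
        intro!: continuous_intros continuous_on_coord)
  fix y :: "nat \<Rightarrow> real" and i
  have fin: "finite ((\<lambda>L. L y) ` faces k b)" using finite_faces by blast
  show "0 \<le> slot_gauge k b y" unfolding slot_gauge_def using fin by (intro Max_ge) auto
  have ge: "L y \<le> slot_gauge k b y" if "L \<in> faces k b" for L
    unfolding slot_gauge_def using fin that by (intro Max_ge) auto
  show "\<bar>y i\<bar> \<le> slot_gauge k b y" if i: "i < k"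
  proof -
    have f1: "lower_face k i \<in> faces k b" and f2: "upper_face k i \<in> faces k b"
      using i by (auto simp: faces_def)
    have 1: "1 \<le> (real k + 1) / (real i + 1)" "1 \<le> (real k + 1) / (real k - real i)"
      using i by (auto simp: le_divide_eq)
    show ?thesis
    proof (cases "0 \<le> y i")
      case True
      then have "\<bar>y i\<bar> \<le> y i * ((real k + 1) / (real k - real i))" using mult_left_mono[OF 1(2) True] by simp
      then show ?thesis using ge[OF f2] by (simp add: upper_face_def)
    next
      case False
      then have "0 \<le> - y i" by simp
      then have "\<bar>y i\<bar> \<le> - y i * ((real k + 1) / (real i + 1))" using mult_left_mono[OF 1(1), of "- y i"] False by simp
      then show ?thesis using ge[OF f1] by (simp add: lower_face_def)
    qed
  qed
  show "slot_gauge k b (\<lambda>i. y i * c) = slot_gauge k b y * c" if c: "0 \<le> c" for c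
  proof -
    have "L (\<lambda>i. y i * c) = L y * c" if "L \<in> faces k b" for L
      using that by (auto simp: faces_def lower_face_def upper_face_def diagonal_face_def algebra_simps)
    then have "insert 0 ((\<lambda>L. L (\<lambda>i. y i * c)) ` faces k b) = (\<lambda>x. x * c) ` insert 0 ((\<lambda>L. L y) ` faces k b)"
      by (auto simp: image_image)
    moreover have "mono (\<lambda>x. x * c)" using c by (auto intro!: monoI mult_right_mono)
    ultimately show ?thesis
      unfolding slot_gauge_def using fin by (subst mono_Max_commute) auto
  qed
qed

lemma slot_gauge_less_1: "slot_gauge k b y < 1 \<longleftrightarrow> (\<forall>L\<in>faces k b. L y < 1)"
  unfolding slot_gauge_def using finite_faces by (subst Max_less_iff) auto

lemma slot_gauge_eq_1:
  assumes "slot_gauge k b y = 1" shows "\<exists>L\<in>faces k b. L y = 1"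
proof -
  have "Max (insert 0 ((\<lambda>L. L y) ` faces k b)) \<in> insert 0 ((\<lambda>L. L y) ` faces k b)"
    using finite_faces by (intro Max_in) auto
  then show ?thesis using assms unfolding slot_gauge_def by auto
qed

definition slot_point :: "nat \<Rightarrow> (nat \<Rightarrow> nat) \<Rightarrow> (nat \<Rightarrow> real) \<Rightarrow> nat \<Rightarrow> real"
  where "slot_point k b y = (\<lambda>a. if a < k then slot_centre k b a + radial_gauge.rescale k (slot_gauge k b) y a else 0)"

lemma slot_centre_mono:
  assumes "b a \<le> b (Suc a)" shows "slot_centre k b a < slot_centre k b (Suc a)"
proof -
  have "(real a + 1) / (real k + 1) < (real (Suc a) + 1) / (real k + 1)" by (intro divide_strict_right_mono) auto
  then show ?thesis using assms by (simp add: slot_centre_def)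
qed

lemma face_value:
  assumes "a < k"
  shows "lower_face k a y < 1 \<longleftrightarrow> real (b a) - 1 < slot_centre k b a + y a"
    and "lower_face k a y = 1 \<longleftrightarrow> slot_centre k b a + y a = real (b a) - 1"
    and "upper_face k a y < 1 \<longleftrightarrow> slot_centre k b a + y a < real (b a)"
    and "upper_face k a y = 1 \<longleftrightarrow> slot_centre k b a + y a = real (b a)"
  using assms by (auto simp: lower_face_def upper_face_def slot_centre_def field_simps)

context
  fixes k :: nat and b :: "nat \<Rightarrow> nat"
  assumes mono: "\<And>a. Suc a < k \<Longrightarrow> b a \<le> b (Suc a)"
begin

interpretation radial_gauge k "slot_gauge k b" by (rule radial_gauge_slot_gauge)

lemma face_value_diff:
  assumes "Suc a < k"
  shows "diagonal_face k b a y < 1 \<longleftrightarrow> slot_centre k b a + y a < slot_centre k b (Suc a) + y (Suc a)"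
    and "diagonal_face k b a y = 1 \<longleftrightarrow> slot_centre k b a + y a = slot_centre k b (Suc a) + y (Suc a)"
  using slot_centre_mono[OF mono[OF assms], of k] unfolding diagonal_face_def divide_inverse[symmetric]
  by (auto simp: divide_less_eq divide_eq_eq)

lemma slot_gauge_less_1_iff:
  "z \<in> V \<Longrightarrow> slot_gauge k b z < 1 \<longleftrightarrow> (\<lambda>a. if a < k then slot_centre k b a + z a else 0) \<in> open_slots k b"
  unfolding slot_gauge_less_1 faces_def open_slots_def
  by (auto simp: ball_Un face_value[where b=b] face_value_diff)

lemma slot_point_bij: "bij_betw (slot_point k b) (open_unit_disc k) (open_slots k b)"
proof (rule bij_betw_imageI)
  show "inj_on (slot_point k b) (open_unit_disc k)"
  proof (rule inj_onI)
    fix y z assume yz: "y \<in> open_unit_disc k" "z \<in> open_unit_disc k" and eq: "slot_point k b y = slot_point k b z"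
    then have V: "y \<in> V" "z \<in> V" by (auto simp: mem_open_unit_disc)
    have "rescale y = rescale z"
    proof
      fix a show "rescale y a = rescale z a"
      using fun_cong[OF eq, of a] rescale_V[OF V(1)] rescale_V[OF V(2)] 
      by (cases "a < k") (auto simp: slot_point_def not_less)
    qed
    then show "y = z" by (rule inj_onD[OF rescale_inj _ V])
  qed
  show "slot_point k b ` open_unit_disc k = open_slots k b"
  proof (intro equalityI subsetI)
    fix t assume "t \<in> slot_point k b ` open_unit_disc k"
    then obtain y where y: "y \<in> open_unit_disc k" "t = slot_point k b y" by blast
    then have V: "y \<in> V" by (auto simp: mem_open_unit_disc)
    have "slot_gauge k b (rescale y) < 1" using N_rescale[OF V] y by (simp add: mem_open_unit_disc)
    then show "t \<in> open_slots k b"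
      using slot_gauge_less_1_iff[OF rescale_V[OF V]] by (simp add: y(2) slot_point_def)
  next
    fix t assume t: "t \<in> open_slots k b"
    define z where "z = (\<lambda>a. if a < k then t a - slot_centre k b a else 0)"
    have zV: "z \<in> V" by (simp add: z_def)
    have tz: "t = (\<lambda>a. if a < k then slot_centre k b a + z a else 0)"
      using t by (auto simp: z_def open_slots_def fun_eq_iff)
    have lt: "slot_gauge k b z < 1" using slot_gauge_less_1_iff[OF zV] t tz by simp
    obtain y where y: "y \<in> V" "rescale y = z" "nrm k y = slot_gauge k b z" using rescale_onto[OF zV] by blast
    have "y \<in> open_unit_disc k" using y lt by (simp add: mem_open_unit_disc)
    moreover have "slot_point k b y = t" unfolding slot_point_def y(2) by (rule tz[symmetric])
    ultimately show "t \<in> slot_point k b ` open_unit_disc k" by blast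
  qed
qed

text \<open>On the sphere the gauge is \<open>1\<close>, so the maximum is attained by some facet.\<close>

lemma slot_point_boundary:
  assumes "y \<in> unit_sphere k"
  shows "\<exists>a<k. slot_point k b y a = real (b a) - 1 \<or> slot_point k b y a = real (b a) \<or>
     (Suc a < k \<and> slot_point k b y a = slot_point k b y (Suc a))"
proof -
  have V: "y \<in> V" and n: "nrm k y = 1" using assms by (auto simp: mem_unit_sphere)
  then obtain L where L: "L \<in> faces k b" "L (rescale y) = 1"
    using slot_gauge_eq_1[of k b "rescale y"] N_rescale[OF V] by auto
  then consider a where "a < k" "lower_face k a (rescale y) = 1"
    | a where "a < k" "upper_face k a (rescale y) = 1"
    | a where "Suc a < k" "diagonal_face k b a (rescale y) = 1"
    unfolding faces_def by auto
  then show ?thesis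
  proof cases
    case 1
    then show ?thesis using face_value(2) by (intro exI[of _ a]) (simp add: slot_point_def)
  next
    case 2
    then show ?thesis using face_value(4) by (intro exI[of _ a]) (simp add: slot_point_def)
  next
    case 3
    then show ?thesis using face_value_diff(2) by (intro exI[of _ a]) (simp add: slot_point_def)
  qed
qed

lemma continuous_on_slot_point: "continuous_on (unit_disc k) (\<lambda>y. slot_point k b y a)"
proof -
  have "unit_disc k \<subseteq> V" by (auto simp: mem_unit_disc)
  then have "continuous_on (unit_disc k) rescale" using continuous_on_rescale continuous_on_subset by blast
  then have "continuous_on (unit_disc k) (\<lambda>y. rescale y a)"
    by (rule continuous_on_compose2[OF continuous_on_coord[of UNIV]]) auto
  then show ?thesis by (cases "a < k") (auto simp: slot_point_def intro!: continuous_intros)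
qed

end

section \<open>The rose\<close>

lemma continuous_map_petal: "i \<in> {1..g} \<Longrightarrow> continuous_map (top_of_set (sphere 0 1)) (rose g) (\<lambda>z. wedge_proj (i, z))"
proof -
  assume i: "i \<in> {1..g}"
  let ?S = "sum_topology (\<lambda>i::nat. top_of_set (sphere (0::complex) 1)) {1..g}"
  have "continuous_map (top_of_set (sphere 0 1)) ?S (\<lambda>z. (i, z))"
    by (rule continuous_map_component_injection[OF i])
  moreover have "continuous_map ?S (rose g) wedge_proj"
    unfolding rose_def by (rule quotient_imp_continuous_map[OF quotient_map_quotient_topology])
  ultimately have "continuous_map (top_of_set (sphere 0 1)) (rose g) (wedge_proj \<circ> (\<lambda>z. (i, z)))"
    by (rule continuous_map_compose)
  then show ?thesis by (simp add: comp_def)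
qed

lemma topspace_rose: "topspace (rose g) = (\<Union>i\<in>{1..g}. (\<lambda>z. wedge_proj (i, z)) ` sphere 0 1)"
  unfolding rose_def by auto

lemma compact_space_rose: "compact_space (rose g)"
proof -
  have "compactin (rose g) ((\<lambda>z. wedge_proj (i, z)) ` sphere 0 1)" if "i \<in> {1..g}" for i
    by (rule image_compactin[OF _ continuous_map_petal[OF that]]) (simp add: compactin_subtopology)
  then have "compactin (rose g) (topspace (rose g))"
    unfolding topspace_rose by (intro compactin_Union) auto
  then show ?thesis by (simp add: compact_space_def)
qed

text \<open>Every petal is mapped to its own complex coordinate, with the vertex at the point \<open>(1, \<dots>, 1)\<close>. This
  continuous injection shows that the rose is Hausdorff.\<close>

definition rose_embed :: "(nat \<times> complex) option \<Rightarrow> nat \<Rightarrow> complex"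
  where "rose_embed x = (\<lambda>j. case x of None \<Rightarrow> 1 | Some (i, z) \<Rightarrow> if j = i then z else 1)"

lemma rose_embed_proj: "rose_embed (wedge_proj (i, z)) = (\<lambda>j. if j = i then z else 1)"
  by (auto simp: rose_embed_def wedge_proj_def)

lemma Hausdorff_space_rose: "Hausdorff_space (rose g)"
proof (rule Hausdorff_space_injective_preimage)
  let ?P = "product_topology (\<lambda>_. euclidean :: complex topology) (UNIV :: nat set)"
  show "Hausdorff_space ?P" by (simp add: Hausdorff_space_product_topology)
  have 1: "continuous_map (sum_topology (\<lambda>i. top_of_set (sphere 0 1)) {1..g}) euclidean
     (\<lambda>p::nat\<times>complex. if j = fst p then snd p else 1)" for j
    unfolding continuous_map openin_sum_topology
  proof (intro conjI allI impI ballI)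
    fix U :: "complex set" and i assume U: "openin euclidean U"
    have "{x. (i, x) \<in> {p \<in> topspace (sum_topology (\<lambda>i. top_of_set (sphere 0 1)) {1..g}). (if j = fst p then snd p else 1) \<in> U}}
      = (if i \<in> {1..g} then if j = i then sphere 0 1 \<inter> U else if 1 \<in> U then sphere 0 1 else {} else {})"
      by auto
    then show "openin (top_of_set (sphere 0 1)) {x. (i, x) \<in> {p \<in> topspace (sum_topology (\<lambda>i. top_of_set (sphere 0 1)) {1..g}).
        (if j = fst p then snd p else 1) \<in> U}}"
      using U by (auto simp: openin_open_Int)
  qed auto
  have "continuous_map (rose g) ?P rose_embed"
    unfolding rose_def
  proof (rule continuous_compose_quotient_map[OF quotient_map_quotient_topology])
    show "continuous_map (sum_topology (\<lambda>i. top_of_set (sphere 0 1)) {1..g}) ?P (rose_embed \<circ> wedge_proj)"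
      unfolding continuous_map_componentwise_UNIV
    proof
      fix j
      show "continuous_map (sum_topology (\<lambda>i. top_of_set (sphere 0 1)) {1..g}) euclidean (\<lambda>x. (rose_embed \<circ> wedge_proj) x j)"
        by (rule continuous_map_eq[OF 1[of j]]) (auto simp: rose_embed_proj)
    qed
  qed
  then show "continuous_map (rose g) ?P rose_embed" .
  show "inj_on rose_embed (topspace (rose g))"
  proof (rule inj_onI)
    fix x y assume x: "x \<in> topspace (rose g)" and y: "y \<in> topspace (rose g)" and eq: "rose_embed x = rose_embed y"
    from x obtain i z where xz: "x = wedge_proj (i, z)" by (auto simp: topspace_rose)
    from y obtain i' z' where yz: "y = wedge_proj (i', z')" by (auto simp: topspace_rose)
    have e: "(if j = i then z else 1) = (if j = i' then z' else 1)" for j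
      using fun_cong[OF eq, of j] by (simp add: xz yz rose_embed_proj)
    show "x = y"
    proof (cases "i = i'")
      case True
      then show ?thesis using e[of i] by (simp add: xz yz)
    next
      case False
      then have "z = 1" "z' = 1" using e[of i] e[of i'] by auto
      then show ?thesis by (simp add: xz yz wedge_proj_def)
    qed
  qed
qed

lemma vertex_in_rose: "1 \<le> g \<Longrightarrow> None \<in> topspace (rose g)"
  unfolding topspace_rose
  by (rule UN_I[of 1], simp, rule image_eqI[of _ _ 1]) (simp_all add: wedge_proj_def)

lemma open_Xi: "open (Xi g)"
  unfolding Xi_def by auto

section \<open>Extending the parametrisation\<close>

definition petal_ext :: "nat \<Rightarrow> (real \<Rightarrow> (nat \<times> complex) option) \<Rightarrow> real \<Rightarrow> (nat \<times> complex) option"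
  where "petal_ext g h t = (if t \<in> Xi g then h t else None)"

lemma petal_homeo_maps:
  assumes "petal_homeo g h" obtains h' where
    "homeomorphic_maps (top_of_set (Xi g)) (subtopology (rose g) (topspace (rose g) - {None})) h h'"
  using assms unfolding petal_homeo_def homeomorphic_map_maps rose_vertex_def by blast

text \<open>A closed set that misses the vertex is compact in the complement of the vertex, so its preimage is
  compact. The preimage of a closed set that contains the vertex is the complement of an open subset
  of \<open>Xi g\<close>.\<close>

lemma continuous_map_petal_ext:
  assumes g: "1 \<le> g" and h: "petal_homeo g h"
  shows "continuous_map euclidean (rose g) (petal_ext g h)"
proof -
  obtain h' where h': "homeomorphic_maps (top_of_set (Xi g)) (subtopology (rose g) (topspace (rose g) - {None})) h h'"
    using petal_homeo_maps[OF h] .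
  let ?Y = "subtopology (rose g) (topspace (rose g) - {None})"
  have ch: "continuous_map (top_of_set (Xi g)) ?Y h" and ch': "continuous_map ?Y (top_of_set (Xi g)) h'"
    and hh': "\<And>x. x \<in> Xi g \<Longrightarrow> h' (h x) = x" and h'h: "\<And>y. y \<in> topspace ?Y \<Longrightarrow> h (h' y) = y"
    using h' by (auto simp: homeomorphic_maps_def)
  have hX: "h t \<in> topspace (rose g) - {None}" if "t \<in> Xi g" for t
    using subsetD[OF continuous_map_image_subset_topspace[OF ch], of "h t"] that by simp
  have h'X: "h' y \<in> Xi g" if "y \<in> topspace (rose g) - {None}" for y
    using subsetD[OF continuous_map_image_subset_topspace[OF ch'], of "h' y"] that by simp
  show ?thesis
    unfolding continuous_map_closedin
  proof (intro conjI allI impI ballI)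
    show "petal_ext g h \<in> topspace euclidean \<rightarrow> topspace (rose g)"
    proof
      fix t show "petal_ext g h t \<in> topspace (rose g)"
        using hX[of t] vertex_in_rose[OF g] by (simp add: petal_ext_def)
    qed
  next
    fix F assume F: "closedin (rose g) F"
    show "closedin euclidean {t \<in> topspace euclidean. petal_ext g h t \<in> F}"
    proof (cases "None \<in> F")
      case False
      have FY: "F \<subseteq> topspace (rose g) - {None}" using F False closedin_subset by blast
      have "compactin (rose g) F" using F compact_space_rose by (rule closedin_compact_space[rotated])
      then have "compactin ?Y F" using FY by (simp add: compactin_subtopology)
      then have "compactin (top_of_set (Xi g)) (h' ` F)" by (rule image_compactin[OF _ ch'])
      then have "closed (h' ` F)" by (simp add: compactin_subtopology compact_imp_closed)
      moreover have "{t. petal_ext g h t \<in> F} = h' ` F"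
      proof (intro equalityI subsetI)
        fix t assume "t \<in> {t. petal_ext g h t \<in> F}"
        then have "t \<in> Xi g" "h t \<in> F" using False by (auto simp: petal_ext_def split: if_splits)
        then show "t \<in> h' ` F" using hh'[of t] by (metis image_eqI)
      next
        fix t assume "t \<in> h' ` F"
        then obtain y where y: "y \<in> F" "t = h' y" by blast
        then have "y \<in> topspace (rose g) - {None}" using FY by blast
        then show "t \<in> {t. petal_ext g h t \<in> F}" using y h'X h'h[of y] by (simp add: petal_ext_def)
      qed
      ultimately show ?thesis by simp
    next
      case True
      have "openin (rose g) (topspace (rose g) - F)" using F by (simp add: openin_diff)
      then have "openin (rose g) ((topspace (rose g) - F) \<inter> (topspace (rose g) - {None}))"
      proof -
        have "closedin (rose g) {None}" using vertex_in_rose[OF g] Hausdorff_space_rose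
          by (simp add: closedin_Hausdorff_sing_eq)
        then show ?thesis using \<open>openin (rose g) (topspace (rose g) - F)\<close> by (intro openin_Int) auto
      qed
      then have "openin ?Y (topspace (rose g) - F - {None})"
        by (intro openin_subtopology[THEN iffD2] exI[of _ "(topspace (rose g) - F) \<inter> (topspace (rose g) - {None})"]) auto
      then have "openin (top_of_set (Xi g)) {t \<in> Xi g. h t \<in> topspace (rose g) - F - {None}}"
        using ch unfolding continuous_map_def by auto
      then have "open {t \<in> Xi g. h t \<in> topspace (rose g) - F - {None}}"
        using open_Xi openin_open_trans by blast
      moreover have "{t. petal_ext g h t \<in> F} = - {t \<in> Xi g. h t \<in> topspace (rose g) - F - {None}}"
        using True hX by (auto simp: petal_ext_def)
      ultimately show ?thesis by (simp add: closed_def)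
    qed
  qed
qed

section \<open>The configuration space\<close>

abbreviation Rose_power :: "nat \<Rightarrow> nat \<Rightarrow> (nat \<Rightarrow> (nat \<times> complex) option) topology"
  where "Rose_power n g \<equiv> product_topology (\<lambda>_. rose g) {1..n}"

lemma openin_distinct:
  assumes "Hausdorff_space X"
  shows "openin (product_topology (\<lambda>_. X) {1..n::nat}) {x \<in> topspace (product_topology (\<lambda>_. X) {1..n}). inj_on x {1..n}}"
proof -
  let ?P = "product_topology (\<lambda>_. X) {1..n::nat}"
  let ?E = "\<lambda>i j. {x \<in> topspace ?P. x i = x j}"
  have "closedin ?P (?E i j)" if "i \<in> {1..n}" "j \<in> {1..n}" for i j
    by (rule closedin_continuous_maps_eq[OF assms]) (use that in \<open>auto intro: continuous_map_product_projection\<close>)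
  then have "closedin ?P (\<Union>p\<in>{p \<in> {1..n} \<times> {1..n}. fst p \<noteq> snd p}. ?E (fst p) (snd p))"
    by (intro closedin_Union) auto
  moreover have "inj_on x {1..n} \<longleftrightarrow> (\<forall>p\<in>{p \<in> {1..n} \<times> {1..n}. fst p \<noteq> snd p}. x (fst p) \<noteq> x (snd p))" for x :: "nat \<Rightarrow> 'a"
  proof
    assume i: "inj_on x {1..n}"
    show "\<forall>p\<in>{p \<in> {1..n} \<times> {1..n}. fst p \<noteq> snd p}. x (fst p) \<noteq> x (snd p)"
    proof
      fix p assume "p \<in> {p \<in> {1..n} \<times> {1..n}. fst p \<noteq> snd p}"
      then show "x (fst p) \<noteq> x (snd p)" using inj_onD[OF i, of "fst p" "snd p"] by (auto simp del: atLeastAtMost_iff)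
    qed
  next
    assume a: "\<forall>p\<in>{p \<in> {1..n} \<times> {1..n}. fst p \<noteq> snd p}. x (fst p) \<noteq> x (snd p)"
    show "inj_on x {1..n}"
    proof (rule inj_onI, rule ccontr)
      fix i j assume "i \<in> {1..n}" "j \<in> {1..n}" "x i = x j" "i \<noteq> j"
      then show False using a[rule_format, of "(i, j)"] by simp
    qed
  qed
  then have "{x \<in> topspace ?P. inj_on x {1..n}} = topspace ?P - (\<Union>p\<in>{p \<in> {1..n} \<times> {1..n}. fst p \<noteq> snd p}. ?E (fst p) (snd p))"
    by (simp only: set_eq_iff mem_Collect_eq Diff_iff UN_iff) blast
  ultimately show ?thesis using openin_diff[OF openin_topspace] by (simp only:)
qed

lemma Conf_eq: "Conf n X = subtopology (product_topology (\<lambda>_. X) {1..n})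
   {x \<in> topspace (product_topology (\<lambda>_. X) {1..n}). inj_on x {1..n}}"
proof -
  let ?P = "product_topology (\<lambda>_. X) {1..n}"
  have "{x \<in> topspace ?P. inj_on x {1..n}} = topspace ?P \<inter> {x. inj_on x {1..n}}" by blast
  then show ?thesis unfolding Conf_def by (simp only: subtopology_restrict)
qed

lemma topspace_Conf: "topspace (Conf n X) = {x \<in> {1..n} \<rightarrow>\<^sub>E topspace X. inj_on x {1..n}}"
  by (auto simp: Conf_def)

lemma compact_Rose_power: "compact_space (Rose_power n g)"
  by (simp add: compact_space_product_topology compact_space_rose)

lemma Hausdorff_Rose_power: "Hausdorff_space (Rose_power n g)"
  by (simp add: Hausdorff_space_product_topology Hausdorff_space_rose)

lemma Hausdorff_Conf_plus: "Hausdorff_space (Conf_plus n (rose g))"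
proof -
  have "locally_compact_space (Conf n (rose g))"
    unfolding Conf_eq
    by (intro locally_compact_space_open_subset openin_distinct Hausdorff_space_rose
        compact_imp_locally_compact_space compact_Rose_power disjI1 Hausdorff_Rose_power)
  moreover have "Hausdorff_space (Conf n (rose g))"
    unfolding Conf_def by (intro Hausdorff_space_subtopology Hausdorff_Rose_power)
  ultimately show ?thesis by (simp add: Hausdorff_space_Alexandroff_compactification)
qed

definition collapse :: "nat \<Rightarrow> (nat \<Rightarrow> 'a) \<Rightarrow> (nat \<Rightarrow> 'a) option"
  where "collapse n x = (if inj_on x {1..n} then Some x else None)"

text \<open>Tuples of distinct points form an open subset of a compact Hausdorff space. A neighbourhood of
  \<open>\<infinity>\<close> is the complement of a compact set \<open>K\<close> of configurations, and \<open>K\<close> is closed in the product.\<close>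

lemma continuous_map_collapse: "continuous_map (Rose_power n g) (Conf_plus n (rose g)) (collapse n)"
proof -
  let ?P = "Rose_power n g" and ?S = "{x \<in> topspace (Rose_power n g). inj_on x {1..n}}"
  have op: "openin ?P ?S" by (rule openin_distinct[OF Hausdorff_space_rose])
  have tC: "topspace (Conf n (rose g)) = ?S" by (auto simp: Conf_def)
  show ?thesis
    unfolding continuous_map
  proof (intro conjI allI impI)
    show "collapse n ` topspace ?P \<subseteq> topspace (Conf_plus n (rose g))"
      by (auto simp: collapse_def tC)
    fix U assume "openin (Conf_plus n (rose g)) U"
    then consider W where "openin (Conf n (rose g)) W" "U = Some ` W"
      | K where "compactin (Conf n (rose g)) K" "U = insert None (Some ` (topspace (Conf n (rose g)) - K))"
      unfolding openin_Alexandroff_compactification by blast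
    then show "openin ?P {x \<in> topspace ?P. collapse n x \<in> U}"
    proof cases
      case 1
      then have W: "openin ?P W" using op openin_trans_full unfolding Conf_eq by blast
      have "W \<subseteq> ?S" using 1(1) openin_subset tC by blast
      then have "{x \<in> topspace ?P. collapse n x \<in> U} = W" by (auto simp: 1(2) collapse_def)
      then show ?thesis using W by simp
    next
      case 2
      then have "compactin ?P K" unfolding Conf_def by (simp add: compactin_subtopology)
      then have "closedin ?P K" using Hausdorff_Rose_power compactin_imp_closedin by blast
      moreover have "K \<subseteq> ?S" using 2(1) compactin_subset_topspace tC by blast
      then have "{x \<in> topspace ?P. collapse n x \<in> U} = topspace ?P - K" by (auto simp: 2(2) collapse_def tC)
      ultimately show ?thesis using openin_diff[OF openin_topspace] by (simp only:)
    qed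
  qed
qed

section \<open>Positions in a list\<close>

definition pos :: "'a list \<Rightarrow> 'a \<Rightarrow> nat" where "pos \<sigma> s = (THE a. a < length \<sigma> \<and> \<sigma> ! a = s)"

lemma pos_nth: "distinct \<sigma> \<Longrightarrow> a < length \<sigma> \<Longrightarrow> pos \<sigma> (\<sigma> ! a) = a"
  unfolding pos_def by (rule the_equality) (auto simp: nth_eq_iff_index_eq)

lemma pos_less: "distinct \<sigma> \<Longrightarrow> s \<in> set \<sigma> \<Longrightarrow> pos \<sigma> s < length \<sigma>"
  and nth_pos: "distinct \<sigma> \<Longrightarrow> s \<in> set \<sigma> \<Longrightarrow> \<sigma> ! pos \<sigma> s = s"
  by (auto simp: in_set_conv_nth pos_nth)

lemma pos_map:
  assumes "inj p" "distinct \<sigma>" "s \<in> set \<sigma>" shows "pos (map p \<sigma>) (p s) = pos \<sigma> s"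
proof -
  obtain a where a: "a < length \<sigma>" "s = \<sigma> ! a" using assms(3) by (auto simp: in_set_conv_nth)
  have "distinct (map p \<sigma>)" using assms(2) inj_on_subset[OF assms(1) subset_UNIV] by (simp add: distinct_map)
  then have "pos (map p \<sigma>) (map p \<sigma> ! a) = a" using a by (intro pos_nth) auto
  then show ?thesis using a assms by (simp add: pos_nth)
qed

section \<open>Bar symbols\<close>

lemma bar_symbols_iff: "(\<sigma>, \<beta>) \<in> bar_symbols n g k \<longleftrightarrow>
  length \<sigma> = k \<and> distinct \<sigma> \<and> set \<sigma> \<subseteq> {1..n} \<and> length \<beta> = k \<and> sorted \<beta> \<and> set \<beta> \<subseteq> {1..g}"
  by (simp add: bar_symbols_def)

lemma Xi_interval: "t \<in> Xi g \<longleftrightarrow> (\<exists>i\<in>{1..g}. real i - 1 < t \<and> t < real i)"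
  by (auto simp: Xi_def)

lemma interval_unique: "real i - 1 < t \<Longrightarrow> t < real i \<Longrightarrow> real j - 1 < t \<Longrightarrow> t < real j \<Longrightarrow> i = (j::nat)"
  by linarith

lemma nat_notin_Xi: "real m \<notin> Xi g" and nat_minus_1_notin_Xi: "real m - 1 \<notin> Xi g"
proof -
  have 1: "real m \<notin> Xi g" for m
  proof
    assume "real m \<in> Xi g"
    then obtain i where "real i - 1 < real m" "real m < real i" unfolding Xi_interval by blast
    then have "real i < real (Suc m)" "m < i" by simp_all
    then show False by simp
  qed
  then show "real m \<notin> Xi g" .
  show "real m - 1 \<notin> Xi g"
  proof
    assume "real m - 1 \<in> Xi g"
    then obtain i where "real i - 1 < real m - 1" "real m - 1 < real i" unfolding Xi_interval by blast
    then have "i < m" "real m < real (Suc i)" by simp_all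
    then show False by simp
  qed
qed

lemma open_slots_mono:
  assumes t: "t \<in> open_slots k b" and "a < c" "c < k"
  shows "t a < t c"
  using assms(2,3)
proof (induction c)
  case (Suc c)
  have "t c < t (Suc c)" using t Suc.prems by (auto simp: open_slots_def)
  then show ?case using Suc by (cases "a = c") auto
qed simp

lemma open_slots_less_iff:
  assumes t: "t \<in> open_slots k b" and "a < k" "c < k"
  shows "t a < t c \<longleftrightarrow> a < c"
  using open_slots_mono[OF t, of a c] open_slots_mono[OF t, of c a] assms(2,3)
  by (cases a c rule: linorder_cases) auto

lemma open_slots_Xi:
  assumes "t \<in> open_slots k ((!) \<beta>)" "length \<beta> = k" "set \<beta> \<subseteq> {1..g}" "a < k"
  shows "t a \<in> Xi g"
proof -
  have "\<beta> ! a \<in> {1..g}" using assms(2-4) nth_mem[of a \<beta>] by blast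
  moreover have "real (\<beta> ! a) - 1 < t a \<and> t a < real (\<beta> ! a)" using assms(1,4) by (simp add: open_slots_def)
  ultimately show ?thesis unfolding Xi_interval by blast
qed

section \<open>Characteristic maps\<close>

locale rose_config =
  fixes g n :: nat and h :: "real \<Rightarrow> (nat \<times> complex) option"
  assumes g: "g \<ge> 1" and n: "n \<ge> 1" and h: "petal_homeo g h"
begin

abbreviation "X \<equiv> Conf_plus n (rose g)"

text \<open>The tuple in which the label at position \<open>a\<close> of \<open>\<sigma>\<close> sits at the image of \<open>t a\<close> and all other labels
  sit at the vertex. It is defined for all \<open>t\<close>, including those on the boundary of the polytope, where
  points may coincide.\<close>

definition config :: "nat list \<Rightarrow> (nat \<Rightarrow> real) \<Rightarrow> nat \<Rightarrow> (nat \<times> complex) option"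
  where "config \<sigma> t = (\<lambda>s\<in>{1..n}. if s \<in> set \<sigma> then petal_ext g h (t (pos \<sigma> s)) else None)"

definition char_map :: "nat list \<times> nat list \<Rightarrow> (nat \<Rightarrow> real) \<Rightarrow> (nat \<Rightarrow> (nat \<times> complex) option) option"
  where "char_map w y = collapse n (config (fst w) (slot_point (length (fst w)) ((!) (snd w)) y))"

lemma h_inj: "inj_on h (Xi g)"
  using h unfolding petal_homeo_def homeomorphic_map_def by simp

lemma h_image: "h ` Xi g = topspace (rose g) - {None}"
proof -
  have "h ` topspace (top_of_set (Xi g)) = topspace (subtopology (rose g) (topspace (rose g) - {None}))"
    using h unfolding petal_homeo_def rose_vertex_def by (intro homeomorphic_imp_surjective_map) simp
  then show ?thesis by auto
qed

lemma h_not_vertex: "t \<in> Xi g \<Longrightarrow> h t \<noteq> None"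
  using h_image by (metis DiffD2 image_eqI singletonI)

lemma petal_ext_None_iff: "petal_ext g h t = None \<longleftrightarrow> t \<notin> Xi g"
  using h_not_vertex by (auto simp: petal_ext_def)

lemma petal_ext_inj: "t \<in> Xi g \<Longrightarrow> petal_ext g h t = petal_ext g h u \<Longrightarrow> t = u"
  using h_inj h_not_vertex[of t] by (auto simp: petal_ext_def inj_on_def split: if_splits)

lemma continuous_map_char:
  assumes "(\<sigma>, \<beta>) \<in> bar_symbols n g k"
  shows "continuous_map (disc k) X (char_map (\<sigma>, \<beta>))"
proof -
  have w: "length \<sigma> = k" "distinct \<sigma>" "length \<beta> = k" "sorted \<beta>" using assms by (auto simp: bar_symbols_iff)
  have mono: "Suc a < k \<Longrightarrow> \<beta> ! a \<le> \<beta> ! Suc a" for a using w by (intro sorted_nth_mono) auto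
  have "continuous_map (disc k) (Rose_power n g) (\<lambda>y. config \<sigma> (slot_point k ((!) \<beta>) y))"
    unfolding continuous_map_componentwise
  proof (intro conjI ballI)
    fix s assume s: "s \<in> {1..n}"
    show "continuous_map (disc k) (rose g) (\<lambda>y. config \<sigma> (slot_point k ((!) \<beta>) y) s)"
    proof (cases "s \<in> set \<sigma>")
      case True
      have "continuous_map (disc k) euclidean (\<lambda>y. slot_point k ((!) \<beta>) y (pos \<sigma> s))"
        unfolding disc_eq using continuous_on_slot_point[of k "(!) \<beta>" "pos \<sigma> s"] mono by simp
      then have "continuous_map (disc k) (rose g) (petal_ext g h \<circ> (\<lambda>y. slot_point k ((!) \<beta>) y (pos \<sigma> s)))"
        using continuous_map_petal_ext[OF g h] by (rule continuous_map_compose)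
      then show ?thesis using True s by (simp add: config_def comp_def)
    next
      case False
      then have "(\<lambda>y. config \<sigma> (slot_point k ((!) \<beta>) y) s) = (\<lambda>_. None)" using s by (auto simp: config_def)
      then show ?thesis using vertex_in_rose[OF g] by simp
    qed
  qed (auto simp: config_def)
  then have "continuous_map (disc k) X (collapse n \<circ> (\<lambda>y. config \<sigma> (slot_point k ((!) \<beta>) y)))"
    using continuous_map_collapse by (rule continuous_map_compose)
  moreover have "char_map (\<sigma>, \<beta>) = collapse n \<circ> (\<lambda>y. config \<sigma> (slot_point k ((!) \<beta>) y))"
    using w(1) by (simp add: char_map_def fun_eq_iff)
  ultimately show ?thesis by simp
qed

lemma config_None_iff:
  assumes "(\<sigma>, \<beta>) \<in> bar_symbols n g k" "t \<in> open_slots k ((!) \<beta>)" "s \<in> {1..n}"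
  shows "config \<sigma> t s = None \<longleftrightarrow> s \<notin> set \<sigma>"
  using assms open_slots_Xi[OF assms(2)] pos_less[of \<sigma> s]
  by (auto simp: config_def petal_ext_None_iff bar_symbols_iff)

text \<open>At most one label is absent from an ordering of length at least \<open>n - 1\<close>, so no two points meet at
  the vertex.\<close>

lemma missing_label_unique:
  assumes "(\<sigma>, \<beta>) \<in> bar_symbols n g k" "n - 1 \<le> k" "s \<in> {1..n} - set \<sigma>" "s' \<in> {1..n} - set \<sigma>"
  shows "s = s'"
proof -
  have "card (set \<sigma>) = k" "set \<sigma> \<subseteq> {1..n}" using assms by (auto simp: bar_symbols_iff distinct_card)
  then have "card ({1..n} - set \<sigma>) \<le> 1" using assms(2) n by (simp add: card_Diff_subset)
  then show ?thesis using assms(3,4) by (metis card_le_Suc0_iff_eq finite_Diff finite_atLeastAtMost One_nat_def)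
qed

lemma config_inj:
  assumes w: "(\<sigma>, \<beta>) \<in> bar_symbols n g k" and k: "n - 1 \<le> k" and t: "t \<in> open_slots k ((!) \<beta>)"
  shows "inj_on (config \<sigma> t) {1..n}"
proof (rule inj_onI)
  fix s s' assume s: "s \<in> {1..n}" and s': "s' \<in> {1..n}" and eq: "config \<sigma> t s = config \<sigma> t s'"
  have W: "length \<sigma> = k" "distinct \<sigma>" "length \<beta> = k" "set \<beta> \<subseteq> {1..g}" using w by (auto simp: bar_symbols_iff)
  show "s = s'"
  proof (cases "s \<in> set \<sigma>")
    case False
    then have "s' \<notin> set \<sigma>" using config_None_iff[OF w t] s s' eq by metis
    then show ?thesis using missing_label_unique[OF w k] s s' False by blast
  next
    case True
    then have s'\<sigma>: "s' \<in> set \<sigma>" using config_None_iff[OF w t] s s' eq by metis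
    have p: "pos \<sigma> s < k" "pos \<sigma> s' < k" using pos_less W True s'\<sigma> by metis+
    have "t (pos \<sigma> s) = t (pos \<sigma> s')"
      using eq True s'\<sigma> s s' open_slots_Xi[OF t W(3,4) p(1)] by (intro petal_ext_inj) (auto simp: config_def)
    then have "pos \<sigma> s = pos \<sigma> s'" using open_slots_mono[OF t] p by (metis less_irrefl linorder_neqE_nat)
    then show ?thesis using nth_pos[OF W(2)] True s'\<sigma> by metis
  qed
qed

lemma symbol_cell_eq:
  assumes w: "(\<sigma>, \<beta>) \<in> bar_symbols n g k"
  shows "symbol_cell n g h (\<sigma>, \<beta>) = (\<lambda>t. Some (config \<sigma> t)) ` open_slots k ((!) \<beta>)"
proof (intro equalityI subsetI)
  have W: "length \<sigma> = k" "distinct \<sigma>" "length \<beta> = k" "set \<beta> \<subseteq> {1..g}" using w by (auto simp: bar_symbols_iff)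
  have \<beta>in: "\<beta> ! a \<in> {1..g}" if "a < k" for a using W(3,4) nth_mem[of a \<beta>] that by blast
  {
    fix c assume "c \<in> symbol_cell n g h (\<sigma>, \<beta>)"
    then obtain x where x: "x \<in> symbol_configs g (\<sigma>, \<beta>)"
      and c: "c = Some (\<lambda>s\<in>{1..n}. if s \<in> set \<sigma> then h (x s) else None)"
      unfolding symbol_cell_def rose_vertex_def by auto
    define t where "t a = (if a < k then x (\<sigma> ! a) else 0)" for a
    have xX: "x s \<in> Xi g" if "s \<in> set \<sigma>" for s using x that by (auto simp: symbol_configs_def)
    have lt: "x (\<sigma> ! a) < x (\<sigma> ! b) \<longleftrightarrow> a < b" if "a < k" "b < k" for a b
      using x that W(1) by (auto simp: symbol_configs_def)
    have int: "x (\<sigma> ! a) \<in> {real i - 1 <..< real i} \<longleftrightarrow> \<beta> ! a = i" if "a < k" "i \<in> {1..g}" for a i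
      using x that W(1) by (auto simp: symbol_configs_def)
    have "t \<in> open_slots k ((!) \<beta>)"
      unfolding open_slots_def using int[OF _ \<beta>in] lt by (auto simp: t_def)
    moreover have "config \<sigma> t = (\<lambda>s\<in>{1..n}. if s \<in> set \<sigma> then h (x s) else None)"
    proof (rule ext)
      fix s show "config \<sigma> t s = (\<lambda>s\<in>{1..n}. if s \<in> set \<sigma> then h (x s) else None) s"
        using pos_less[OF W(2), of s] nth_pos[OF W(2), of s] xX[of s] W(1)
        by (auto simp: config_def t_def petal_ext_def)
    qed
    ultimately show "c \<in> (\<lambda>t. Some (config \<sigma> t)) ` open_slots k ((!) \<beta>)"
      unfolding c by (intro image_eqI[of _ _ t]) auto
  }
  {
    fix c assume "c \<in> (\<lambda>t. Some (config \<sigma> t)) ` open_slots k ((!) \<beta>)"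
    then obtain t where t: "t \<in> open_slots k ((!) \<beta>)" and c: "c = Some (config \<sigma> t)" by blast
    define x where "x = (\<lambda>s\<in>set \<sigma>. t (pos \<sigma> s))"
    have xn: "x (\<sigma> ! a) = t a" if "a < k" for a using that W by (simp add: x_def pos_nth)
    have xX: "x s \<in> Xi g" if "s \<in> set \<sigma>" for s
      using open_slots_Xi[OF t W(3,4)] pos_less[OF W(2) that] W(1) that by (simp add: x_def)
    have "inj_on x (set \<sigma>)"
    proof (rule inj_onI)
      fix s s' assume s: "s \<in> set \<sigma>" "s' \<in> set \<sigma>" and "x s = x s'"
      then have "t (pos \<sigma> s) = t (pos \<sigma> s')" by (simp add: x_def)
      then have "pos \<sigma> s = pos \<sigma> s'"
        using open_slots_mono[OF t] pos_less[OF W(2)] W(1) s by (metis less_irrefl linorder_neqE_nat)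
      then show "s = s'" using nth_pos[OF W(2)] s by metis
    qed
    moreover have "x (\<sigma> ! a) \<in> {real i - 1 <..< real i} \<longleftrightarrow> \<beta> ! a = i" if a: "a < k" for a i
    proof -
      have "real (\<beta> ! a) - 1 < t a" "t a < real (\<beta> ! a)" using t a by (auto simp: open_slots_def)
      then show ?thesis unfolding xn[OF a] using interval_unique by auto
    qed
    moreover have "x \<in> set \<sigma> \<rightarrow>\<^sub>E Xi g" using xX by (auto simp: x_def)
    ultimately have "x \<in> symbol_configs g (\<sigma>, \<beta>)"
      unfolding symbol_configs_def using W(1) xn open_slots_less_iff[OF t] by auto
    moreover have "config \<sigma> t = (\<lambda>s\<in>{1..n}. if s \<in> set \<sigma> then h (x s) else None)"
    proof (rule ext)
      fix s show "config \<sigma> t s = (\<lambda>s\<in>{1..n}. if s \<in> set \<sigma> then h (x s) else None) s"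
        using xX[of s] by (auto simp: config_def x_def petal_ext_def)
    qed
    ultimately show "c \<in> symbol_cell n g h (\<sigma>, \<beta>)"
      unfolding c symbol_cell_def rose_vertex_def by auto
  }
qed

lemma symbol_mono:
  assumes "(\<sigma>, \<beta>) \<in> bar_symbols n g k" "Suc a < k" shows "\<beta> ! a \<le> \<beta> ! Suc a"
  using assms by (intro sorted_nth_mono) (auto simp: bar_symbols_iff)

lemma char_map_open:
  assumes w: "(\<sigma>, \<beta>) \<in> bar_symbols n g k" and k: "n - 1 \<le> k" and y: "y \<in> open_unit_disc k"
  shows "char_map (\<sigma>, \<beta>) y = Some (config \<sigma> (slot_point k ((!) \<beta>) y))"
proof -
  have "slot_point k ((!) \<beta>) y \<in> open_slots k ((!) \<beta>)"
    using slot_point_bij[of k "(!) \<beta>"] symbol_mono[OF w] y by (auto simp: bij_betw_def)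
  then have "inj_on (config \<sigma> (slot_point k ((!) \<beta>) y)) {1..n}" by (rule config_inj[OF w k])
  then show ?thesis using w by (simp add: char_map_def collapse_def bar_symbols_iff)
qed

lemma char_map_image:
  assumes w: "(\<sigma>, \<beta>) \<in> bar_symbols n g k" and k: "n - 1 \<le> k"
  shows "char_map (\<sigma>, \<beta>) ` open_unit_disc k = symbol_cell n g h (\<sigma>, \<beta>)"
proof -
  have "slot_point k ((!) \<beta>) ` open_unit_disc k = open_slots k ((!) \<beta>)"
    using slot_point_bij[of k "(!) \<beta>"] symbol_mono[OF w] by (auto simp: bij_betw_def)
  moreover have "char_map (\<sigma>, \<beta>) ` open_unit_disc k = (\<lambda>y. Some (config \<sigma> (slot_point k ((!) \<beta>) y))) ` open_unit_disc k"
    using char_map_open[OF w k] by (intro image_cong refl)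
  moreover have "\<dots> = (\<lambda>t. Some (config \<sigma> t)) ` slot_point k ((!) \<beta>) ` open_unit_disc k"
    by (simp only: image_image)
  ultimately show ?thesis unfolding symbol_cell_eq[OF w] by (simp only:)
qed

lemma char_map_inj:
  assumes w: "(\<sigma>, \<beta>) \<in> bar_symbols n g k" and k: "n - 1 \<le> k"
  shows "inj_on (char_map (\<sigma>, \<beta>)) (open_unit_disc k)"
proof (rule inj_onI)
  fix y z assume y: "y \<in> open_unit_disc k" and z: "z \<in> open_unit_disc k" and "char_map (\<sigma>, \<beta>) y = char_map (\<sigma>, \<beta>) z"
  let ?t = "slot_point k ((!) \<beta>) y" and ?u = "slot_point k ((!) \<beta>) z"
  have W: "length \<sigma> = k" "distinct \<sigma>" "length \<beta> = k" "set \<beta> \<subseteq> {1..g}" "set \<sigma> \<subseteq> {1..n}" using w by (auto simp: bar_symbols_iff)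
  have bij: "bij_betw (slot_point k ((!) \<beta>)) (open_unit_disc k) (open_slots k ((!) \<beta>))"
    using slot_point_bij[of k "(!) \<beta>"] symbol_mono[OF w] by auto
  then have tu: "?t \<in> open_slots k ((!) \<beta>)" "?u \<in> open_slots k ((!) \<beta>)" using y z by (auto simp: bij_betw_def)
  have eq: "config \<sigma> ?t = config \<sigma> ?u"
    using \<open>char_map (\<sigma>, \<beta>) y = char_map (\<sigma>, \<beta>) z\<close> char_map_open[OF w k] y z by simp
  have "?t = ?u"
  proof
    fix a show "?t a = ?u a"
    proof (cases "a < k")
      case True
      then have "\<sigma> ! a \<in> set \<sigma>" "pos \<sigma> (\<sigma> ! a) = a" using W by (auto simp: pos_nth)
      moreover from this have "\<sigma> ! a \<in> {1..n}" using W(5) by blast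
      ultimately have "petal_ext g h (?t a) = petal_ext g h (?u a)"
        using fun_cong[OF eq, of "\<sigma> ! a"] by (simp add: config_def)
      then show ?thesis using open_slots_Xi[OF tu(1) W(3,4) True] by (rule petal_ext_inj[rotated])
    next
      case False
      then show ?thesis using tu by (auto simp: open_slots_def)
    qed
  qed
  then show "y = z" using bij y z by (auto simp: bij_betw_def inj_on_def)
qed

text \<open>On a facet either two points of the configuration coincide, or a point has reached an integer, where
  the extended parametrisation takes the vertex as its value.\<close>

lemma char_map_sphere:
  assumes w: "(\<sigma>, \<beta>) \<in> bar_symbols n g k" and y: "y \<in> unit_sphere k"
  shows "char_map (\<sigma>, \<beta>) y = None \<or> (\<exists>x s. char_map (\<sigma>, \<beta>) y = Some x \<and> s \<in> set \<sigma> \<and> x s = None)"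
proof -
  let ?t = "slot_point k ((!) \<beta>) y"
  have W: "length \<sigma> = k" "distinct \<sigma>" "set \<sigma> \<subseteq> {1..n}" using w by (auto simp: bar_symbols_iff)
  have \<sigma>n: "\<sigma> ! a \<in> set \<sigma>" "\<sigma> ! a \<in> {1..n}" if "a < k" for a using that W nth_mem[of a \<sigma>] by blast+
  have val: "config \<sigma> ?t (\<sigma> ! a) = petal_ext g h (?t a)" if "a < k" for a
    using \<sigma>n[OF that] that W by (simp add: config_def pos_nth)
  obtain a where a: "a < k" and alt: "?t a = real (\<beta> ! a) - 1 \<or> ?t a = real (\<beta> ! a) \<or> (Suc a < k \<and> ?t a = ?t (Suc a))"
    using slot_point_boundary[of k "(!) \<beta>" y] symbol_mono[OF w] y by auto
  show ?thesis
  proof (cases "?t a \<in> Xi g")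
    case False
    then have "config \<sigma> ?t (\<sigma> ! a) = None" using val[OF a] by (simp add: petal_ext_None_iff)
    then show ?thesis using \<sigma>n[OF a] W(1) by (auto simp: char_map_def collapse_def)
  next
    case True
    then have "Suc a < k" "?t a = ?t (Suc a)" using alt nat_notin_Xi nat_minus_1_notin_Xi by metis+
    then have "config \<sigma> ?t (\<sigma> ! a) = config \<sigma> ?t (\<sigma> ! Suc a)" "\<sigma> ! a \<noteq> \<sigma> ! Suc a"
      using val a W by (auto simp: nth_eq_iff_index_eq)
    then have "\<not> inj_on (config \<sigma> ?t) {1..n}" using \<sigma>n[OF a] \<sigma>n[OF \<open>Suc a < k\<close>] by (meson inj_onD)
    then show ?thesis using W(1) by (simp add: char_map_def collapse_def)
  qed
qed

lemma symbol_cell_support: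
  assumes w: "(\<sigma>, \<beta>) \<in> bar_symbols n g k" and c: "c \<in> symbol_cell n g h (\<sigma>, \<beta>)"
  obtains x where "c = Some x" "\<And>s. s \<in> {1..n} \<Longrightarrow> x s = None \<longleftrightarrow> s \<notin> set \<sigma>"
  using c config_None_iff[OF w] unfolding symbol_cell_eq[OF w] by blast

text \<open>The labels in \<open>\<sigma>\<close> are those whose points are off the vertex. Their positions in \<open>\<real>\<close> are determined by
  the configuration, and \<open>\<sigma>\<close> lists them in increasing order; each position determines its petal.\<close>

lemma symbol_unique:
  assumes w: "(\<sigma>, \<beta>) \<in> bar_symbols n g k" and w': "(\<sigma>', \<beta>') \<in> bar_symbols n g k'"
    and c: "c \<in> symbol_cell n g h (\<sigma>, \<beta>)" and c': "c \<in> symbol_cell n g h (\<sigma>', \<beta>')"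
  shows "(\<sigma>, \<beta>) = (\<sigma>', \<beta>')"
proof -
  have W: "length \<sigma> = k" "distinct \<sigma>" "length \<beta> = k" "set \<beta> \<subseteq> {1..g}" "set \<sigma> \<subseteq> {1..n}" using w by (auto simp: bar_symbols_iff)
  have W': "length \<sigma>' = k'" "distinct \<sigma>'" "length \<beta>' = k'" "set \<beta>' \<subseteq> {1..g}" "set \<sigma>' \<subseteq> {1..n}" using w' by (auto simp: bar_symbols_iff)
  obtain t where t: "t \<in> open_slots k ((!) \<beta>)" "c = Some (config \<sigma> t)" using c unfolding symbol_cell_eq[OF w] by blast
  obtain u where u: "u \<in> open_slots k' ((!) \<beta>')" "c = Some (config \<sigma>' u)" using c' unfolding symbol_cell_eq[OF w'] by blast
  have eq: "config \<sigma> t = config \<sigma>' u" using t u by simp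
  have S: "set \<sigma> = set \<sigma>'"
  proof -
    have "s \<in> set \<sigma> \<longleftrightarrow> s \<in> set \<sigma>'" if "s \<in> {1..n}" for s
      using config_None_iff[OF w t(1) that] config_None_iff[OF w' u(1) that] eq by simp
    then show ?thesis using W(5) W'(5) by blast
  qed
  then have kk: "k = k'" using W W' by (metis distinct_card)
  have val: "t (pos \<sigma> s) = u (pos \<sigma>' s)" if "s \<in> set \<sigma>" for s
  proof (rule petal_ext_inj)
    show "t (pos \<sigma> s) \<in> Xi g" using open_slots_Xi[OF t(1) W(3,4)] pos_less[OF W(2) that] W(1) by simp
    show "petal_ext g h (t (pos \<sigma> s)) = petal_ext g h (u (pos \<sigma>' s))"
      using fun_cong[OF eq, of s] that S W(5) by (auto simp: config_def split: if_splits)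
  qed
  have st: "map (\<lambda>s. t (pos \<sigma> s)) \<sigma> = map t [0..<k]" 
    by (rule nth_equalityI) (use W in \<open>auto simp: pos_nth\<close>)
  have su: "map (\<lambda>s. t (pos \<sigma> s)) \<sigma>' = map u [0..<k']" 
    by (rule nth_equalityI) (use W' S val in \<open>auto simp: pos_nth\<close>)
  have sorted_t: "sorted (map t [0..<k])" 
    using open_slots_mono[OF t(1)] by (force simp: sorted_iff_nth_mono_less intro: less_imp_le)
  have sorted_u: "sorted (map u [0..<k'])" 
    using open_slots_mono[OF u(1)] by (force simp: sorted_iff_nth_mono_less intro: less_imp_le)
  have inj: "inj_on (\<lambda>s. t (pos \<sigma> s)) (set \<sigma>)"
  proof (rule inj_onI)
    fix s s' assume s: "s \<in> set \<sigma>" "s' \<in> set \<sigma>" and "t (pos \<sigma> s) = t (pos \<sigma> s')"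
    then have "pos \<sigma> s = pos \<sigma> s'"
      using open_slots_mono[OF t(1)] pos_less[OF W(2)] W(1) by (metis less_irrefl linorder_neqE_nat)
    then show "s = s'" using nth_pos[OF W(2)] s by metis
  qed
  have "map (\<lambda>s. t (pos \<sigma> s)) \<sigma> = map (\<lambda>s. t (pos \<sigma> s)) \<sigma>'"
  proof (rule sorted_distinct_set_unique)
    show "distinct (map (\<lambda>s. t (pos \<sigma> s)) \<sigma>)" "distinct (map (\<lambda>s. t (pos \<sigma> s)) \<sigma>')"
      using inj W(2) W'(2) S by (auto simp: distinct_map)
    show "set (map (\<lambda>s. t (pos \<sigma> s)) \<sigma>) = set (map (\<lambda>s. t (pos \<sigma> s)) \<sigma>')" by (simp add: S)
  qed (simp_all only: st su sorted_t sorted_u)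
  then have \<sigma>: "\<sigma> = \<sigma>'" using inj S by (intro map_inj_on[of "\<lambda>s. t (pos \<sigma> s)"]) auto
  have "\<beta> ! a = \<beta>' ! a" if a: "a < k" for a
  proof -
    have "\<sigma> ! a \<in> set \<sigma>" using a W(1) by simp
    from val[OF this] have "t a = u a" using a W(1,2) \<sigma> by (simp add: pos_nth)
    moreover have "real (\<beta> ! a) - 1 < t a" "t a < real (\<beta> ! a)" using t(1) a by (auto simp: open_slots_def)
    moreover have "real (\<beta>' ! a) - 1 < u a" "u a < real (\<beta>' ! a)" using u(1) a kk by (auto simp: open_slots_def)
    ultimately show ?thesis using interval_unique by metis
  qed
  then have "\<beta> = \<beta>'" using W(3) W'(3) kk by (intro nth_equalityI) auto
  then show ?thesis using \<sigma> by simp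
qed

text \<open>The symbol of a configuration arises by sorting the labels by their positions in \<open>\<real>\<close>.\<close>

lemma symbol_cover:
  assumes x: "x \<in> topspace (Conf n (rose g))"
  defines "S \<equiv> {s \<in> {1..n}. x s \<noteq> None}"
  shows "\<exists>\<sigma> \<beta>. (\<sigma>, \<beta>) \<in> bar_symbols n g (card S) \<and> set \<sigma> = S \<and> Some x \<in> symbol_cell n g h (\<sigma>, \<beta>)"
proof -
  have xr: "x s \<in> topspace (rose g)" if "s \<in> {1..n}" for s using x that by (auto simp: topspace_Conf)
  have xext: "x s = undefined" if "s \<notin> {1..n}" for s using x that by (auto simp: topspace_Conf PiE_iff extensional_def)
  have xinj: "inj_on x {1..n}" using x by (simp add: topspace_Conf)
  define y where "y s = inv_into (Xi g) h (x s)" for s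
  have y: "y s \<in> Xi g" "h (y s) = x s" if "s \<in> S" for s
  proof -
    have "x s \<in> h ` Xi g" using that xr h_image by (auto simp: S_def)
    then show "y s \<in> Xi g" "h (y s) = x s" by (auto simp: y_def inv_into_into f_inv_into_f)
  qed
  have yinj: "inj_on y S"
  proof (rule inj_onI)
    fix s s' assume s: "s \<in> S" "s' \<in> S" and "y s = y s'"
    then have "x s = x s'" using y(2) by metis
    then show "s = s'" using inj_onD[OF xinj, of s s'] s by (simp add: S_def)
  qed
  have finS: "finite S" by (simp add: S_def)
  define \<sigma> where "\<sigma> = sort_key y (sorted_list_of_set S)"
  have \<sigma>: "set \<sigma> = S" "distinct \<sigma>" "sorted (map y \<sigma>)" using finS by (simp_all add: \<sigma>_def)
  have len: "length \<sigma> = card S" using \<sigma> distinct_card by metis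
  define petal where "petal t = (THE i. i \<in> {1..g} \<and> real i - 1 < t \<and> t < real i)" for t
  have petal: "petal t \<in> {1..g}" "real (petal t) - 1 < t" "t < real (petal t)" if t: "t \<in> Xi g" for t
  proof -
    have "\<exists>!i. i \<in> {1..g} \<and> real i - 1 < t \<and> t < real i"
      using t interval_unique unfolding Xi_interval by blast
    from theI'[OF this] show "petal t \<in> {1..g}" "real (petal t) - 1 < t" "t < real (petal t)"
      by (simp_all add: petal_def)
  qed
  have petal_mono: "petal t \<le> petal u" if "t \<in> Xi g" "u \<in> Xi g" "t \<le> u" for t u
    using petal(2)[OF that(1)] petal(3)[OF that(2)] that(3) by linarith
  define \<beta> where "\<beta> = map (\<lambda>s. petal (y s)) \<sigma>"
  have nthS: "\<sigma> ! a \<in> S" if "a < card S" for a using that len \<sigma>(1) nth_mem[of a \<sigma>] by simp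
  have ymono: "y (\<sigma> ! a) < y (\<sigma> ! b)" if "a < b" "b < card S" for a b
  proof -
    have "y (\<sigma> ! a) \<le> y (\<sigma> ! b)" using sorted_nth_mono[OF \<sigma>(3), of a b] that len by simp
    moreover have "y (\<sigma> ! a) \<noteq> y (\<sigma> ! b)"
    proof
      assume "y (\<sigma> ! a) = y (\<sigma> ! b)"
      then have "\<sigma> ! a = \<sigma> ! b" using inj_onD[OF yinj] nthS that by simp
      then show False using that len \<sigma>(2) by (simp add: nth_eq_iff_index_eq)
    qed
    ultimately show ?thesis by simp
  qed
  have bs: "(\<sigma>, \<beta>) \<in> bar_symbols n g (card S)"
  proof -
    have "sorted \<beta>"
      unfolding sorted_iff_nth_mono_less
    proof (intro allI impI)
      fix a b assume "a < b" "b < length \<beta>"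
      then have ab: "a < b" "b < card S" using len by (simp_all add: \<beta>_def)
      then show "\<beta> ! a \<le> \<beta> ! b"
        using petal_mono[OF y(1)[OF nthS] y(1)[OF nthS], of a b] ymono[OF ab] len by (simp add: \<beta>_def)
    qed
    moreover have "set \<beta> \<subseteq> {1..g}" using petal(1) y(1) \<sigma>(1) by (auto simp: \<beta>_def)
    ultimately show ?thesis using \<sigma> len by (auto simp: bar_symbols_iff \<beta>_def S_def)
  qed
  define t where "t a = (if a < card S then y (\<sigma> ! a) else 0)" for a
  have "t \<in> open_slots (card S) ((!) \<beta>)"
    using petal(2,3)[OF y(1)[OF nthS]] ymono len by (auto simp: open_slots_def t_def \<beta>_def)
  moreover have "config \<sigma> t = x"
  proof
    fix s show "config \<sigma> t s = x s"
    proof (cases "s \<in> S")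
      case True
      then have "s \<in> {1..n}" by (simp add: S_def)
      then show ?thesis
        using True y[of s] pos_less[OF \<sigma>(2), of s] nth_pos[OF \<sigma>(2), of s] len \<sigma>(1)
        by (simp add: config_def t_def petal_ext_def)
    next
      case False
      then have "s \<in> {1..n} \<Longrightarrow> x s = None" using S_def by blast
      then show ?thesis using False xext[of s] \<sigma>(1) by (simp add: config_def restrict_def)
    qed
  qed
  ultimately have "Some x \<in> symbol_cell n g h (\<sigma>, \<beta>)"
    unfolding symbol_cell_eq[OF bs] by (intro image_eqI[of _ _ t]) auto
  then show ?thesis using bs \<sigma>(1) by blast
qed

end

section \<open>Counting bar symbols\<close>

definition sorted_lists :: "nat \<Rightarrow> nat \<Rightarrow> nat list set"
  where "sorted_lists k g = {\<beta>. length \<beta> = k \<and> sorted \<beta> \<and> set \<beta> \<subseteq> {1..g}}"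

lemma finite_sorted_lists: "finite (sorted_lists k g)"
  by (rule finite_subset[OF _ finite_lists_length_eq[of "{1..g}" k]]) (auto simp: sorted_lists_def)

lemma sorted_lists_Suc:
  "sorted_lists (Suc k) (Suc g) = sorted_lists (Suc k) g \<union> (\<lambda>\<beta>. \<beta> @ [Suc g]) ` sorted_lists k (Suc g)"
proof (intro equalityI subsetI)
  fix \<beta> assume \<beta>: "\<beta> \<in> sorted_lists (Suc k) (Suc g)"
  then obtain \<gamma> m where \<gamma>: "\<beta> = \<gamma> @ [m]" by (cases \<beta> rule: rev_cases) (auto simp: sorted_lists_def)
  show "\<beta> \<in> sorted_lists (Suc k) g \<union> (\<lambda>\<beta>. \<beta> @ [Suc g]) ` sorted_lists k (Suc g)"
  proof (cases "m = Suc g")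
    case True
    then show ?thesis using \<beta> \<gamma> by (auto simp: sorted_lists_def sorted_append)
  next
    case False
    then have "x \<le> g \<and> 1 \<le> x" if "x \<in> set \<beta>" for x
      using \<beta> that by (fastforce simp: sorted_lists_def sorted_append \<gamma>)
    then show ?thesis using \<beta> by (auto simp: sorted_lists_def)
  qed
next
  fix \<beta> assume "\<beta> \<in> sorted_lists (Suc k) g \<union> (\<lambda>\<beta>. \<beta> @ [Suc g]) ` sorted_lists k (Suc g)"
  then show "\<beta> \<in> sorted_lists (Suc k) (Suc g)"
    by (fastforce simp: sorted_lists_def sorted_append)
qed

text \<open>Pascal's rule, splitting the lists by whether the last entry is the largest admissible value.\<close>

lemma card_sorted_lists: "card (sorted_lists k g) = (k + g - 1) choose k"
proof (induction k arbitrary: g)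
  case 0
  have "sorted_lists 0 g = {[]}" by (auto simp: sorted_lists_def)
  then show ?case by simp
next
  case (Suc k)
  show ?case
  proof (induction g)
    case 0
    have "sorted_lists (Suc k) 0 = {}" by (auto simp: sorted_lists_def)
    then show ?case by simp
  next
    case (Suc g)
    have "sorted_lists (Suc k) g \<inter> (\<lambda>\<beta>. \<beta> @ [Suc g]) ` sorted_lists k (Suc g) = {}"
      by (auto simp: sorted_lists_def)
    then have "card (sorted_lists (Suc k) (Suc g)) = card (sorted_lists (Suc k) g) + card ((\<lambda>\<beta>. \<beta> @ [Suc g]) ` sorted_lists k (Suc g))"
      unfolding sorted_lists_Suc by (intro card_Un_disjoint) (auto simp: finite_sorted_lists)
    also have "card ((\<lambda>\<beta>. \<beta> @ [Suc g]) ` sorted_lists k (Suc g)) = card (sorted_lists k (Suc g))"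
      by (intro card_image) (auto simp: inj_on_def)
    finally show ?case using Suc.IH \<open>\<And>g. card (sorted_lists k g) = k + g - 1 choose k\<close>[of "Suc g"] by simp
  qed
qed

lemma bar_symbols_Times:
  "bar_symbols n g k = {\<sigma>. length \<sigma> = k \<and> distinct \<sigma> \<and> set \<sigma> \<subseteq> {1..n}} \<times> sorted_lists k g"
  by (auto simp: bar_symbols_def sorted_lists_def)

lemma finite_bar_symbols: "finite (bar_symbols n g k)"
  unfolding bar_symbols_Times
  by (intro finite_cartesian_product finite_sorted_lists finite_subset[OF _ finite_lists_length_eq[of "{1..n}" k]]) auto

lemma card_bar_symbols:
  assumes n: "1 \<le> n" and k: "k \<in> {n - 1, n}"
  shows "card (bar_symbols n g k) = fact n * ((k + g - 1) choose k)"
proof -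
  have "card {\<sigma>. length \<sigma> = k \<and> distinct \<sigma> \<and> set \<sigma> \<subseteq> {1..n}} = \<Prod>{n - k + 1..n}"
    using card_lists_distinct_length_eq[of "{1..n}" k] k by auto
  also have "\<dots> = fact n"
  proof (cases "k = n")
    case False
    then have "{1..n} = insert 1 {n - k + 1..n}" using k n by auto
    then have "\<Prod>{1..n} = \<Prod>{n - k + 1..n}" using k n False by simp
    then show ?thesis by (simp add: fact_prod)
  qed (simp add: fact_prod)
  finally show ?thesis by (simp add: bar_symbols_Times card_cartesian_product card_sorted_lists)
qed

text \<open>A permutation that fixes all but at most one point is the identity.\<close>

lemma permutes_eqI_almost:
  assumes p: "p permutes {1..n}" and q: "q permutes {1..n}" and "n - 1 \<le> card T" "T \<subseteq> {1..n}"
    and eq: "\<And>i. i \<in> T \<Longrightarrow> p i = q i"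
  shows "p = (q :: nat \<Rightarrow> nat)"
proof
  let ?r = "inv' q \<circ> p"
  have r: "?r permutes {1..n}" using permutes_compose[OF p permutes_inv[OF q]] .
  have fixT: "?r i = i" if "i \<in> T" for i using eq[OF that] permutes_inverses(2)[OF q] by simp
  have "card ({1..n} - T) \<le> 1" using assms(3,4) by (simp add: card_Diff_subset finite_subset)
  then have one: "i = j" if "i \<in> {1..n} - T" "j \<in> {1..n} - T" for i j
    using that by (metis card_le_Suc0_iff_eq finite_Diff finite_atLeastAtMost One_nat_def)
  have "?r i = i" for i
  proof (cases "i \<in> {1..n} - T")
    case True
    have "?r i \<notin> T"
    proof
      assume "?r i \<in> T"
      then have "?r (?r i) = ?r i" by (rule fixT)
      then have "?r i = i" using permutes_inj[OF r] by (meson injD)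
      then show False using True \<open>?r i \<in> T\<close> by simp
    qed
    moreover have "?r i \<in> {1..n}" using True permutes_in_image[OF r] by blast
    ultimately show ?thesis using one True by blast
  next
    case False
    then show ?thesis using fixT permutes_not_in[OF r] by blast
  qed
  then show "p i = q i" for i using permutes_inverses(1)[OF q] by (metis comp_apply)
qed

lemma bar_symbols_permute:
  assumes p: "p permutes {1..n}" and w: "(\<sigma>, \<beta>) \<in> bar_symbols n g k"
  shows "(map p \<sigma>, \<beta>) \<in> bar_symbols n g k"
proof -
  have "distinct (map p \<sigma>)"
    using w inj_on_subset[OF permutes_inj[OF p] subset_UNIV] by (simp add: bar_symbols_iff distinct_map)
  moreover have "p ` set \<sigma> \<subseteq> {1..n}" using w permutes_in_image[OF p] by (force simp: bar_symbols_iff)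
  ultimately show ?thesis using w by (simp add: bar_symbols_iff)
qed

lemma map_permutes_eq_imp:
  assumes p: "p permutes {1..n}" and q: "q permutes {1..n}" and w: "(\<sigma>, \<beta>) \<in> bar_symbols n g k"
    and k: "n - 1 \<le> k" and eq: "map p \<sigma> = map q \<sigma>"
  shows "p = q"
proof (rule permutes_eqI_almost[OF p q])
  show "n - 1 \<le> card (set \<sigma>)" "set \<sigma> \<subseteq> {1..n}" using w k by (auto simp: bar_symbols_iff distinct_card)
qed (use eq in auto)

text \<open>The action on symbols is free, and an orbit is determined by the list of petals. Each orbit has a
  representative with the labels in their natural order. The labelling \<open>b\<close> is injective because the
  action is free, and it is onto because both sides have the same number of elements.\<close>

lemma exists_orbit_labelling:
  assumes n: "1 \<le> n" and k: "k \<in> {n - 1, n}"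
  shows "\<exists>b. bij_betw b ({..<(k + g - 1) choose k} \<times> carrier (sym_group n)) (bar_symbols n g k) \<and>
    (\<forall>j<(k + g - 1) choose k. \<forall>s\<in>carrier (sym_group n). \<forall>t\<in>carrier (sym_group n).
       b (j, s \<circ> t) = (map s (fst (b (j, t))), snd (b (j, t))))"
proof -
  obtain f where f: "bij_betw f {..<(k + g - 1) choose k} (sorted_lists k g)"
    using ex_bij_betw_nat_finite[OF finite_sorted_lists[of k g]] by (auto simp: card_sorted_lists atLeast0LessThan)
  define b :: "nat \<times> (nat \<Rightarrow> nat) \<Rightarrow> nat list \<times> nat list" where "b = (\<lambda>(j, s). (map s [1..<Suc k], f j))"
  let ?I = "{..<(k + g - 1) choose k} \<times> carrier (sym_group n)"
  have f_in: "f j \<in> sorted_lists k g" if "j < (k + g - 1) choose k" for j using f that by (auto simp: bij_betw_def)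
  have idw: "([1..<Suc k], f j) \<in> bar_symbols n g k" if "j < (k + g - 1) choose k" for j
    using f_in[OF that] k n by (auto simp: bar_symbols_iff sorted_lists_def simp del: upt_Suc)
  have sub: "b ` ?I \<subseteq> bar_symbols n g k"
    using bar_symbols_permute[OF _ idw] by (auto simp: b_def sym_group_carrier simp del: upt_Suc)
  have inj: "inj_on b ?I"
  proof (rule inj_onI)
    fix x y assume x: "x \<in> ?I" and y: "y \<in> ?I" and "b x = b y"
    obtain j s where xj: "x = (j, s)" by force
    obtain i t where yi: "y = (i, t)" by force
    have "map s [1..<Suc k] = map t [1..<Suc k]" "f j = f i"
      using \<open>b x = b y\<close> by (simp_all add: xj yi b_def del: upt_Suc)
    moreover have "s = t"
    proof (rule map_permutes_eq_imp)
      show "s permutes {1..n}" "t permutes {1..n}" "n - 1 \<le> k" "([1..<Suc k], f j) \<in> bar_symbols n g k"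
        using x y k idw by (auto simp: xj yi sym_group_carrier simp del: upt_Suc)
    qed fact
    moreover have "j = i" using \<open>f j = f i\<close> f x y by (auto simp: xj yi bij_betw_def inj_on_def)
    ultimately show "x = y" by (simp add: xj yi)
  qed
  have "card (carrier (sym_group n)) = fact n"
    using card_permutations[of "{1..n}" n] by (simp add: sym_group_def)
  then have "card (b ` ?I) = card (bar_symbols n g k)"
    using card_image[OF inj] card_bar_symbols[OF n k, of g] by (simp add: card_cartesian_product)
  then have "b ` ?I = bar_symbols n g k"
    using sub finite_bar_symbols by (intro card_subset_eq) auto
  then have "bij_betw b ?I (bar_symbols n g k)" using inj by (simp add: bij_betw_def)
  then show ?thesis by (intro exI[of _ b]) (auto simp: b_def)
qed

section \<open>The action on compactified configurations\<close>

definition relabel :: "nat \<Rightarrow> (nat \<Rightarrow> nat) \<Rightarrow> (nat \<Rightarrow> 'a) \<Rightarrow> nat \<Rightarrow> 'a"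
  where "relabel n p x = (\<lambda>i\<in>{1..n}. x (inv' p i))"

lemma conf_act_eq: "conf_act n p = map_option (relabel n p)"
  by (simp add: conf_act_def relabel_def[abs_def])

lemma conf_act_None [simp]: "conf_act n p None = None"
  and conf_act_Some [simp]: "conf_act n p (Some x) = Some (relabel n p x)"
  by (simp_all add: conf_act_eq)

lemma relabel_apply: "i \<in> {1..n} \<Longrightarrow> relabel n p x i = x (inv' p i)"
  by (simp add: relabel_def)

lemma relabel_compose:
  assumes p: "p permutes {1..n}" and q: "q permutes {1..n}"
  shows "relabel n p (relabel n q x) = relabel n (p \<circ> q) x"
proof
  fix i
  have "inv' p i \<in> {1..n}" if "i \<in> {1..n}" using permutes_in_image[OF permutes_inv[OF p]] that by blast
  moreover have "inv' (p \<circ> q) = inv' q \<circ> inv' p" using p q by (simp add: o_inv_distrib permutes_bij)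
  ultimately show "relabel n p (relabel n q x) i = relabel n (p \<circ> q) x i"
    by (simp add: relabel_def)
qed

lemma relabel_id: "x \<in> extensional {1..n} \<Longrightarrow> relabel n id x = x"
  by (auto simp: relabel_def extensional_def fun_eq_iff)

lemma relabel_inj:
  assumes p: "p permutes {1..n}"
  shows "inj_on (relabel n p x) {1..n} \<longleftrightarrow> inj_on x {1..n}"
proof -
  have "bij_betw (inv' p) {1..n} {1..n}" using permutes_imp_bij[OF permutes_inv[OF p]] .
  then have "inj_on (x \<circ> inv' p) {1..n} \<longleftrightarrow> inj_on x {1..n}"
    using comp_inj_on_iff[of "inv' p" "{1..n}" x] by (simp add: bij_betw_def)
  moreover have "inj_on (relabel n p x) {1..n} \<longleftrightarrow> inj_on (x \<circ> inv' p) {1..n}"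
    by (rule inj_on_cong) (simp add: relabel_def)
  ultimately show ?thesis by simp
qed

lemma continuous_map_relabel:
  assumes p: "p permutes {1..n}"
  shows "continuous_map (Conf n X) (Conf n X) (relabel n p)"
proof -
  let ?P = "product_topology (\<lambda>i. X) {1..n}"
  have "continuous_map (Conf n X) ?P (relabel n p)"
    unfolding continuous_map_componentwise
  proof (intro conjI ballI)
    fix i assume i: "i \<in> {1..n}"
    then have "inv' p i \<in> {1..n}" using permutes_in_image[OF permutes_inv[OF p]] by blast
    then have "continuous_map (Conf n X) X (\<lambda>x. x (inv' p i))"
      unfolding Conf_def by (intro continuous_map_from_subtopology continuous_map_product_projection)
    then show "continuous_map (Conf n X) X (\<lambda>x. relabel n p x i)" using i by (simp add: relabel_def)
  qed (auto simp: relabel_def)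
  then show ?thesis
    unfolding Conf_def continuous_map_in_subtopology using relabel_inj[OF p] by auto
qed

lemma homeomorphic_maps_relabel:
  assumes p: "p permutes {1..n}"
  shows "homeomorphic_maps (Conf n X) (Conf n X) (relabel n p) (relabel n (inv' p))"
  unfolding homeomorphic_maps_def
  using continuous_map_relabel[OF p] continuous_map_relabel[OF permutes_inv[OF p]]
  by (auto simp: topspace_Conf PiE_iff relabel_id relabel_compose[OF p permutes_inv[OF p]]
      relabel_compose[OF permutes_inv[OF p] p] permutes_inv_o[OF p])

text \<open>A homeomorphism pulls compact closed sets back to compact closed sets, so it extends continuously by
  \<open>\<infinity> \<mapsto> \<infinity>\<close>.\<close>

lemma continuous_map_Alexandroff:
  assumes "homeomorphic_maps X Y f f'"
  shows "continuous_map (Alexandroff_compactification X) (Alexandroff_compactification Y) (map_option f)"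
proof -
  have f: "continuous_map X Y f" and f': "continuous_map Y X f'"
    and ff': "\<And>x. x \<in> topspace X \<Longrightarrow> f' (f x) = x" "\<And>y. y \<in> topspace Y \<Longrightarrow> f (f' y) = y"
    using assms by (auto simp: homeomorphic_maps_def)
  have fX: "f x \<in> topspace Y" if "x \<in> topspace X" for x using f that by (auto simp: continuous_map_def)
  have f'Y: "f' y \<in> topspace X" if "y \<in> topspace Y" for y using f' that by (auto simp: continuous_map_def)
  show ?thesis
    unfolding continuous_map
  proof (intro conjI allI impI)
    show "map_option f ` topspace (Alexandroff_compactification X) \<subseteq> topspace (Alexandroff_compactification Y)"
      using fX by auto
    fix U assume "openin (Alexandroff_compactification Y) U"
    then consider V where "openin Y V" "U = Some ` V"
      | K where "compactin Y K" "closedin Y K" "U = insert None (Some ` (topspace Y - K))"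
      unfolding openin_Alexandroff_compactification by blast
    then show "openin (Alexandroff_compactification X) {x \<in> topspace (Alexandroff_compactification X). map_option f x \<in> U}"
    proof cases
      case 1
      have "{x \<in> topspace (Alexandroff_compactification X). map_option f x \<in> U} = Some ` {x \<in> topspace X. f x \<in> V}"
        by (auto simp: 1(2))
      moreover have "openin X {x \<in> topspace X. f x \<in> V}" using f 1(1) by (auto simp: continuous_map_def)
      ultimately show ?thesis by simp
    next
      case 2
      have K: "K \<subseteq> topspace Y" using 2(2) closedin_subset by blast
      let ?L = "{x \<in> topspace X. f x \<in> K}"
      have "?L = f' ` K"
      proof (intro equalityI subsetI)
        fix x assume "x \<in> ?L"
        then show "x \<in> f' ` K" using ff'(1)[of x] by (intro image_eqI[of _ _ "f x"]) auto
      next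
        fix x assume "x \<in> f' ` K"
        then obtain y where "y \<in> K" "x = f' y" by blast
        then show "x \<in> ?L" using K f'Y[of y] ff'(2)[of y] by auto
      qed
      then have "compactin X ?L" using image_compactin[OF 2(1) f'] by simp
      moreover have "closedin X ?L" by (rule closedin_continuous_map_preimage[OF f 2(2)])
      moreover have "{x \<in> topspace (Alexandroff_compactification X). map_option f x \<in> U}
          = insert None (Some ` (topspace X - ?L))"
        using fX by (auto simp: 2(3))
      ultimately show ?thesis unfolding openin_Alexandroff_compactification by blast
    qed
  qed
qed

lemma continuous_map_conf_act:
  "p permutes {1..n} \<Longrightarrow> continuous_map (Conf_plus n X) (Conf_plus n X) (conf_act n p)"
  unfolding conf_act_eq by (rule continuous_map_Alexandroff[OF homeomorphic_maps_relabel])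

lemma conf_act_compose:
  "p permutes {1..n} \<Longrightarrow> q permutes {1..n} \<Longrightarrow> conf_act n p (conf_act n q c) = conf_act n (p \<circ> q) c"
  by (cases c) (simp_all add: relabel_compose)

section \<open>The cell structure\<close>

lemma (in attached_cells) cell_homeo:
  assumes "w \<in> W"
  shows "homeomorphic_map (subtopology (disc k) (open_unit_disc k)) (subtopology X (cell w)) (\<Phi> w)"
proof -
  have "topspace X - rest {w} = cell w"
    using cell_subset[OF assms] by (auto simp: rest_def)
  then show ?thesis using attached_cell.homeo[OF single_cell[OF assms]] by simp
qed

context rose_config
begin

text \<open>The union of \<open>\<infinity>\<close> and the \<open>(n - 1)\<close>-cells, described without reference to cells as the set of
  configurations that occupy the vertex. This form makes it visibly closed.\<close>

definition skeleton :: "(nat \<Rightarrow> (nat \<times> complex) option) option set"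
  where "skeleton = {c \<in> topspace X. \<forall>x. c = Some x \<longrightarrow> (\<exists>s\<in>{1..n}. x s = None)}"

lemma None_in_skeleton: "None \<in> skeleton" by (simp add: skeleton_def)

lemma skeleton_subset: "skeleton \<subseteq> topspace X" by (auto simp: skeleton_def)

lemma closed_skeleton: "closedin X skeleton"
proof -
  have "closedin (Conf n (rose g)) {x \<in> topspace (Conf n (rose g)). x s \<in> {None}}" if "s \<in> {1..n}" for s
  proof (rule closedin_continuous_map_preimage)
    show "continuous_map (Conf n (rose g)) (rose g) (\<lambda>x. x s)"
      unfolding Conf_def by (intro continuous_map_from_subtopology continuous_map_product_projection that)
    show "closedin (rose g) {None}"
      using vertex_in_rose[OF g] Hausdorff_space_rose by (simp add: closedin_Hausdorff_sing_eq)
  qed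
  then have "closedin (Conf n (rose g)) (\<Union>s\<in>{1..n}. {x \<in> topspace (Conf n (rose g)). x s \<in> {None}})"
    by (intro closedin_Union) auto
  then have "openin (Conf n (rose g)) (topspace (Conf n (rose g)) - (\<Union>s\<in>{1..n}. {x \<in> topspace (Conf n (rose g)). x s \<in> {None}}))"
    by (rule openin_diff[OF openin_topspace])
  then have "openin X (Some ` (topspace (Conf n (rose g)) - (\<Union>s\<in>{1..n}. {x \<in> topspace (Conf n (rose g)). x s \<in> {None}})))"
    by simp
  moreover have "skeleton = topspace X - Some ` (topspace (Conf n (rose g)) - (\<Union>s\<in>{1..n}. {x \<in> topspace (Conf n (rose g)). x s \<in> {None}}))"
    unfolding skeleton_def by auto
  ultimately show ?thesis by (simp only: closedin_diff[OF closedin_topspace])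
qed

lemma char_map_topspace:
  assumes "(\<sigma>, \<beta>) \<in> bar_symbols n g k" "y \<in> unit_disc k"
  shows "char_map (\<sigma>, \<beta>) y \<in> topspace X"
  using subsetD[OF continuous_map_image_subset_topspace[OF continuous_map_char[OF assms(1)]]] assms(2) by simp

lemma symbol_cell_topspace:
  assumes w: "(\<sigma>, \<beta>) \<in> bar_symbols n g k" "n - 1 \<le> k"
  shows "symbol_cell n g h (\<sigma>, \<beta>) \<subseteq> topspace X"
  using char_map_topspace[OF w(1)] open_subset_disc[of k] unfolding char_map_image[OF w, symmetric] by blast

lemma symbol_cell_nonempty:
  assumes w: "(\<sigma>, \<beta>) \<in> bar_symbols n g k" "n - 1 \<le> k"
  shows "symbol_cell n g h (\<sigma>, \<beta>) \<noteq> {}"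
proof -
  have "(\<lambda>_. 0) \<in> open_unit_disc k" by (simp add: mem_open_unit_disc nrm_def)
  then show ?thesis unfolding char_map_image[OF w, symmetric] by blast
qed

lemma top_cells_union: "\<Union>(symbol_cells n g h n) = topspace X - skeleton"
proof (intro equalityI subsetI)
  fix c assume "c \<in> \<Union>(symbol_cells n g h n)"
  then obtain \<sigma> \<beta> where w: "(\<sigma>, \<beta>) \<in> bar_symbols n g n" and c: "c \<in> symbol_cell n g h (\<sigma>, \<beta>)"
    by (auto simp: symbol_cells_def)
  have "set \<sigma> = {1..n}" using w by (intro card_subset_eq) (auto simp: bar_symbols_iff distinct_card)
  moreover obtain x where "c = Some x" "\<And>s. s \<in> {1..n} \<Longrightarrow> x s = None \<longleftrightarrow> s \<notin> set \<sigma>"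
    using symbol_cell_support[OF w c] by blast
  ultimately show "c \<in> topspace X - skeleton"
    using subsetD[OF symbol_cell_topspace[OF w] c] unfolding skeleton_def by simp
next
  fix c assume "c \<in> topspace X - skeleton"
  then obtain x where x: "c = Some x" "\<forall>s\<in>{1..n}. x s \<noteq> None" "x \<in> topspace (Conf n (rose g))"
    unfolding skeleton_def by auto
  then have "{s \<in> {1..n}. x s \<noteq> None} = {1..n}" by blast
  then have "\<exists>\<sigma> \<beta>. (\<sigma>, \<beta>) \<in> bar_symbols n g n \<and> Some x \<in> symbol_cell n g h (\<sigma>, \<beta>)"
    using symbol_cover[OF x(3)] by auto
  then show "c \<in> \<Union>(symbol_cells n g h n)" using x(1) unfolding symbol_cells_def by blast
qed

lemma low_cells_union: "\<Union>(symbol_cells n g h (n - 1)) = skeleton - {None}"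
proof (intro equalityI subsetI)
  fix c assume "c \<in> \<Union>(symbol_cells n g h (n - 1))"
  then obtain \<sigma> \<beta> where w: "(\<sigma>, \<beta>) \<in> bar_symbols n g (n - 1)" and c: "c \<in> symbol_cell n g h (\<sigma>, \<beta>)"
    by (auto simp: symbol_cells_def)
  have "card (set \<sigma>) = n - 1" using w by (auto simp: bar_symbols_iff distinct_card)
  then have "\<not> {1..n} \<subseteq> set \<sigma>" using n card_mono[of "set \<sigma>" "{1..n}"] by auto
  then obtain s where "s \<in> {1..n}" "s \<notin> set \<sigma>" by blast
  moreover obtain x where "c = Some x" "\<And>s. s \<in> {1..n} \<Longrightarrow> x s = None \<longleftrightarrow> s \<notin> set \<sigma>"
    using symbol_cell_support[OF w c] by blast
  ultimately show "c \<in> skeleton - {None}"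
    using subsetD[OF symbol_cell_topspace[OF w] c] unfolding skeleton_def by auto
next
  fix c assume "c \<in> skeleton - {None}"
  then obtain x s where x: "c = Some x" "s \<in> {1..n}" "x s = None" "x \<in> topspace (Conf n (rose g))"
    unfolding skeleton_def by auto
  have "{s \<in> {1..n}. x s \<noteq> None} = {1..n} - {s}"
  proof -
    have "inj_on x {1..n}" using x(4) by (simp add: topspace_Conf)
    then have "i = s" if "i \<in> {1..n}" "x i = None" for i using that x(2,3) inj_onD by metis
    then show ?thesis using x(3) by blast
  qed
  then have "card {s \<in> {1..n}. x s \<noteq> None} = n - 1" using x(2) by simp
  then have "\<exists>\<sigma> \<beta>. (\<sigma>, \<beta>) \<in> bar_symbols n g (n - 1) \<and> Some x \<in> symbol_cell n g h (\<sigma>, \<beta>)"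
    using symbol_cover[OF x(4)] by auto
  then show "c \<in> \<Union>(symbol_cells n g h (n - 1))" using x(1) unfolding symbol_cells_def by blast
qed

lemma sphere_in_skeleton:
  assumes w: "(\<sigma>, \<beta>) \<in> bar_symbols n g k" and y: "y \<in> unit_sphere k"
  shows "char_map (\<sigma>, \<beta>) y \<in> skeleton"
proof -
  have t: "char_map (\<sigma>, \<beta>) y \<in> topspace X" using char_map_topspace[OF w] y sphere_subset_disc[of k] by blast
  have "set \<sigma> \<subseteq> {1..n}" using w by (simp add: bar_symbols_iff)
  then show ?thesis using char_map_sphere[OF w y] t unfolding skeleton_def by auto
qed

text \<open>The missing label sits at the vertex, so a second point that reaches the vertex collides with it.\<close>

lemma low_sphere_to_None:
  assumes w: "(\<sigma>, \<beta>) \<in> bar_symbols n g (n - 1)" and y: "y \<in> unit_sphere (n - 1)"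
  shows "char_map (\<sigma>, \<beta>) y = None"
proof (rule ccontr)
  assume "char_map (\<sigma>, \<beta>) y \<noteq> None"
  then obtain x s where x: "char_map (\<sigma>, \<beta>) y = Some x" "s \<in> set \<sigma>" "x s = None"
    using char_map_sphere[OF w y] by auto
  have "card (set \<sigma>) = n - 1" using w by (auto simp: bar_symbols_iff distinct_card)
  then have "\<not> {1..n} \<subseteq> set \<sigma>" using n card_mono[of "set \<sigma>" "{1..n}"] by auto
  then obtain s' where s': "s' \<in> {1..n}" "s' \<notin> set \<sigma>" by blast
  have "x s' = None" using x(1) s' by (auto simp: char_map_def collapse_def config_def split: if_splits)
  moreover have "inj_on x {1..n}" using x(1) by (auto simp: char_map_def collapse_def split: if_splits)
  moreover have "s \<in> {1..n}" using x(2) w by (auto simp: bar_symbols_iff)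
  ultimately have "s = s'" using x(3) s'(1) by (metis inj_onD)
  then show False using x(2) s'(2) by simp
qed

lemma char_map_disjoint:
  assumes "w \<in> bar_symbols n g k" "v \<in> bar_symbols n g k" "w \<noteq> v" "n - 1 \<le> k"
  shows "char_map w ` open_unit_disc k \<inter> char_map v ` open_unit_disc k = {}"
proof -
  obtain \<sigma> \<beta> where w: "w = (\<sigma>, \<beta>)" by force
  obtain \<sigma>' \<beta>' where v: "v = (\<sigma>', \<beta>')" by force
  show ?thesis
    using symbol_unique[of \<sigma> \<beta> k \<sigma>' \<beta>' k] assms
      char_map_image[of \<sigma> \<beta> k] char_map_image[of \<sigma>' \<beta>' k] unfolding w v by auto
qed

lemma char_map_union:
  assumes "n - 1 \<le> k"
  shows "(\<Union>w\<in>bar_symbols n g k. char_map w ` open_unit_disc k) = \<Union>(symbol_cells n g h k)"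
proof -
  have "char_map w ` open_unit_disc k = symbol_cell n g h w" if "w \<in> bar_symbols n g k" for w
    using char_map_image[OF _ assms] that by (cases w) simp
  then have "(\<Union>w\<in>bar_symbols n g k. char_map w ` open_unit_disc k) = (\<Union>w\<in>bar_symbols n g k. symbol_cell n g h w)"
    by (intro SUP_cong refl)
  then show ?thesis unfolding symbol_cells_def by (simp only:)
qed

lemma top_cells: "attached_cells X skeleton n (bar_symbols n g n) char_map"
proof
  show "(\<Union>w\<in>bar_symbols n g n. char_map w ` open_unit_disc n) = topspace X - skeleton"
    using char_map_union[of n] top_cells_union by simp
  fix w assume "w \<in> bar_symbols n g n"
  moreover obtain \<sigma> \<beta> where "w = (\<sigma>, \<beta>)" by force
  ultimately show "continuous_map (disc n) X (char_map w)" "inj_on (char_map w) (open_unit_disc n)"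
    "char_map w ` unit_sphere n \<subseteq> skeleton"
    using continuous_map_char char_map_inj sphere_in_skeleton by auto
qed (simp_all add: Hausdorff_Conf_plus closed_skeleton finite_bar_symbols char_map_disjoint)

lemma low_char_map_in_skeleton:
  assumes "(\<sigma>, \<beta>) \<in> bar_symbols n g (n - 1)" "y \<in> unit_disc (n - 1)"
  shows "char_map (\<sigma>, \<beta>) y \<in> skeleton"
proof (cases "y \<in> unit_sphere (n - 1)")
  case False
  then have "y \<in> open_unit_disc (n - 1)" using assms(2) by (simp add: unit_sphere_def)
  then have "char_map (\<sigma>, \<beta>) y \<in> \<Union>(symbol_cells n g h (n - 1))"
    using char_map_image[OF assms(1) order_refl] assms(1) unfolding symbol_cells_def by blast
  then show ?thesis unfolding low_cells_union by simp
qed (rule sphere_in_skeleton[OF assms(1)])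

lemma low_cells: "attached_cells (subtopology X skeleton) {None} (n - 1) (bar_symbols n g (n - 1)) char_map"
proof
  show "(\<Union>w\<in>bar_symbols n g (n - 1). char_map w ` open_unit_disc (n - 1)) = topspace (subtopology X skeleton) - {None}"
    using char_map_union[of "n - 1"] low_cells_union skeleton_subset by (auto simp: Int_absorb1)
  show "Hausdorff_space (subtopology X skeleton)" by (rule Hausdorff_space_subtopology[OF Hausdorff_Conf_plus])
  then show "closedin (subtopology X skeleton) {None}"
    using None_in_skeleton by (simp add: closedin_Hausdorff_sing_eq)
  fix w assume "w \<in> bar_symbols n g (n - 1)"
  moreover obtain \<sigma> \<beta> where "w = (\<sigma>, \<beta>)" by force
  ultimately show "continuous_map (disc (n - 1)) (subtopology X skeleton) (char_map w)"
    "inj_on (char_map w) (open_unit_disc (n - 1))" "char_map w ` unit_sphere (n - 1) \<subseteq> {None}"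
    using continuous_map_char char_map_inj[of \<sigma> \<beta> "n - 1"] low_sphere_to_None low_char_map_in_skeleton
    by (auto simp: continuous_map_in_subtopology)
qed (simp_all add: finite_bar_symbols char_map_disjoint)

lemma symbol_cell_char_map:
  assumes "w \<in> bar_symbols n g k" "k \<in> {n - 1, n}"
  shows "continuous_map (disc k) X (char_map w)"
    and "homeomorphic_map (subtopology (disc k) (open_unit_disc k)) (subtopology X (symbol_cell n g h w)) (char_map w)"
proof -
  obtain \<sigma> \<beta> where w: "w = (\<sigma>, \<beta>)" by force
  show "continuous_map (disc k) X (char_map w)" using continuous_map_char assms(1) by (simp add: w)
  interpret T: attached_cells X skeleton n "bar_symbols n g n" char_map by (rule top_cells)
  interpret L: attached_cells "subtopology X skeleton" "{None}" "n - 1" "bar_symbols n g (n - 1)" char_map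
    by (rule low_cells)
  have img: "char_map w ` open_unit_disc k = symbol_cell n g h w"
  proof -
    have "n - 1 \<le> k" using assms(2) by auto
    then show ?thesis using char_map_image[of \<sigma> \<beta> k] assms(1) by (simp add: w)
  qed
  show "homeomorphic_map (subtopology (disc k) (open_unit_disc k)) (subtopology X (symbol_cell n g h w)) (char_map w)"
  proof (cases "k = n")
    case True
    then show ?thesis using T.cell_homeo[of w] assms(1) img by (simp add: T.cell_def)
  next
    case False
    then have k: "k = n - 1" using assms(2) by simp
    have "symbol_cell n g h w \<subseteq> skeleton"
      using low_cells_union assms(1) unfolding k symbol_cells_def by blast
    moreover have "L.cell w = symbol_cell n g h w" unfolding L.cell_def using img by (simp only: k)
    ultimately show ?thesis
      using L.cell_homeo[of w] assms(1) unfolding k by (simp only: subtopology_subtopology Int_absorb1)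
  qed
qed

lemma all_cells_cases:
  assumes "c \<in> all_cells n g h k"
  obtains "k = 0" "c = {None}" | w where "k \<in> {n - 1, n}" "w \<in> bar_symbols n g k" "c = symbol_cell n g h w"
  using assms unfolding all_cells_def symbol_cells_def by (auto split: if_splits)

lemma None_notin_symbol_cell: "None \<notin> symbol_cell n g h w"
  by (auto simp: symbol_cell_def)

lemma finite_all_cells: "finite (\<Union>k. all_cells n g h k)"
proof -
  have "(\<Union>k. all_cells n g h k) \<subseteq> insert {None} (symbol_cells n g h (n - 1) \<union> symbol_cells n g h n)"
    unfolding all_cells_def by (auto split: if_splits)
  then show ?thesis by (rule finite_subset) (simp add: symbol_cells_def finite_bar_symbols)
qed

lemma Union_all_cells: "(\<Union>k. \<Union>(all_cells n g h k)) = topspace X"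
proof -
  have "(\<Union>k. \<Union>(all_cells n g h k)) = {None} \<union> \<Union>(symbol_cells n g h (n - 1)) \<union> \<Union>(symbol_cells n g h n)"
  proof (intro equalityI subsetI)
    fix x assume "x \<in> (\<Union>k. \<Union>(all_cells n g h k))"
    then show "x \<in> {None} \<union> \<Union>(symbol_cells n g h (n - 1)) \<union> \<Union>(symbol_cells n g h n)"
      unfolding all_cells_def by (auto split: if_splits)
  next
    fix x assume "x \<in> {None} \<union> \<Union>(symbol_cells n g h (n - 1)) \<union> \<Union>(symbol_cells n g h n)"
    moreover have "{None} \<in> all_cells n g h 0" "symbol_cells n g h (n - 1) \<subseteq> all_cells n g h (n - 1)"
      "symbol_cells n g h n \<subseteq> all_cells n g h n" by (auto simp: all_cells_def)
    ultimately show "x \<in> (\<Union>k. \<Union>(all_cells n g h k))" by blast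
  qed
  also have "\<dots> = {None} \<union> (skeleton - {None}) \<union> (topspace X - skeleton)"
    unfolding low_cells_union top_cells_union ..
  also have "\<dots> = topspace X"
    using insert_Diff[OF None_in_skeleton] Diff_partition[OF skeleton_subset] by (simp only: insert_is_Un[symmetric] Un_insert_left Un_empty_left)
  finally show ?thesis .
qed

text \<open>There are finitely many cells, so the topology is automatically determined by their closures; the
  remaining conditions are properties of the characteristic maps.\<close>

theorem CW_decomposition_Conf_plus: "CW_decomposition X (all_cells n g h)"
  unfolding CW_decomposition_def
proof (intro conjI allI ballI impI)
  show "Hausdorff_space X" by (rule Hausdorff_Conf_plus)
  show "(\<Union>k. \<Union>(all_cells n g h k)) = topspace X" by (rule Union_all_cells)
next
  fix k l c d assume c: "c \<in> all_cells n g h k" and d: "d \<in> all_cells n g h l" and cd: "c \<inter> d \<noteq> {}"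
  have "k = l \<and> c = d" 
    using c
  proof (cases rule: all_cells_cases)
    case 1
    with d cd show ?thesis by (cases rule: all_cells_cases) (auto simp: None_notin_symbol_cell)
  next
    case (2 w)
    note w = this
    from d show ?thesis
    proof (cases rule: all_cells_cases)
      case 1
      then show ?thesis using w cd None_notin_symbol_cell by auto
    next
      case (2 v)
      obtain \<sigma> \<beta> where ws: "w = (\<sigma>, \<beta>)" by force
      obtain \<sigma>' \<beta>' where vs: "v = (\<sigma>', \<beta>')" by force
      obtain e where "e \<in> symbol_cell n g h w" "e \<in> symbol_cell n g h v" using cd w 2 by blast
      then have "w = v" using symbol_unique[of \<sigma> \<beta> k \<sigma>' \<beta>' l] w 2 by (simp add: ws vs)
      then show ?thesis using w 2 by (auto simp: ws bar_symbols_iff)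
    qed
  qed
  then show "k = l" "c = d" by auto
next
  fix k c assume c: "c \<in> all_cells n g h k"
  then show "\<exists>\<Phi>. continuous_map (subtopology (Euclidean_space k) (unit_disc k)) X \<Phi> \<and>
       homeomorphic_map (subtopology (Euclidean_space k) (open_unit_disc k)) (subtopology X c) \<Phi> \<and>
       (\<exists>F. finite F \<and> F \<subseteq> (\<Union>j<k. all_cells n g h j) \<and> \<Phi> ` (unit_disc k - open_unit_disc k) \<subseteq> \<Union>F)"
  proof (cases rule: all_cells_cases)
    case 1
    have o: "open_unit_disc 0 = {\<lambda>_. 0}" by (auto simp: mem_open_unit_disc nrm_def)
    have "homeomorphic_map (subtopology (disc 0) (open_unit_disc 0)) (subtopology X {None}) (\<lambda>_. None)"
    proof (rule continuous_imp_homeomorphic_map)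
      show "compact_space (subtopology (disc 0) (open_unit_disc 0))"
        unfolding o using unit_disc_0 by (intro compact_space_subtopology) simp
      show "Hausdorff_space (subtopology X {None})" by (rule Hausdorff_space_subtopology[OF Hausdorff_Conf_plus])
    qed (auto simp: o unit_disc_0)
    moreover have "continuous_map (disc 0) X (\<lambda>_. None)" by simp
    ultimately show ?thesis
      unfolding 1 disc_def[symmetric] subtopology_disc_open[symmetric] unit_sphere_def[symmetric]
      by (intro exI[of _ "\<lambda>_. None"] conjI exI[of _ "{}"]) (simp_all add: unit_sphere_0)
  next
    case (2 w)
    obtain \<sigma> \<beta> where w: "w = (\<sigma>, \<beta>)" by force
    have b: "(\<sigma>, \<beta>) \<in> bar_symbols n g k" using 2 w by simp
    have "\<exists>F. finite F \<and> F \<subseteq> (\<Union>j<k. all_cells n g h j) \<and> char_map w ` unit_sphere k \<subseteq> \<Union>F"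
    proof (cases "k = n")
      case True
      (* For \<open>n = 1\<close> the point at infinity and the cells of dimension \<open>n - 1\<close> all have dimension 0. *)
      let ?F = "insert {None} (symbol_cells n g h (n - 1))"
      have F: "{None} \<in> all_cells n g h 0" "symbol_cells n g h (n - 1) \<subseteq> all_cells n g h (n - 1)"
        by (auto simp: all_cells_def)
      moreover have "0 < k" "n - 1 < k" using True n by auto
      ultimately have "?F \<subseteq> (\<Union>j<k. all_cells n g h j)" by blast
      moreover have "\<Union>?F = skeleton" using low_cells_union None_in_skeleton by auto
      moreover have "char_map w ` unit_sphere k \<subseteq> skeleton" using sphere_in_skeleton[OF b] w by auto
      moreover have "finite ?F" by (simp add: symbol_cells_def finite_bar_symbols)
      ultimately show ?thesis by (intro exI[of _ ?F]) simp
    next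
      case False
      then have k: "k = n - 1" using 2 by simp
      show ?thesis
      proof (cases "k = 0")
        case True
        then show ?thesis by (intro exI[of _ "{}"]) (simp add: unit_sphere_0)
      next
        case False
        then have "{{None}} \<subseteq> (\<Union>j<k. all_cells n g h j)" by (auto simp: all_cells_def intro!: bexI[of _ 0])
        moreover have "char_map w ` unit_sphere k \<subseteq> \<Union>{{None}}"
          using low_sphere_to_None b unfolding k w by auto
        ultimately show ?thesis by (intro exI[of _ "{{None}}"]) simp
      qed
    qed
    then show ?thesis
      using symbol_cell_char_map[OF 2(2,1)]
      unfolding 2(3) disc_def[symmetric] subtopology_disc_open[symmetric] unit_sphere_def[symmetric]
      by (intro exI[of _ "char_map w"] conjI)
  qed
next
  fix A assume A: "A \<subseteq> topspace X"
    and cl: "\<forall>k. \<forall>c\<in>all_cells n g h k. closedin X (A \<inter> Abstract_Topology.closure_of X c)"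
  have "A = (\<Union>c\<in>(\<Union>k. all_cells n g h k). A \<inter> Abstract_Topology.closure_of X c)"
  proof (intro equalityI subsetI)
    fix x assume x: "x \<in> A"
    then have "x \<in> (\<Union>k. \<Union>(all_cells n g h k))" unfolding Union_all_cells using A by blast
    then obtain k c where c: "c \<in> all_cells n g h k" "x \<in> c" by blast
    then have "c \<subseteq> topspace X" using Union_all_cells by blast
    then have "x \<in> Abstract_Topology.closure_of X c" using c(2) closure_of_subset by blast
    then show "x \<in> (\<Union>c\<in>(\<Union>k. all_cells n g h k). A \<inter> Abstract_Topology.closure_of X c)" using c(1) x by blast
  qed blast
  moreover have "closedin X (\<Union>c\<in>(\<Union>k. all_cells n g h k). A \<inter> Abstract_Topology.closure_of X c)"
    using finite_all_cells cl by (intro closedin_Union) auto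
  ultimately show "closedin X A" by simp
qed

section \<open>The action on cells\<close>

text \<open>The polytope and its parametrisation depend on the petals only, which relabelling leaves unchanged.
  So the action permutes the characteristic maps themselves, without any reparametrisation of discs.\<close>

lemma char_map_permute:
  assumes p: "p permutes {1..n}" and w: "(\<sigma>, \<beta>) \<in> bar_symbols n g k"
  shows "conf_act n p (char_map (\<sigma>, \<beta>) y) = char_map (map p \<sigma>, \<beta>) y"
proof -
  let ?t = "slot_point k ((!) \<beta>) y"
  have W: "length \<sigma> = k" "distinct \<sigma>" using w by (auto simp: bar_symbols_iff)
  have "config (map p \<sigma>) ?t = relabel n p (config \<sigma> ?t)"
  proof
    fix i show "config (map p \<sigma>) ?t i = relabel n p (config \<sigma> ?t) i"
    proof (cases "i \<in> {1..n}")
      case True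
      define j where "j = inv' p i"
      have j: "j \<in> {1..n}" "i = p j"
        using True permutes_in_image[OF permutes_inv[OF p]] permutes_inverses(1)[OF p] by (auto simp: j_def)
      have "relabel n p (config \<sigma> ?t) i = config \<sigma> ?t j" using True by (simp add: relabel_apply j_def)
      moreover have "p j \<in> set (map p \<sigma>) \<longleftrightarrow> j \<in> set \<sigma>" using permutes_inj[OF p] by (auto dest: injD)
      then have "config (map p \<sigma>) ?t i = config \<sigma> ?t j"
        using True j(1) pos_map[OF permutes_inj[OF p] W(2), of j]
        unfolding j(2) by (simp add: config_def)
      ultimately show ?thesis by simp
    next
      case False
      then show ?thesis unfolding config_def relabel_def by (simp only: restrict_apply if_False)
    qed
  qed
  then show ?thesis
    using W(1) relabel_inj[OF p, of "config \<sigma> ?t"] by (simp add: char_map_def collapse_def)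
qed

lemma symbol_cell_permute:
  assumes p: "p permutes {1..n}" and w: "(\<sigma>, \<beta>) \<in> bar_symbols n g k" "n - 1 \<le> k"
  shows "conf_act n p ` symbol_cell n g h (\<sigma>, \<beta>) = symbol_cell n g h (map p \<sigma>, \<beta>)"
  using char_map_permute[OF p w(1)]
  unfolding char_map_image[OF w, symmetric] char_map_image[OF bar_symbols_permute[OF p w(1)] w(2), symmetric]
  by (simp add: image_image)

lemma symbol_cell_inj:
  assumes "w \<in> bar_symbols n g k" "v \<in> bar_symbols n g k" "n - 1 \<le> k" "symbol_cell n g h w = symbol_cell n g h v"
  shows "w = v"
proof -
  obtain \<sigma> \<beta> where w: "w = (\<sigma>, \<beta>)" by force
  obtain \<sigma>' \<beta>' where v: "v = (\<sigma>', \<beta>')" by force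
  obtain c where "c \<in> symbol_cell n g h (\<sigma>, \<beta>)" using symbol_cell_nonempty[of \<sigma> \<beta> k] assms(1,3) by (auto simp: w)
  then show ?thesis using symbol_unique[of \<sigma> \<beta> k \<sigma>' \<beta>' k c] assms by (simp add: w v)
qed

lemma symbol_cell_bij: "n - 1 \<le> k \<Longrightarrow> bij_betw (symbol_cell n g h) (bar_symbols n g k) (symbol_cells n g h k)"
  unfolding symbol_cells_def by (intro bij_betw_imageI inj_onI symbol_cell_inj) auto

lemma card_symbol_cells:
  "k \<in> {n - 1, n} \<Longrightarrow> card (symbol_cells n g h k) = fact n * ((k + g - 1) choose k)"
  using bij_betw_same_card[OF symbol_cell_bij[of k]] card_bar_symbols[OF n, of k g] by auto

lemma cells_action:
  assumes k: "k \<in> {n - 1, n}"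
  defines "E \<equiv> symbol_cells n g h k"
  defines "\<phi> \<equiv> \<lambda>p. \<lambda>c\<in>E. conf_act n p ` c"
  shows "group_action (sym_group n) E \<phi>"
    and "c \<in> E \<Longrightarrow> stabilizer (sym_group n) \<phi> c = {\<one>\<^bsub>sym_group n\<^esub>}"
proof -
  have k1: "n - 1 \<le> k" using k by auto
  have E: "\<exists>\<sigma> \<beta>. (\<sigma>, \<beta>) \<in> bar_symbols n g k \<and> c = symbol_cell n g h (\<sigma>, \<beta>)" if "c \<in> E" for c
    using that by (auto simp: E_def symbol_cells_def)
  have cl: "conf_act n p ` c \<in> E" if "p permutes {1..n}" "c \<in> E" for p c
    using E[OF that(2)] symbol_cell_permute[OF that(1) _ k1] bar_symbols_permute[OF that(1)]
    by (auto simp: E_def symbol_cells_def)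
  have comp: "conf_act n p ` conf_act n q ` c = conf_act n (p \<circ> q) ` c" if "p permutes {1..n}" "q permutes {1..n}" for p q c
    by (simp add: image_image conf_act_compose[OF that])
  have one: "conf_act n id ` c = c" if "c \<in> E" for c
    using E[OF that] symbol_cell_permute[OF permutes_id _ k1] by auto
  have Bij: "\<phi> p \<in> Bij E" if p: "p permutes {1..n}" for p
  proof -
    note p' = permutes_inv[OF p]
    have "bij_betw (\<lambda>c. conf_act n p ` c) E E"
    proof (rule bij_betw_byWitness[where f'="\<lambda>c. conf_act n (inv' p) ` c"]; intro ballI image_subsetI)
      fix c assume c: "c \<in> E"
      show "conf_act n p ` c \<in> E" "conf_act n (inv' p) ` c \<in> E" using cl p p' c by simp_all
      show "conf_act n (inv' p) ` conf_act n p ` c = c" "conf_act n p ` conf_act n (inv' p) ` c = c"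
        unfolding comp[OF p p'] comp[OF p' p] permutes_inv_o[OF p] using one[OF c] by simp_all
    qed
    then have "bij_betw (\<phi> p) E E" unfolding \<phi>_def by (subst bij_betw_restrict_eq) 
    then show ?thesis by (simp add: Bij_def \<phi>_def)
  qed
  have "\<phi> \<in> hom (sym_group n) (BijGroup E)"
  proof (rule homI)
    fix p q assume "p \<in> carrier (sym_group n)" "q \<in> carrier (sym_group n)"
    then have pq: "p permutes {1..n}" "q permutes {1..n}" by (simp_all add: sym_group_carrier)
    have "\<phi> (p \<circ> q) = compose E (\<phi> p) (\<phi> q)"
    proof
      fix c show "\<phi> (p \<circ> q) c = compose E (\<phi> p) (\<phi> q) c"
        using cl[OF pq(2), of c] comp[OF pq, of c] by (cases "c \<in> E") (simp_all add: compose_def \<phi>_def)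
    qed
    then show "\<phi> (p \<otimes>\<^bsub>sym_group n\<^esub> q) = \<phi> p \<otimes>\<^bsub>BijGroup E\<^esub> \<phi> q"
      using Bij pq by (simp add: BijGroup_def sym_group_mult)
  qed (use Bij in \<open>auto simp: BijGroup_def sym_group_carrier\<close>)
  then show "group_action (sym_group n) E \<phi>"
    by (intro group_action.intro) (simp add: group_hom_def group_hom_axioms_def sym_group_is_group group_BijGroup)
  assume c: "c \<in> E"
  then obtain \<sigma> \<beta> where w: "(\<sigma>, \<beta>) \<in> bar_symbols n g k" "c = symbol_cell n g h (\<sigma>, \<beta>)" using E by blast
  have "p = id" if p: "p permutes {1..n}" and "\<phi> p c = c" for p
  proof -
    have "symbol_cell n g h (map p \<sigma>, \<beta>) = symbol_cell n g h (\<sigma>, \<beta>)"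
      using that c symbol_cell_permute[OF p w(1) k1] by (simp add: \<phi>_def w(2))
    then have "(map p \<sigma>, \<beta>) = (\<sigma>, \<beta>)" by (rule symbol_cell_inj[OF bar_symbols_permute[OF p w(1)] w(1) k1])
    then show ?thesis using map_permutes_eq_imp[OF p permutes_id w(1) k1] by simp
  qed
  moreover have "\<phi> id c = c" using one[OF c] c by (simp add: \<phi>_def)
  ultimately show "stabilizer (sym_group n) \<phi> c = {\<one>\<^bsub>sym_group n\<^esub>}"
    by (auto simp: stabilizer_def sym_group_carrier sym_group_one permutes_id)
qed

lemma conf_act_skeleton:
  assumes p: "p permutes {1..n}" shows "conf_act n p \<in> skeleton \<rightarrow> skeleton"
proof
  fix c assume c: "c \<in> skeleton"
  have t: "conf_act n p c \<in> topspace X"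
    using subsetD[OF continuous_map_image_subset_topspace[OF continuous_map_conf_act[OF p]]] c skeleton_subset by blast
  have "\<exists>s\<in>{1..n}. relabel n p x s = None" if cx: "c = Some x" for x
  proof -
    obtain s where s: "s \<in> {1..n}" "x s = None" using c cx by (auto simp: skeleton_def)
    then have "p s \<in> {1..n}" using permutes_in_image[OF p] by blast
    then show ?thesis using s permutes_inverses(2)[OF p, of s] by (intro bexI[of _ "p s"]) (simp_all add: relabel_apply)
  qed
  then show "conf_act n p c \<in> skeleton" using t unfolding skeleton_def by (cases c) auto
qed

end

section \<open>The equivariant chain complex\<close>

context rose_config
begin

abbreviation "Sn \<equiv> sym_group n"

lemma finite_group_Sn: "finite_group Sn"
  unfolding finite_group_def finite_group_axioms_def
  using sym_group_is_group finite_permutations[of "{1..n}"] by (simp add: sym_group_def)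

text \<open>The basis elements are the images of one fixed generator of the homology of the disc under the
  characteristic maps. The group permutes these maps, hence also the basis.\<close>

lemma permuted_basis_of_cells:
  assumes cells: "attached_cells Y B k (bar_symbols n g k) char_map"
    and k: "k \<in> {n - 1, n}"
    and m: "m = (k + g - 1) choose k"
    and act: "\<And>s. s permutes {1..n} \<Longrightarrow> continuous_map Y Y (conf_act n s)"
      "\<And>s. s permutes {1..n} \<Longrightarrow> conf_act n s \<in> B \<rightarrow> B"
  shows "\<exists>e \<pi>. permuted_basis Sn (relative_homology_group (int k) Y B) m e \<pi>
    (\<lambda>s. hom_induced (int k) Y B Y B (conf_act n s))"
proof -
  interpret attached_cells Y B k "bar_symbols n g k" char_map by (rule cells)
  let ?M = "relative_homology_group (int k) Y B"
  obtain \<kappa> where \<kappa>: "\<kappa> \<in> iso (relative_homology_group (int k) (disc k) (unit_sphere k)) integer_group"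
    using disc_homology_top by (auto simp: is_iso_def)
  then have "1 \<in> \<kappa> ` carrier (relative_homology_group (int k) (disc k) (unit_sphere k))"
    by (auto simp: iso_def bij_betw_def)
  then obtain \<iota> where \<iota>: "\<iota> \<in> carrier (relative_homology_group (int k) (disc k) (unit_sphere k))" "\<kappa> \<iota> = 1"
    by auto
  let ?e = "\<lambda>w. hom_induced (int k) (disc k) (unit_sphere k) Y B (char_map w) \<iota>"
  obtain \<pi> where \<pi>: "dual_bases ?M (bar_symbols n g k) ?e \<pi>" using cellular_basis[OF \<kappa> \<iota>] by blast
  interpret B: dual_basis ?M "bar_symbols n g k" ?e \<pi>
    using \<pi> by (simp add: dual_basis_def dual_basis_axioms_def)
  obtain b where b: "bij_betw b ({..<m} \<times> carrier Sn) (bar_symbols n g k)"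
    and bs: "\<And>j s t. j < m \<Longrightarrow> s \<in> carrier Sn \<Longrightarrow> t \<in> carrier Sn \<Longrightarrow> b (j, s \<circ> t) = (map s (fst (b (j, t))), snd (b (j, t)))"
    using exists_orbit_labelling[OF n k, of g] unfolding m by blast
  have db: "dual_basis ?M ({..<m} \<times> carrier Sn) (?e \<circ> b) (\<pi> \<circ> b)"
    using B.dual_basis_reindex[OF b] B.comm_group_axioms by (simp add: dual_basis_def dual_basis_axioms_def)
  have act_e: "hom_induced (int k) Y B Y B (conf_act n s) ((?e \<circ> b) (j, t)) = (?e \<circ> b) (j, s \<otimes>\<^bsub>Sn\<^esub> t)"
    if s: "s \<in> carrier Sn" and t: "t \<in> carrier Sn" and j: "j < m" for s t j
  proof -
    have p: "s permutes {1..n}" using s by (simp add: sym_group_carrier)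
    obtain \<sigma> \<beta> where w: "b (j, t) = (\<sigma>, \<beta>)" by force
    have W: "(\<sigma>, \<beta>) \<in> bar_symbols n g k" using b t j w by (force simp: bij_betw_def)
    have "hom_induced (int k) Y B Y B (conf_act n s) (?e (\<sigma>, \<beta>))
      = hom_induced (int k) (disc k) (unit_sphere k) Y B (conf_act n s \<circ> char_map (\<sigma>, \<beta>)) \<iota>"
      using act[OF p] cont[OF W] sphere_to_A[OF W] by (intro hom_induced_compose') auto
    also have "conf_act n s \<circ> char_map (\<sigma>, \<beta>) = char_map (map s \<sigma>, \<beta>)"
      using char_map_permute[OF p W] by (simp add: fun_eq_iff)
    finally show ?thesis using bs[OF j s t] by (simp add: w sym_group_mult)
  qed
  have "permuted_basis Sn ?M m (?e \<circ> b) (\<pi> \<circ> b) (\<lambda>s. hom_induced (int k) Y B Y B (conf_act n s))"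
    unfolding permuted_basis_def permuted_basis_axioms_def
    using finite_group_Sn db act_e by (simp add: hom_induced_hom)
  then show ?thesis by blast
qed

lemma group_hom_hom_induced:
  "group_hom (relative_homology_group p Y B) (relative_homology_group p Z C) (hom_induced p Y B Z C f)"
  by (simp add: group_hom_def group_hom_axioms_def hom_induced_hom)

lemma conf_act_Pi_None: "conf_act n s \<in> {None} \<rightarrow> {None}" by simp

text \<open>The differential is the connecting map of the triple \<open>\<infinity> \<in> A \<subseteq> X\<close>, written in the permuted bases. Its
  kernel and cokernel are found from the exact sequences of the triple and the vanishing of
  \<open>H\<^sub>n(A, \<infinity>)\<close> and \<open>H\<^sub>n\<^sub>-\<^sub>1(X, A)\<close>.\<close>

theorem equivariant_chain_complex:
  "\<exists>d. let R = group_ring Sn; C = two_term R n ((n + g - 1) choose (g - 1)) ((n + g - 2) choose (g - 1))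
     in module_complex R C d \<and>
        (\<forall>p. \<exists>\<phi>\<in>iso (complex_homology C d p) (reduced_homology_group p X).
           \<forall>s\<in>carrier Sn. \<forall>c\<in>carrier (complex_homology C d p).
             \<phi> (homology_smult C p (group_ring_of s) c) = hom_induced p X {} X {} (conf_act n s) (\<phi> c))"
proof -
  let ?A = "subtopology X skeleton"
  let ?H = "\<lambda>p. relative_homology_group p X skeleton"
  let ?L = "\<lambda>p. relative_homology_group p ?A {None}"
  let ?R = "\<lambda>p. relative_homology_group p X {None}"
  let ?m = "(n + g - 1) choose (g - 1)" and ?m' = "(n + g - 2) choose (g - 1)"
  interpret T: attached_cells X skeleton n "bar_symbols n g n" char_map by (rule top_cells)
  interpret L: attached_cells ?A "{None}" "n - 1" "bar_symbols n g (n - 1)" char_map by (rule low_cells)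
  have int: "int (n - 1) = int n - 1" using n by simp
  have act: "continuous_map X X (conf_act n s)" "conf_act n s \<in> skeleton \<rightarrow> skeleton"
    "continuous_map ?A ?A (conf_act n s)" if "s permutes {1..n}" for s
  proof -
    show c: "continuous_map X X (conf_act n s)" and sk: "conf_act n s \<in> skeleton \<rightarrow> skeleton"
      by (rule continuous_map_conf_act[OF that], rule conf_act_skeleton[OF that])
    show "continuous_map ?A ?A (conf_act n s)"
      using c sk by (auto simp: continuous_map_in_subtopology continuous_map_from_subtopology)
  qed
  have m: "?m = (n + g - 1) choose n"
  proof -
    have "n + g - 1 - n = g - 1" by simp
    then show ?thesis using binomial_symmetric[of n "n + g - 1"] g by simp
  qed
  have m': "?m' = (n - 1 + g - 1) choose (n - 1)"
  proof -
    have "n - 1 + g - 1 = n + g - 2" "n + g - 2 - (n - 1) = g - 1" "n - 1 \<le> n + g - 2" using n g by auto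
    then show ?thesis using binomial_symmetric[of "n - 1" "n + g - 2"] by simp
  qed
  obtain e \<pi> where M: "permuted_basis Sn (?H (int n)) ?m e \<pi> (\<lambda>s. hom_induced (int n) X skeleton X skeleton (conf_act n s))"
    using permuted_basis_of_cells[OF top_cells _ m] act by auto
  obtain e' \<pi>' where K: "permuted_basis Sn (?L (int n - 1)) ?m' e' \<pi>' (\<lambda>s. hom_induced (int n - 1) ?A {None} ?A {None} (conf_act n s))"
    using permuted_basis_of_cells[OF low_cells _ m'] act conf_act_Pi_None unfolding int by auto
  let ?bd = "hom_relboundary (int n) X skeleton {None}"
  have sub: "{None} \<subseteq> skeleton" using None_in_skeleton by simp
  have bd_hom: "?bd \<in> hom (?H (int n)) (?L (int n - 1))" by (rule group_homomorphism_hom_relboundary)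
  have bd_act: "?bd (hom_induced (int n) X skeleton X skeleton (conf_act n s) c) = hom_induced (int n - 1) ?A {None} ?A {None} (conf_act n s) (?bd c)"
    if "s \<in> carrier Sn" for s c
  proof -
    have p: "s permutes {1..n}" using that by (simp add: sym_group_carrier)
    show ?thesis
      using fun_cong[OF naturality_hom_induced_relboundary[OF act(1,2)[OF p] conf_act_Pi_None, of "int n"], of c] by simp
  qed
  interpret E: equivariant_map Sn "?H (int n)" ?m e \<pi> "\<lambda>s. hom_induced (int n) X skeleton X skeleton (conf_act n s)"
    "?L (int n - 1)" ?m' e' \<pi>' "\<lambda>s. hom_induced (int n - 1) ?A {None} ?A {None} (conf_act n s)" ?bd
    unfolding equivariant_map_def equivariant_map_axioms_def using M K bd_hom bd_act by auto
  (* A point is contractible, so reduced homology is homology relative to the point at infinity. *)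
  let ?u = "\<lambda>p. hom_induced p X {} X {None} id"
  have u: "?u p \<in> iso (reduced_homology_group p X) (?R p)" for p
    using iso_reduced_homology_by_contractible[of X "{None}" p] contractible_space_subtopology_singleton[of X None] by simp
  let ?v = "\<lambda>p. hom_induced p X {None} X skeleton id"
  let ?i = "\<lambda>p. hom_induced p ?A {None} X {None} id"
  have ex3: "?i p ` carrier (?L p) = kernel (?R p) (?H p) (?v p)" for p
    using exact_seq_image_eq_kernel[OF homology_exactness_triple_3[OF sub, of p X]] .
  have ex1: "?v (int n) ` carrier (?R (int n)) = kernel (?H (int n)) (?L (int n - 1)) ?bd"
    using exact_seq_image_eq_kernel[OF homology_exactness_triple_1[OF sub, of "int n" X]] .
  have ex2: "?bd ` carrier (?H (int n)) = kernel (?L (int n - 1)) (?R (int n - 1)) (?i (int n - 1))"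
    using exact_seq_image_eq_kernel[OF homology_exactness_triple_2[OF sub, of "int n" X]] .
  have L0: "carrier (?L p) = {\<one>\<^bsub>?L p\<^esub>}" if "p \<noteq> int n - 1" for p
    using L.other_degrees[of p] that int by (simp add: trivial_group_def)
  have H0: "carrier (?H p) = {\<one>\<^bsub>?H p\<^esub>}" if "p \<noteq> int n" for p
    using T.other_degrees[OF that] by (simp add: trivial_group_def)
  have v_inj: "inj_on (?v p) (carrier (?R p))" if "p \<noteq> int n - 1" for p
  proof -
    interpret v: group_hom "?R p" "?H p" "?v p" by (rule group_hom_hom_induced)
    have "kernel (?R p) (?H p) (?v p) = {\<one>\<^bsub>?R p\<^esub>}"
      using ex3[of p] L0[OF that] hom_one[OF hom_induced_hom[of p ?A "{None}" X "{None}" id]] by simp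
    then show ?thesis by (simp only: v.inj_iff_trivial_ker)
  qed
  have i_surj: "?i p ` carrier (?L p) = carrier (?R p)" if "p \<noteq> int n" for p
    unfolding ex3 kernel_def using hom_induced_carrier[of p X "{None}" X skeleton id] H0[OF that] by auto
  let ?q = "hom_induced (int n) X {} X skeleton id"
  have q_eq: "?q c = ?v (int n) (?u (int n) c)" for c
    using sub by (subst hom_induced_compose') auto
  let ?r = "inv_into (carrier (reduced_homology_group (int n - 1) X)) (?u (int n - 1)) \<circ> ?i (int n - 1)"
  have u_inv: "inv_into (carrier (reduced_homology_group p X)) (?u p) \<in> iso (?R p) (reduced_homology_group p X)" for p
    by (rule group.iso_set_sym[OF group_reduced_homology_group u])
  show ?thesis
    unfolding Let_def
  proof (rule E.two_term_homology)
    show "group (reduced_homology_group p X)" for p by simp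
    show "hom_induced p X {} X {} (conf_act n s) \<in> hom (reduced_homology_group p X) (reduced_homology_group p X)" for p s
      by (rule hom_induced_reduced_hom)
    show "trivial_group (reduced_homology_group p X)" if "p \<noteq> int n" "p \<noteq> int n - 1" for p
    proof -
      have "carrier (?R p) = {\<one>\<^bsub>?R p\<^esub>}"
        using i_surj[OF that(1)] L0[OF that(2)] hom_one[OF hom_induced_hom[of p ?A "{None}" X "{None}" id]] by simp
      then have "trivial_group (?R p)" by (simp add: trivial_group_def)
      then show ?thesis using isomorphic_group_triviality[OF is_isoI[OF u[of p]]] by simp
    qed
    show "?q \<in> hom (reduced_homology_group (int n) X) (?H (int n))"
    proof -
      have "?q = ?v (int n) \<circ> ?u (int n)" by (simp add: fun_eq_iff q_eq)
      then show ?thesis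
        using Group.hom_compose[OF iso_imp_homomorphism[OF u[of "int n"]] hom_induced_hom] by simp
    qed
    show "inj_on ?q (carrier (reduced_homology_group (int n) X))"
    proof -
      have "inj_on (?v (int n) \<circ> ?u (int n)) (carrier (reduced_homology_group (int n) X))"
        using v_inj[of "int n"] u[of "int n"] by (intro comp_inj_on) (auto simp: iso_def bij_betw_def)
      then show ?thesis by (simp add: inj_on_def q_eq)
    qed
    show "?q ` carrier (reduced_homology_group (int n) X) = kernel (?H (int n)) (?L (int n - 1)) ?bd"
    proof -
      have "?u (int n) ` carrier (reduced_homology_group (int n) X) = carrier (?R (int n))"
        using u[of "int n"] by (simp add: iso_def bij_betw_def)
      then show ?thesis unfolding ex1[symmetric] by (metis (no_types, lifting) image_cong image_image q_eq)
    qed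
    show "?q (hom_induced (int n) X {} X {} (conf_act n s) x) = hom_induced (int n) X skeleton X skeleton (conf_act n s) (?q x)"
      if "s \<in> carrier Sn" for s x
      using act[of s] that by (simp add: sym_group_carrier hom_induced_compose')
    show "?r \<in> hom (?L (int n - 1)) (reduced_homology_group (int n - 1) X)"
      by (rule Group.hom_compose[OF hom_induced_hom iso_imp_homomorphism[OF u_inv]])
    have inv_bij: "bij_betw (inv_into (carrier (reduced_homology_group (int n - 1) X)) (?u (int n - 1))) (carrier (?R (int n - 1))) (carrier (reduced_homology_group (int n - 1) X))"
      using u_inv[of "int n - 1"] by (simp add: iso_def)
    show "?r ` carrier (?L (int n - 1)) = carrier (reduced_homology_group (int n - 1) X)"
      unfolding image_comp[symmetric] using i_surj[of "int n - 1"] inv_bij by (simp add: bij_betw_def)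
    show "kernel (?L (int n - 1)) (reduced_homology_group (int n - 1) X) ?r = ?bd ` carrier (?H (int n))"
    proof -
      have "?r c = \<one>\<^bsub>reduced_homology_group (int n - 1) X\<^esub> \<longleftrightarrow> ?i (int n - 1) c = \<one>\<^bsub>?R (int n - 1)\<^esub>" for c
      proof -
        have one: "inv_into (carrier (reduced_homology_group (int n - 1) X)) (?u (int n - 1)) \<one>\<^bsub>?R (int n - 1)\<^esub> = \<one>\<^bsub>reduced_homology_group (int n - 1) X\<^esub>"
          by (rule hom_one[OF iso_imp_homomorphism[OF u_inv]]) simp_all
        have "\<one>\<^bsub>?R (int n - 1)\<^esub> \<in> carrier (?R (int n - 1))"
          using group.is_monoid[OF group_relative_homology_group] by (rule monoid.one_closed)
        note eq = inj_on_eq_iff[OF bij_betw_imp_inj_on[OF inv_bij] hom_induced_carrier this]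
        show ?thesis unfolding comp_apply one[symmetric] by (rule eq)
      qed
      then show ?thesis unfolding ex2 kernel_def by simp
    qed
    show "?r (hom_induced (int n - 1) ?A {None} ?A {None} (conf_act n s) x) = hom_induced (int n - 1) X {} X {} (conf_act n s) (?r x)"
      if s: "s \<in> carrier Sn" for s x
    proof -
      let ?p = "int n - 1"
      have a: "continuous_map X X (conf_act n s)" "continuous_map ?A ?A (conf_act n s)"
        using act[of s] s by (simp_all add: sym_group_carrier)
      have rx: "?r x \<in> carrier (reduced_homology_group ?p X)" "?u ?p (?r x) = ?i ?p x"
      proof -
        have ix: "?i ?p x \<in> carrier (?R ?p)" by (rule hom_induced_carrier)
        also have "carrier (?R ?p) = ?u ?p ` carrier (reduced_homology_group ?p X)"
          using u[of ?p] by (simp add: iso_def bij_betw_def)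
        finally have im: "?i ?p x \<in> ?u ?p ` carrier (reduced_homology_group ?p X)" .
        show "?r x \<in> carrier (reduced_homology_group ?p X)"
          unfolding comp_apply by (rule inv_into_into[OF im])
        show "?u ?p (?r x) = ?i ?p x"
          unfolding comp_apply by (rule f_inv_into_f[OF im])
      qed
      have "?i ?p (hom_induced ?p ?A {None} ?A {None} (conf_act n s) x) = hom_induced ?p X {None} X {None} (conf_act n s) (?i ?p x)"
        using a by (simp add: hom_induced_compose' continuous_map_from_subtopology)
      also have "\<dots> = hom_induced ?p X {None} X {None} (conf_act n s) (?u ?p (?r x))" by (simp only: rx(2))
      also have "\<dots> = ?u ?p (hom_induced ?p X {} X {} (conf_act n s) (?r x))"
        using a by (simp add: hom_induced_compose')
      finally have "?r (hom_induced ?p ?A {None} ?A {None} (conf_act n s) x)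
        = inv_into (carrier (reduced_homology_group ?p X)) (?u ?p) (?u ?p (hom_induced ?p X {} X {} (conf_act n s) (?r x)))" by simp
      also have "\<dots> = hom_induced ?p X {} X {} (conf_act n s) (?r x)"
        using hom_induced_reduced[OF rx(1)] u[of ?p] by (intro inv_into_f_f) (auto simp: iso_def bij_betw_def)
      finally show ?thesis .
    qed
  qed
qed

end

theorem lemma2p4:
  fixes g n :: nat and h :: "real \<Rightarrow> (nat \<times> complex) option"
  assumes "g \<ge> 1" and "n \<ge> 1"
    and "petal_homeo g h"
  shows
    "CW_decomposition (Conf_plus n (rose g)) (all_cells n g h) \<and>
     card (symbol_cells n g h n) = fact n * ((n + g - 1) choose (g - 1)) \<and>
     card (symbol_cells n g h (n - 1)) = fact n * ((n + g - 2) choose (n - 1)) \<and>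
     (\<forall>k\<in>{n - 1, n}.
        bij_betw (symbol_cell n g h) (bar_symbols n g k) (symbol_cells n g h k) \<and>
        group_action (sym_group n) (symbol_cells n g h k)
          (\<lambda>p. \<lambda>c\<in>symbol_cells n g h k. conf_act n p ` c) \<and>
        (\<forall>c\<in>symbol_cells n g h k.
           stabilizer (sym_group n) (\<lambda>p. \<lambda>c\<in>symbol_cells n g h k. conf_act n p ` c) c
             = {\<one>\<^bsub>sym_group n\<^esub>})) \<and>
     (\<exists>d. let R = group_ring (sym_group n);
              C = two_term R n ((n + g - 1) choose (g - 1)) ((n + g - 2) choose (g - 1))
          in module_complex R C d \<and>
             (\<forall>p. \<exists>\<phi>\<in>iso (complex_homology C d p)
                          (reduced_homology_group p (Conf_plus n (rose g))).
                \<forall>s\<in>carrier (sym_group n). \<forall>c\<in>carrier (complex_homology C d p).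
                  \<phi> (homology_smult C p (group_ring_of s) c) =
                  hom_induced p (Conf_plus n (rose g)) {} (Conf_plus n (rose g)) {}
                    (conf_act n s) (\<phi> c)))"
proof -
  interpret rose_config g n h using assms by unfold_locales
  have c1: "card (symbol_cells n g h n) = fact n * ((n + g - 1) choose (g - 1))"
  proof -
    have "n + g - 1 - n = g - 1" by simp
    then show ?thesis using card_symbol_cells[of n] binomial_symmetric[of n "n + g - 1"] assms(1) by simp
  qed
  have c2: "card (symbol_cells n g h (n - 1)) = fact n * ((n + g - 2) choose (n - 1))"
  proof -
    have "n - 1 + g - 1 = n + g - 2" using assms by simp
    then show ?thesis using card_symbol_cells[of "n - 1"] by simp
  qed
  have "bij_betw (symbol_cell n g h) (bar_symbols n g k) (symbol_cells n g h k)" if "k \<in> {n - 1, n}" for k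
    using that by (intro symbol_cell_bij) auto
  then show ?thesis
    using CW_decomposition_Conf_plus c1 c2 cells_action equivariant_chain_complex by blast
qed

end
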